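(* Fix $\gamma\in[0,1/2)$ and let $\beta_c=\frac14-\frac\gamma2$. Let $(\beta_n)_{n\ge1}$ be a sequence of positive reals with $\beta_n\to\beta_c$ and $4\beta_c(\beta_n-\beta_c)(\log n)^2\to\alpha\in[-\infty,\infty]$. Then, with $|\mathscr L_n|$ taken under $\mathbb P^{\beta_n}$: (a) if $\alpha\in[-\infty,0)$, then $|\mathscr L_n|\asymp \sqrt{|\beta_n-\beta_c|}\; n^{1/2-\sqrt{4\beta_c|\beta_n-\beta_c|}}$; (b) if $\alpha\in(-\infty,\pi^2)$, then $|\mathscr L_n|\asymp\sqrt n/\log n$; (c) if $\alpha\in[\pi^2,\infty]$, then $|\mathscr L_n|\gg\sqrt n/\log n$.
   Context: $\gamma$-growing random graph with parameter $\beta>0$: the random graph $\mathscr G_n$ on vertex set $[n]=\{1,\dots,n\}$ in which, independently over pairs $i<j$, the edge $\{i,j\}$ is present with probability $p_{ij}=\min(\beta\, i^{-\gamma}j^{\gamma-1},1)$; $\mathbb P^\beta$ denotes its law. $\mathscr L_n$ is the largest connected component of $\mathscr G_n$ (arbitrary tie-breaking), $|\mathscr L_n|$ its number of vertices. Under $\mathbb P^{\beta_n}$ all edges of $\mathscr G_n$ are generated with the same parameter $\beta=\beta_n$. For random variables $X_n$ and numbers $a_n$ (positive for all large $n$): $X_n\gg a_n$ means $X_n/a_n\to\infty$ in probability; $X_n\asymp a_n$ means that $(X_n/a_n)$ is tight on $(0,\infty)$, i.e. there is $n_0$ with $\lim_{M\to\infty}\inf_{n\ge n_0}\mathbb P(1/M\le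 X_n/a_n\le M)=1$. *)

theory Defs
  imports "HOL-Probability.Probability" "HOL-Library.Extended_Real"
begin

definition edge_prob :: "real \<Rightarrow> real \<Rightarrow> nat \<Rightarrow> nat \<Rightarrow> real" where
  "edge_prob \<gamma> \<beta> i j = min (\<beta> * real i powr (-\<gamma>) * real j powr (\<gamma> - 1)) 1"

definition vertex_pairs :: "nat \<Rightarrow> (nat \<times> nat) set" where
  "vertex_pairs n = {(i, j). 1 \<le> i \<and> i < j \<and> j \<le> n}"

text \<open>The law of the random graph on \<open>{1..n}\<close>, as a distribution over its edge set; an edge is a
  two-element set of vertices, and the edge indicators are independent over pairs \<open>i < j\<close>.\<close>

definition growing_graph :: "real \<Rightarrow> real \<Rightarrow> nat \<Rightarrow> nat set set pmf" where
  "growing_graph \<gamma> \<beta> n =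
     map_pmf (\<lambda>\<omega>. {{i, j} | i j. (i, j) \<in> vertex_pairs n \<and> \<omega> (i, j)})
       (Pi_pmf (vertex_pairs n) False (\<lambda>(i, j). bernoulli_pmf (edge_prob \<gamma> \<beta> i j)))"

definition graph_components :: "'v set \<Rightarrow> 'v set set \<Rightarrow> 'v set set" where
  "graph_components V E = V // {(u, v). u \<in> V \<and> v \<in> V \<and> {u, v} \<in> E}\<^sup>*"

text \<open>Ties are broken by the choice operator hidden in \<^const>\<open>arg_max\<close>.\<close>

definition largest_component :: "'v set \<Rightarrow> 'v set set \<Rightarrow> 'v set" where
  "largest_component V E = (ARG_MAX card C. C \<in> graph_components V E)"

definition beta_crit :: "real \<Rightarrow> real" where
  "beta_crit \<gamma> = 1/4 - \<gamma>/2"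

text \<open>The random variables \<open>X n\<close> may live on different probability spaces \<open>M n\<close>. Divergence of
  \<open>X n / a n\<close> to infinity in probability:\<close>

definition prob_much_greater ::
    "(nat \<Rightarrow> 'a measure) \<Rightarrow> (nat \<Rightarrow> 'a \<Rightarrow> real) \<Rightarrow> (nat \<Rightarrow> real) \<Rightarrow> bool" where
  "prob_much_greater M X a \<longleftrightarrow>
     (\<forall>K::real. (\<lambda>n. measure (M n) {\<omega> \<in> space (M n). X n \<omega> / a n > K}) \<longlonglongrightarrow> 1)"

text \<open>Tightness of \<open>X n / a n\<close> on the open half-line \<open>(0, \<infinity>)\<close>, from some index on:\<close>

definition prob_same_order ::
    "(nat \<Rightarrow> 'a measure) \<Rightarrow> (nat \<Rightarrow> 'a \<Rightarrow> real) \<Rightarrow> (nat \<Rightarrow> real) \<Rightarrow> bool" where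
  "prob_same_order M X a \<longleftrightarrow>
     (\<exists>n0. ((\<lambda>K::real. INF n\<in>{n0..}.
        measure (M n) {\<omega> \<in> space (M n). 1 / K \<le> X n \<omega> / a n \<and> X n \<omega> / a n \<le> K})
        \<longlongrightarrow> 1) at_top)"

end

theory Submission
  imports Defs
begin

text \<open>Put \<open>a = 1/2 - \<gamma>\<close>. With vertices on the logarithmic scale, the expected number of edges between
  two vertices becomes the kernel \<open>\<beta> * exp (- a * \<bar>x - y\<bar>)\<close> on \<open>[0, ln n]\<close>, whose harmonic functions
  solve \<open>f'' = \<mu> * f\<close> with \<open>\<mu> = a\<^sup>2 - 2 * a * \<beta> = - 4 * beta_crit \<gamma> * (\<beta> - beta_crit \<gamma>)\<close>. If \<open>S\<close> is the solution with
  \<open>S 0 = 0\<close> and \<open>S' 0 = 1\<close>, a hyperbolic sine below and a sine above criticality, then the largest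
  component has order \<open>sqrt n / S (ln n)\<close>, as long as \<open>ln n\<close> stays away from the first positive zero of \<open>S\<close>; this is where
  \<open>\<pi>\<^sup>2\<close> comes from.

  Exploring a cluster one vertex at a time shows that \<open>1 + v\<close> bounds an exponential moment of the
  cluster whenever \<open>v\<close> is a supersolution of the nonlinear equation for branching processes. Small
  multiples of corrected harmonic functions are such supersolutions, and the bounds for the
  clusters of their oldest vertices \<open>k\<close> are summable in \<open>k\<close>. Dually, a subsolution bounds the Laplace
  transform of the cluster of many old vertices, up to the loss from exploring without
  replacement, whose expectation is small if these vertices are sparse.\<close>

subsection \<open>Exploring a cluster\<close>

text \<open>The edge probability is \<open>\<beta>\<close> times \<open>1 / sqrt (i * j)\<close>
  times the kernel, so every function carries a factor \<open>exp (- z / 2)\<close> that removes the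
  square root. Convolution over a finite interval reproduces a solution of
  \<open>f'' = \<mu> * f\<close> only up to two boundary terms. The one at 0 can be cancelled by the
  ratio of value and slope there. The one at the right end cannot: it has the size of
  \<open>S (ln n)\<close>, and it is what a supersolution can afford to put as a weight on every
  vertex, about \<open>S (ln n) / sqrt n\<close> each. This yields an exponential moment of the
  number of vertices, hence the order \<open>sqrt n / S (ln n)\<close>. A subsolution has to be
  charged an amount of the same order, which gives the matching lower bound. The slack for the
  nonlinearity and the discretisation comes from the auxiliary function
  \<open>exp (- a / 4 * z)\<close>, which the convolution enlarges by a factor of about 16/15. In
  the critical window monotonicity in \<beta> leads to parameters whose \<open>\<mu>\<close> is plus
  or minus the square of \<open>x / ln n\<close>; then \<open>S (ln n)\<close> is a constant
  multiple of \<open>ln n\<close>.\<close>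

abbreviation edge_index :: "nat \<Rightarrow> nat \<Rightarrow> nat \<times> nat" where
  "edge_index i j \<equiv> (min i j, max i j)"

definition adj :: "(nat \<times> nat \<Rightarrow> bool) \<Rightarrow> nat \<Rightarrow> nat \<Rightarrow> bool" where
  "adj \<omega> i j \<longleftrightarrow> i \<noteq> j \<and> \<omega> (edge_index i j)"

definition pairs :: "nat set \<Rightarrow> (nat \<times> nat) set" where
  "pairs V = {(i, j). i \<in> V \<and> j \<in> V \<and> i < j}"

text \<open>\<open>A\<close> holds the vertices found but not yet explored, \<open>U\<close> those
  not yet seen. Explored vertices belong to neither set, so their edges are never inspected
  again.\<close>

definition cluster :: "nat set \<Rightarrow> nat set \<Rightarrow> (nat \<times> nat \<Rightarrow> bool) \<Rightarrow> nat set" where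
  "cluster A U \<omega> = {(u, v). u \<in> A \<union> U \<and> v \<in> A \<union> U \<and> adj \<omega> u v}\<^sup>* `` A"

definition edge_pmf :: "('e \<Rightarrow> real) \<Rightarrow> 'e set \<Rightarrow> ('e \<Rightarrow> bool) pmf" where
  "edge_pmf p Z = Pi_pmf Z False (\<lambda>e. bernoulli_pmf (p e))"

definition link :: "(nat \<times> nat \<Rightarrow> real) \<Rightarrow> nat \<Rightarrow> nat \<Rightarrow> real" where
  "link p i j = (if i = j then 0 else p (edge_index i j))"

lemma adj_commute: "adj \<omega> i j = adj \<omega> j i"
  by (auto simp: adj_def min.commute max.commute)

lemma edge_index_in_pairs: "i \<in> V \<Longrightarrow> j \<in> V \<Longrightarrow> i \<noteq> j \<Longrightarrow> edge_index i j \<in> pairs V"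
  by (auto simp: pairs_def min_def max_def)

lemma cluster_superset: "A \<subseteq> cluster A U \<omega>"
  by (auto simp: cluster_def)

lemma cluster_subset: "cluster A U \<omega> \<subseteq> A \<union> U"
proof
  fix y assume "y \<in> cluster A U \<omega>"
  then obtain x where "x \<in> A" "(x, y) \<in> {(u, v). u \<in> A \<union> U \<and> v \<in> A \<union> U \<and> adj \<omega> u v}\<^sup>*"
    by (auto simp: cluster_def)
  from this(2,1) show "y \<in> A \<union> U"
    by (cases rule: rtranclE) auto
qed

lemma cluster_empty [simp]: "cluster {} U \<omega> = {}"
  by (simp add: cluster_def)

lemma finite_cluster: "finite A \<Longrightarrow> finite U \<Longrightarrow> finite (cluster A U \<omega>)"
  using cluster_subset[of A U \<omega>] by (auto intro: finite_subset)

lemma cluster_cong: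
  assumes "\<And>e. e \<in> pairs (A \<union> U) \<Longrightarrow> \<omega> e = \<omega>' e"
  shows "cluster A U \<omega> = cluster A U \<omega>'"
proof -
  have "adj \<omega> u v = adj \<omega>' u v" if "u \<in> A \<union> U" "v \<in> A \<union> U" for u v
    using assms[OF edge_index_in_pairs[of u _ v]] that unfolding adj_def by blast
  then show ?thesis
    unfolding cluster_def by (intro arg_cong2[where f = Image] arg_cong[where f = rtrancl]) auto
qed

text \<open>A path that passes through \<open>i\<close> can be cut at its last visit there: it goes
  on from a vertex of \<open>A\<close> or from a newly found neighbour. Edges from \<open>i\<close>
  to the rest of \<open>A\<close> reveal nothing, since those vertices are sources already.\<close>

lemma cluster_step:
  fixes \<omega> :: "nat \<times> nat \<Rightarrow> bool"
  assumes "i \<in> A" "A \<inter> U = {}"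
  defines "N \<equiv> {j \<in> U. adj \<omega> i j}"
  shows "cluster A U \<omega> = insert i (cluster (A - {i} \<union> N) (U - N) \<omega>)"
proof -
  define R where "R = {(u, v). u \<in> A \<union> U \<and> v \<in> A \<union> U \<and> adj \<omega> u v}"
  define V' where "V' = A - {i} \<union> N \<union> (U - N)"
  define R' where "R' = {(u, v). u \<in> V' \<and> v \<in> V' \<and> adj \<omega> u v}"
  have V': "V' = A \<union> U - {i}"
    using assms by (auto simp: V'_def)
  have sub: "R' \<subseteq> R"
    by (auto simp: R_def R'_def V')
  have cl: "cluster A U \<omega> = R\<^sup>* `` A" and cl': "cluster (A - {i} \<union> N) (U - N) \<omega> = R'\<^sup>* `` (A - {i} \<union> N)"
    by (simp_all add: cluster_def R_def R'_def V'_def)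
  show ?thesis
  proof (intro equalityI subsetI)
    fix y assume "y \<in> cluster A U \<omega>"
    then obtain x where x: "x \<in> A" "(x, y) \<in> R\<^sup>*"
      by (auto simp: cl)
    from x(2) show "y \<in> insert i (cluster (A - {i} \<union> N) (U - N) \<omega>)"
    proof (induction rule: rtrancl_induct)
      case base
      then show ?case using x(1) by (auto simp: cl')
    next
      case (step y z)
      show ?case
      \<comment> \<open>A path step that touches \<open>i\<close> ends in \<open>i\<close> or in a
        source of the remaining exploration, so the argument can restart there.\<close>
      proof (cases "y = i \<or> z = i")
        case True
        then have "z = i \<or> z \<in> A - {i} \<union> N"
          using step(2) by (auto simp: R_def N_def)
        then show ?thesis by (auto simp: cl')
      next
        case False
        then have "(y, z) \<in> R'"
          using step(2) by (auto simp: R_def R'_def V')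
        moreover have "y \<in> R'\<^sup>* `` (A - {i} \<union> N)"
          using False step(3) by (auto simp: cl')
        ultimately show ?thesis
          unfolding cl' by (auto intro: rtrancl_into_rtrancl)
      qed
    qed
  next
    fix y assume "y \<in> insert i (cluster (A - {i} \<union> N) (U - N) \<omega>)"
    then consider "y = i" | x where "x \<in> A - {i} \<union> N" "(x, y) \<in> R'\<^sup>*"
      by (auto simp: cl')
    then show "y \<in> cluster A U \<omega>"
    proof cases
      case 1
      then show ?thesis using assms(1) cluster_superset by blast
    next
      case 2
      have xy: "(x, y) \<in> R\<^sup>*"
        using 2(2) rtrancl_mono[OF sub] by blast
      show ?thesis
      proof (cases "x \<in> A")
        case True
        then show ?thesis using xy by (auto simp: cl)
      next
        case False
        then have "(i, x) \<in> R"
          using 2(1) assms(1) by (auto simp: R_def N_def)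
        then show ?thesis using xy assms(1) unfolding cl
          by (meson ImageI converse_rtrancl_into_rtrancl)
      qed
    qed
  qed
qed

section \<open>The product measure on edges\<close>

lemma finite_set_edge_pmf: "finite Z \<Longrightarrow> finite (set_pmf (edge_pmf p Z))"
  unfolding edge_pmf_def by (rule finite_subset[OF set_Pi_pmf_subset']) (auto intro!: finite_PiE_dflt)

lemma integrable_edge_pmf [simp]:
  "finite Z \<Longrightarrow> integrable (measure_pmf (edge_pmf p Z)) (f :: _ \<Rightarrow> real)"
  by (intro integrable_measure_pmf_finite finite_set_edge_pmf)

lemma expectation_edge_pmf_mono:
  fixes f g :: "_ \<Rightarrow> real"
  assumes "finite Z" "\<And>\<omega>. f \<omega> \<le> g \<omega>"
  shows "measure_pmf.expectation (edge_pmf p Z) f \<le> measure_pmf.expectation (edge_pmf p Z) g"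
  using assms by (intro integral_mono) auto

lemma expectation_edge_pmf_Un:
  fixes f :: "_ \<Rightarrow> real"
  assumes "finite X" "finite Y" "X \<inter> Y = {}"
  shows "measure_pmf.expectation (edge_pmf p (X \<union> Y)) f =
    measure_pmf.expectation (edge_pmf p X) (\<lambda>\<omega>1.
      measure_pmf.expectation (edge_pmf p Y) (\<lambda>\<omega>2. f (\<lambda>e. if e \<in> X then \<omega>1 e else \<omega>2 e)))"
proof -
  have "edge_pmf p (X \<union> Y) = bind_pmf (edge_pmf p X) (\<lambda>\<omega>1.
      map_pmf (\<lambda>\<omega>2. \<lambda>e. if e \<in> X then \<omega>1 e else \<omega>2 e) (edge_pmf p Y))"
    unfolding edge_pmf_def Pi_pmf_union[OF assms]
    by (simp add: pair_pmf_def map_bind_pmf map_pmf_def bind_assoc_pmf bind_return_pmf)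
  then show ?thesis
    using finite_set_edge_pmf[OF assms(1)] finite_set_edge_pmf[OF assms(2)]
    by (simp add: pmf_expectation_bind[of "set_pmf (edge_pmf p X)"]
        integral_measure_pmf[of "set_pmf (edge_pmf p X)"])
qed

text \<open>This is the generating functional of the neighbours revealed by \<open>i\<close>. Its
  edges to \<open>U\<close> have distinct indices, hence are independent; \<open>other\<close>
  recovers the far end from the index.\<close>

lemma expectation_star:
  fixes g :: "nat \<Rightarrow> real"
  assumes "finite U" "i \<notin> U" "\<And>e. 0 \<le> p e" "\<And>e. p e \<le> 1" "\<And>j. 0 \<le> g j"
  shows "measure_pmf.expectation (edge_pmf p (edge_index i ` U)) (\<lambda>\<omega>. \<Prod>j\<in>{j \<in> U. adj \<omega> i j}. g j) =
    (\<Prod>j\<in>U. 1 + p (edge_index i j) * (g j - 1))"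
proof -
  define other where "other e = (if fst e = i then snd e else fst e)" for e :: "nat \<times> nat"
  have other: "other (edge_index i j) = j" if "j \<in> U" for j
    using that assms(2) by (auto simp: other_def min_def max_def)
  have inj: "inj_on (edge_index i) U"
    by (rule inj_on_inverseI[of _ other]) (rule other)
  have "(\<Prod>j\<in>{j \<in> U. adj \<omega> i j}. g j) = (\<Prod>e\<in>edge_index i ` U. if \<omega> e then g (other e) else 1)" for \<omega>
  proof -
    have "(\<Prod>j\<in>{j \<in> U. adj \<omega> i j}. g j) = (\<Prod>j\<in>U. if adj \<omega> i j then g j else 1)"
      using assms(1) by (simp add: prod.inter_filter)
    also have "\<dots> = (\<Prod>j\<in>U. if \<omega> (edge_index i j) then g (other (edge_index i j)) else 1)"
      using assms(2) other by (intro prod.cong) (auto simp: adj_def)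
    finally show ?thesis
      by (simp only: prod.reindex[OF inj] o_def)
  qed
  then have "measure_pmf.expectation (edge_pmf p (edge_index i ` U)) (\<lambda>\<omega>. \<Prod>j\<in>{j \<in> U. adj \<omega> i j}. g j)
     = (\<Prod>e\<in>edge_index i ` U. measure_pmf.expectation (bernoulli_pmf (p e)) (\<lambda>b. if b then g (other e) else 1))"
    unfolding edge_pmf_def using assms
    by (simp only:) (subst expectation_prod_Pi_pmf, auto intro!: integrable_measure_pmf_finite)
  also have "\<dots> = (\<Prod>j\<in>U. 1 + p (edge_index i j) * (g j - 1))"
    unfolding prod.reindex[OF inj] o_def using assms other
    by (intro prod.cong) (simp_all add: algebra_simps)
  finally show ?thesis .
qed

text \<open>The index set \<open>Z\<close> may be larger than \<open>pairs (A \<union> U)\<close>, so that the step can be iterated without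
  restricting the product measure to the edges that are still relevant.\<close>

lemma expectation_cluster_step:
  fixes f :: "nat set \<Rightarrow> real"
  assumes "finite Z" "pairs (A \<union> U) \<subseteq> Z" "i \<in> A" "A \<inter> U = {}" "finite U"
  shows "measure_pmf.expectation (edge_pmf p Z) (\<lambda>\<omega>. f (cluster A U \<omega>)) =
    measure_pmf.expectation (edge_pmf p (edge_index i ` U)) (\<lambda>\<omega>1.
      measure_pmf.expectation (edge_pmf p (Z - edge_index i ` U)) (\<lambda>\<omega>2.
        f (insert i (cluster (A - {i} \<union> {j \<in> U. adj \<omega>1 i j}) (U - {j \<in> U. adj \<omega>1 i j}) \<omega>2))))"
proof -
  define X where "X = edge_index i ` U"
  have X: "finite X" "X \<subseteq> Z" "i \<notin> U"
    using assms edge_index_in_pairs[of i "A \<union> U"] unfolding X_def by blast+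
  have eq: "cluster A U (\<lambda>e. if e \<in> X then \<omega>1 e else \<omega>2 e) =
      insert i (cluster (A - {i} \<union> {j \<in> U. adj \<omega>1 i j}) (U - {j \<in> U. adj \<omega>1 i j}) \<omega>2)" for \<omega>1 \<omega>2
  proof -
    let ?\<omega> = "\<lambda>e. if e \<in> X then \<omega>1 e else \<omega>2 e"
    have N: "{j \<in> U. adj ?\<omega> i j} = {j \<in> U. adj \<omega>1 i j}"
      by (auto simp: adj_def X_def)
    have "cluster (A - {i} \<union> {j \<in> U. adj \<omega>1 i j}) (U - {j \<in> U. adj \<omega>1 i j}) ?\<omega> =
          cluster (A - {i} \<union> {j \<in> U. adj \<omega>1 i j}) (U - {j \<in> U. adj \<omega>1 i j}) \<omega>2"
      using X(3) by (intro cluster_cong) (auto simp: pairs_def X_def min_def max_def split: if_splits)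
    then show ?thesis
      using cluster_step[OF assms(3,4), of ?\<omega>] by (simp only: N)
  qed
  have "Z = X \<union> (Z - X)" using X by auto
  then have "measure_pmf.expectation (edge_pmf p Z) (\<lambda>\<omega>. f (cluster A U \<omega>)) =
      measure_pmf.expectation (edge_pmf p (X \<union> (Z - X))) (\<lambda>\<omega>. f (cluster A U \<omega>))"
    by simp
  also have "\<dots> = measure_pmf.expectation (edge_pmf p X) (\<lambda>\<omega>1.
      measure_pmf.expectation (edge_pmf p (Z - X)) (\<lambda>\<omega>2. f (cluster A U (\<lambda>e. if e \<in> X then \<omega>1 e else \<omega>2 e))))"
    using X assms by (subst expectation_edge_pmf_Un) auto
  finally show ?thesis
    by (simp only: eq) (simp only: X_def)
qed

text \<open>Exploring \<open>i\<close> replaces the factor \<open>u i\<close> by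
  \<open>exp (w i)\<close> times the factors of the vertices found. By
  \<open>1 + x \<le> exp x\<close> the mean of this is at most the left side of
  \<open>super\<close>. Vertices seen before drop out of the sum, which only helps because
  \<open>1 \<le> u\<close>.\<close>

lemma cluster_exp_upper:
  fixes u w :: "nat \<Rightarrow> real"
  assumes "finite Z" "finite U\<^sub>0" "\<And>e. 0 \<le> p e" "\<And>e. p e \<le> 1" "\<And>j. j \<in> V \<Longrightarrow> 1 \<le> u j"
    and super: "\<And>i. i \<in> V \<Longrightarrow> exp (w i + (\<Sum>j\<in>U\<^sub>0. link p i j * (u j - 1))) \<le> u i"
  assumes "finite A" "U \<subseteq> U\<^sub>0" "A \<union> U \<subseteq> V" "U\<^sub>0 \<subseteq> V" "A \<inter> U = {}" "pairs (A \<union> U) \<subseteq> Z"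
  shows "measure_pmf.expectation (edge_pmf p Z) (\<lambda>\<omega>. exp (\<Sum>j\<in>cluster A U \<omega>. w j)) \<le> (\<Prod>j\<in>A. u j)"
  using assms(1,7-)
proof (induction "card (A \<union> U)" arbitrary: A U Z rule: less_induct)
  case less
  show ?case
  proof (cases "A = {}")
    case True
    then show ?thesis by simp
  next
    case False
    then obtain i where i: "i \<in> A" by auto
    let ?N = "\<lambda>\<omega>. {j \<in> U. adj \<omega> i j}"
    let ?X = "edge_index i ` U"
    \<comment> \<open>The truncation extends nonnegativity from \<open>V\<close> to all indices, as
      \<open>expectation_star\<close> requires.\<close>
    define u' where "u' j = max 1 (u j)" for j
    have u': "u' j = u j" if "j \<in> V" for j
      using assms(5)[OF that] by (simp add: u'_def)
    have finU: "finite U" using less assms(2) finite_subset by auto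
    have iU: "i \<notin> U" using i less by auto
    have inner: "measure_pmf.expectation (edge_pmf p (Z - ?X)) (\<lambda>\<omega>2.
        exp (\<Sum>j\<in>insert i (cluster (A - {i} \<union> ?N \<omega>1) (U - ?N \<omega>1) \<omega>2). w j))
      \<le> exp (w i) * ((\<Prod>j\<in>A - {i}. u' j) * (\<Prod>j\<in>?N \<omega>1. u' j))" for \<omega>1
    proof -
      let ?A = "A - {i} \<union> ?N \<omega>1" and ?U = "U - ?N \<omega>1"
      have AU: "?A \<union> ?U = A \<union> U - {i}" using iU i by auto
      have finAU: "finite ?A" "finite ?U" using less finU by auto
      have i_notin: "i \<notin> cluster ?A ?U \<omega>2" for \<omega>2
        using cluster_subset[of ?A ?U \<omega>2] AU by auto
      have "measure_pmf.expectation (edge_pmf p (Z - ?X)) (\<lambda>\<omega>2. exp (\<Sum>j\<in>insert i (cluster ?A ?U \<omega>2). w j)) =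
         exp (w i) * measure_pmf.expectation (edge_pmf p (Z - ?X)) (\<lambda>\<omega>2. exp (\<Sum>j\<in>cluster ?A ?U \<omega>2. w j))"
        by (simp add: sum.insert[OF finite_cluster[OF finAU] i_notin] exp_add)
      also have "\<dots> \<le> exp (w i) * (\<Prod>j\<in>?A. u j)"
      proof (intro mult_left_mono less(1))
        show "card (?A \<union> ?U) < card (A \<union> U)"
          unfolding AU using i less(3) finU by (intro psubset_card_mono) auto
        show "pairs (?A \<union> ?U) \<subseteq> Z - ?X"
          using less.prems(7) unfolding AU by (auto simp: pairs_def min_def max_def split: if_splits)
      qed (use less AU finAU in auto)
      also have "(\<Prod>j\<in>?A. u j) = (\<Prod>j\<in>A - {i}. u j) * (\<Prod>j\<in>?N \<omega>1. u j)"
        using less finU by (intro prod.union_disjoint) auto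
      also have "\<dots> = (\<Prod>j\<in>A - {i}. u' j) * (\<Prod>j\<in>?N \<omega>1. u' j)"
        using u' less by (intro arg_cong2[where f = "(*)"] prod.cong) auto
      finally show ?thesis .
    qed
    have "measure_pmf.expectation (edge_pmf p Z) (\<lambda>\<omega>. exp (\<Sum>j\<in>cluster A U \<omega>. w j)) \<le>
      measure_pmf.expectation (edge_pmf p ?X) (\<lambda>\<omega>1. exp (w i) * ((\<Prod>j\<in>A - {i}. u' j) * (\<Prod>j\<in>?N \<omega>1. u' j)))"
      unfolding expectation_cluster_step[OF less(2,8) i less(7) finU, of p "\<lambda>C. exp (\<Sum>j\<in>C. w j)"]
      using inner finU by (intro expectation_edge_pmf_mono) auto
    also have "\<dots> = exp (w i) * ((\<Prod>j\<in>A - {i}. u' j) * (\<Prod>j\<in>U. 1 + p (edge_index i j) * (u' j - 1)))"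
      using expectation_star[OF finU iU assms(3,4), of u'] by (simp add: u'_def)
    also have "\<dots> = (\<Prod>j\<in>A - {i}. u' j) * (exp (w i) * (\<Prod>j\<in>U. 1 + p (edge_index i j) * (u' j - 1)))"
      by simp
    also have "\<dots> \<le> (\<Prod>j\<in>A - {i}. u' j) * u' i"
    proof (intro mult_left_mono prod_nonneg)
      have nonneg: "0 \<le> link p i j * (u' j - 1)" for j
        using assms(3) by (simp add: link_def u'_def)
      have "(\<Prod>j\<in>U. 1 + p (edge_index i j) * (u' j - 1)) \<le> (\<Prod>j\<in>U. exp (link p i j * (u' j - 1)))"
      proof (intro prod_mono conjI)
        fix j assume "j \<in> U"
        then have "link p i j = p (edge_index i j)"
          using iU by (auto simp: link_def)
        then show "0 \<le> 1 + p (edge_index i j) * (u' j - 1)"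
          "1 + p (edge_index i j) * (u' j - 1) \<le> exp (link p i j * (u' j - 1))"
          using nonneg[of j] exp_ge_add_one_self[of "link p i j * (u' j - 1)"] by simp_all
      qed
      also have "\<dots> = exp (\<Sum>j\<in>U. link p i j * (u' j - 1))"
        using finU by (simp add: exp_sum)
      also have "(\<Sum>j\<in>U. link p i j * (u' j - 1)) \<le> (\<Sum>j\<in>U\<^sub>0. link p i j * (u' j - 1))"
        using less.prems assms(2) nonneg by (intro sum_mono2) auto
      also have "\<dots> = (\<Sum>j\<in>U\<^sub>0. link p i j * (u j - 1))"
        using u' less.prems by (intro sum.cong) auto
      finally have "exp (w i) * (\<Prod>j\<in>U. 1 + p (edge_index i j) * (u' j - 1)) \<le>
          exp (w i) * exp (\<Sum>j\<in>U\<^sub>0. link p i j * (u j - 1))"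
        by simp
      also have "\<dots> \<le> u i"
        using super[of i] i less.prems by (auto simp: exp_add)
      finally have "exp (w i) * (\<Prod>j\<in>U. 1 + p (edge_index i j) * (u' j - 1)) \<le> u i" .
      then show "exp (w i) * (\<Prod>j\<in>U. 1 + p (edge_index i j) * (u' j - 1)) \<le> u' i"
        using u' i less(5) by auto
    qed (auto simp: u'_def)
    also have "\<dots> = (\<Prod>j\<in>A. u' j)"
      using i less(3) by (simp add: prod.remove[of A i] mult.commute)
    also have "\<dots> = (\<Prod>j\<in>A. u j)"
      using u' less by (intro prod.cong) auto
    finally show ?thesis .
  qed
qed

text \<open>Exploring without replacement loses the edges towards vertices that have been seen before; the
  second sum in the exponent pays for them.\<close>

lemma cluster_exp_lower:
  fixes v w :: "nat \<Rightarrow> real" and p :: "nat \<times> nat \<Rightarrow> real"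
  defines "q \<equiv> link p"
  assumes "finite Z" "finite V" "\<And>e. 0 \<le> p e" "\<And>e. p e \<le> 1" "\<And>j. j \<in> V \<Longrightarrow> 0 \<le> v j"
    and sub: "\<And>i. i \<in> V \<Longrightarrow> v i \<le> w i + (\<Sum>j\<in>V. q i j * (1 - exp (- v j)))"
  assumes "F \<union> A \<union> U = V" "A \<inter> U = {}" "F \<inter> (A \<union> U) = {}" "pairs (A \<union> U) \<subseteq> Z"
  shows "measure_pmf.expectation (edge_pmf p Z)
      (\<lambda>\<omega>. exp (- (\<Sum>i\<in>cluster A U \<omega>. w i + (\<Sum>j\<in>F \<union> cluster A U \<omega>. q i j * v j)))) \<le> exp (- (\<Sum>j\<in>A. v j))"
  using assms(2,8-)
proof (induction "card (A \<union> U)" arbitrary: F A U Z rule: less_induct)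
  case less
  show ?case
  proof (cases "A = {}")
    case True
    then show ?thesis by simp
  next
    case False
    then obtain i where i: "i \<in> A" by auto
    let ?N = "\<lambda>\<omega>. {j \<in> U. adj \<omega> i j}"
    let ?X = "edge_index i ` U"
    let ?f = "\<lambda>F C. exp (- (\<Sum>i\<in>C. w i + (\<Sum>j\<in>F \<union> C. q i j * v j)))"
    have fin: "finite F" "finite A" "finite U"
      using less(3) assms(3) by auto
    have V: "i \<in> V" "F \<subseteq> V" "A \<subseteq> V" "U \<subseteq> V"
      using less(3) i by auto
    have iU: "i \<notin> U" "i \<notin> F" using i less by auto
    have q0: "0 \<le> q x y" for x y
      using assms(4) by (simp add: q_def link_def)
    define W where "W = w i + (\<Sum>j\<in>F \<union> A. q i j * v j)"
    have inner: "measure_pmf.expectation (edge_pmf p (Z - ?X)) (\<lambda>\<omega>2.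
        ?f F (insert i (cluster (A - {i} \<union> ?N \<omega>1) (U - ?N \<omega>1) \<omega>2)))
      \<le> exp (- W) * (exp (- (\<Sum>j\<in>A - {i}. v j)) * (\<Prod>j\<in>?N \<omega>1. exp (- v j)))" for \<omega>1
    proof -
      let ?A = "A - {i} \<union> ?N \<omega>1" and ?U = "U - ?N \<omega>1"
      have AU: "?A \<union> ?U = A \<union> U - {i}" using iU i by auto
      have finAU: "finite ?A" "finite ?U" using fin by auto
      \<comment> \<open>All of \<open>A\<close> ends up in the cluster, so the edges from
        \<open>i\<close> into \<open>F \<union> A\<close>, which are not looked at now, are already
        contained in the penalty that \<open>i\<close> receives at the end.\<close>
      have bound: "?f F (insert i (cluster ?A ?U \<omega>2)) \<le> exp (- W) * ?f (insert i F) (cluster ?A ?U \<omega>2)" for \<omega>2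
      proof -
        let ?C = "cluster ?A ?U \<omega>2"
        have C: "?A \<subseteq> ?C" "?C \<subseteq> A \<union> U - {i}" "finite ?C"
          using cluster_subset[of ?A ?U \<omega>2] cluster_superset[of ?A ?U \<omega>2] finite_cluster[OF finAU] AU by auto
        have "(\<Sum>j\<in>F \<union> A. q i j * v j) \<le> (\<Sum>j\<in>F \<union> insert i ?C. q i j * v j)"
          using C V fin q0 assms(6) by (intro sum_mono2) (auto intro!: mult_nonneg_nonneg)
        moreover have "(\<Sum>x\<in>insert i ?C. w x + (\<Sum>j\<in>F \<union> insert i ?C. q x j * v j)) =
            (w i + (\<Sum>j\<in>F \<union> insert i ?C. q i j * v j)) + (\<Sum>x\<in>?C. w x + (\<Sum>j\<in>insert i F \<union> ?C. q x j * v j))"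
          using C by (subst sum.insert) auto
        ultimately have "W + (\<Sum>x\<in>?C. w x + (\<Sum>j\<in>insert i F \<union> ?C. q x j * v j))
            \<le> (\<Sum>x\<in>insert i ?C. w x + (\<Sum>j\<in>F \<union> insert i ?C. q x j * v j))"
          unfolding W_def by linarith
        then show ?thesis
          by (simp only: exp_add[symmetric] exp_le_cancel_iff)
      qed
      have "measure_pmf.expectation (edge_pmf p (Z - ?X)) (\<lambda>\<omega>2. ?f F (insert i (cluster ?A ?U \<omega>2))) \<le>
         measure_pmf.expectation (edge_pmf p (Z - ?X)) (\<lambda>\<omega>2. exp (- W) * ?f (insert i F) (cluster ?A ?U \<omega>2))"
        using bound less(2) by (intro expectation_edge_pmf_mono) auto
      also have "\<dots> = exp (- W) * measure_pmf.expectation (edge_pmf p (Z - ?X)) (\<lambda>\<omega>2. ?f (insert i F) (cluster ?A ?U \<omega>2))"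
        by simp
      also have "\<dots> \<le> exp (- W) * exp (- (\<Sum>j\<in>?A. v j))"
      proof (intro mult_left_mono less(1))
        show "card (?A \<union> ?U) < card (A \<union> U)"
          unfolding AU using i fin by (intro psubset_card_mono) auto
        show "pairs (?A \<union> ?U) \<subseteq> Z - ?X"
          using less.prems(5) unfolding AU by (auto simp: pairs_def min_def max_def split: if_splits)
        show "insert i F \<union> ?A \<union> ?U = V"
          using less.prems(2) i AU by auto
        show "insert i F \<inter> (?A \<union> ?U) = {}"
          unfolding AU using less.prems(4) by auto
      qed (use less AU finAU in auto)
      also have "(\<Sum>j\<in>?A. v j) = (\<Sum>j\<in>A - {i}. v j) + (\<Sum>j\<in>?N \<omega>1. v j)"
        using less fin by (intro sum.union_disjoint) auto
      also have "exp (- \<dots>) = exp (- (\<Sum>j\<in>A - {i}. v j)) * (\<Prod>j\<in>?N \<omega>1. exp (- v j))"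
        using fin by (simp add: exp_add[symmetric] exp_sum[symmetric] sum_negf)
      finally show ?thesis .
    qed
    have "measure_pmf.expectation (edge_pmf p Z) (\<lambda>\<omega>. ?f F (cluster A U \<omega>)) \<le>
      measure_pmf.expectation (edge_pmf p ?X) (\<lambda>\<omega>1. exp (- W) * (exp (- (\<Sum>j\<in>A - {i}. v j)) * (\<Prod>j\<in>?N \<omega>1. exp (- v j))))"
      unfolding expectation_cluster_step[OF less(2,6) i less(4) fin(3), of p "?f F"]
      using inner fin by (intro expectation_edge_pmf_mono) auto
    also have "\<dots> = exp (- W) * (exp (- (\<Sum>j\<in>A - {i}. v j)) * (\<Prod>j\<in>U. 1 + p (edge_index i j) * (exp (- v j) - 1)))"
      using expectation_star[OF fin(3) iU(1) assms(4,5), of "\<lambda>j. exp (- v j)"] by simp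
    also have "\<dots> \<le> exp (- W) * (exp (- (\<Sum>j\<in>A - {i}. v j)) * exp (- (\<Sum>j\<in>U. q i j * (1 - exp (- v j)))))"
    proof -
      have "(\<Prod>j\<in>U. 1 + p (edge_index i j) * (exp (- v j) - 1)) \<le> (\<Prod>j\<in>U. exp (- (q i j * (1 - exp (- v j)))))"
      proof (intro prod_mono conjI)
        fix j assume j: "j \<in> U"
        have "p (edge_index i j) * (1 - exp (- v j)) \<le> 1 * 1"
          using j V assms(4-6) by (intro mult_mono) auto
        then show "0 \<le> 1 + p (edge_index i j) * (exp (- v j) - 1)"
          by (simp add: algebra_simps)
        have "q i j = p (edge_index i j)"
          using j iU by (auto simp: q_def link_def)
        then show "1 + p (edge_index i j) * (exp (- v j) - 1) \<le> exp (- (q i j * (1 - exp (- v j))))"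
          using exp_ge_add_one_self[of "- (q i j * (1 - exp (- v j)))"] by (simp add: algebra_simps)
      qed
      then show ?thesis
        using fin by (simp add: exp_sum[symmetric] sum_negf)
    qed
    also have "\<dots> = exp (- (W + (\<Sum>j\<in>A - {i}. v j) + (\<Sum>j\<in>U. q i j * (1 - exp (- v j)))))"
      by (simp add: exp_add[symmetric])
    also have "\<dots> \<le> exp (- (v i + (\<Sum>j\<in>A - {i}. v j)))"
    proof -
      have "v i \<le> w i + (\<Sum>j\<in>V. q i j * (1 - exp (- v j)))"
        using sub V by blast
      also have "(\<Sum>j\<in>V. q i j * (1 - exp (- v j))) =
          (\<Sum>j\<in>F \<union> A. q i j * (1 - exp (- v j))) + (\<Sum>j\<in>U. q i j * (1 - exp (- v j)))"
        unfolding less(3)[symmetric] using less fin by (intro sum.union_disjoint) auto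
      also have "(\<Sum>j\<in>F \<union> A. q i j * (1 - exp (- v j))) \<le> (\<Sum>j\<in>F \<union> A. q i j * v j)"
      proof (intro sum_mono mult_left_mono q0)
        fix j
        show "1 - exp (- v j) \<le> v j" using exp_ge_add_one_self[of "- v j"] by linarith
      qed
      finally show ?thesis by (simp add: W_def)
    qed
    also have "v i + (\<Sum>j\<in>A - {i}. v j) = (\<Sum>j\<in>A. v j)"
      using i fin by (simp add: sum.remove[of A i])
    finally show ?thesis .
  qed
qed

text \<open>Edges are added one by one. Given the others, the expectation is affine in the parameter
  of the new edge, with slope \<open>g p' True - g p' False\<close>, which is nonnegative for
  monotone \<open>f\<close>.\<close>

lemma expectation_edge_pmf_coupling:
  fixes f :: "('e \<Rightarrow> bool) \<Rightarrow> real"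
  assumes "finite Z" "\<And>e. 0 \<le> p e" "\<And>e. p e \<le> p' e" "\<And>e. p' e \<le> 1" "mono f"
  shows "measure_pmf.expectation (edge_pmf p Z) f \<le> measure_pmf.expectation (edge_pmf p' Z) f"
  using assms(1,5)
proof (induction Z arbitrary: f rule: finite_induct)
  case empty
  then show ?case by (simp add: edge_pmf_def)
next
  case (insert x Z)
  define g where "g r b = measure_pmf.expectation (edge_pmf r Z) (\<lambda>\<omega>. f (\<lambda>e. if e = x then b else \<omega> e))" for r b
  have decomp: "measure_pmf.expectation (edge_pmf r (insert x Z)) f = r x * g r True + (1 - r x) * g r False"
    if "0 \<le> r x" "r x \<le> 1" for r
  proof -
    have "measure_pmf.expectation (edge_pmf r ({x} \<union> Z)) f =
        measure_pmf.expectation (edge_pmf r {x}) (\<lambda>\<omega>1. g r (\<omega>1 x))"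
      using insert by (subst expectation_edge_pmf_Un) (auto simp: g_def if_distrib cong: if_cong
          intro!: Bochner_Integration.integral_cong arg_cong[of _ _ f])
    also have "\<dots> = measure_pmf.expectation (bernoulli_pmf (r x)) (g r)"
      by (simp add: edge_pmf_def Pi_pmf_singleton)
    finally show ?thesis using that by simp
  qed
  have g: "g p b \<le> g p' b" for b
    unfolding g_def by (intro insert.IH monoI monoD[OF insert.prems]) (auto simp: le_fun_def)
  have g': "g p' False \<le> g p' True"
    unfolding g_def using insert
    by (intro expectation_edge_pmf_mono monoD[OF insert.prems]) (auto simp: le_fun_def)
  have p: "0 \<le> p x" "p x \<le> p' x" "p' x \<le> 1" "p x \<le> 1"
    using assms(2,3,4)[of x] by auto
  have "p x * g p True + (1 - p x) * g p False \<le> p x * g p' True + (1 - p x) * g p' False"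
    using p g by (intro add_mono mult_left_mono) auto
  also have "\<dots> = g p' False + p x * (g p' True - g p' False)"
    by (simp add: algebra_simps)
  also have "\<dots> \<le> g p' False + p' x * (g p' True - g p' False)"
    using p g' by (intro add_left_mono mult_right_mono) auto
  also have "\<dots> = p' x * g p' True + (1 - p' x) * g p' False"
    by (simp add: algebra_simps)
  finally show ?case
    using p by (simp add: decomp)
qed

lemma Markov_edge_pmf:
  fixes f :: "_ \<Rightarrow> real"
  assumes "finite Z" "\<And>\<omega>. 0 \<le> f \<omega>" "0 < t"
  shows "measure (measure_pmf (edge_pmf p Z)) {\<omega>. t \<le> f \<omega>} \<le> measure_pmf.expectation (edge_pmf p Z) f / t"
  using integral_Markov_inequality_measure[where M = "measure_pmf (edge_pmf p Z)" and A = UNIV and u = f and c = t]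
    assms by simp

subsection \<open>Components of the graph\<close>

definition graph_of :: "nat \<Rightarrow> (nat \<times> nat \<Rightarrow> bool) \<Rightarrow> nat set set" where
  "graph_of n \<omega> = {{i, j} | i j. (i, j) \<in> vertex_pairs n \<and> \<omega> (i, j)}"

definition max_component :: "nat \<Rightarrow> (nat \<times> nat \<Rightarrow> bool) \<Rightarrow> nat" where
  "max_component n \<omega> = card (largest_component {1..n} (graph_of n \<omega>))"

definition edge_rel :: "nat set \<Rightarrow> (nat \<times> nat \<Rightarrow> bool) \<Rightarrow> (nat \<times> nat) set" where
  "edge_rel V \<omega> = {(u, v). u \<in> V \<and> v \<in> V \<and> adj \<omega> u v}"

lemma cluster_edge_rel: "cluster A U \<omega> = (edge_rel (A \<union> U) \<omega>)\<^sup>* `` A"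
  by (simp add: cluster_def edge_rel_def)

lemma edge_rel_rtrancl_sym: "(x, y) \<in> (edge_rel V \<omega>)\<^sup>* \<Longrightarrow> (y, x) \<in> (edge_rel V \<omega>)\<^sup>*"
  using sym_rtrancl[of "edge_rel V \<omega>"] by (auto simp: edge_rel_def sym_def adj_commute)

lemma edge_rel_Image_subset: "x \<in> V \<Longrightarrow> (edge_rel V \<omega>)\<^sup>* `` {x} \<subseteq> V"
  using cluster_subset[of "{x}" V \<omega>] by (simp add: cluster_edge_rel insert_absorb)

lemma in_graph_of_iff:
  assumes "u \<in> {1..n}" "v \<in> {1..n}"
  shows "{u, v} \<in> graph_of n \<omega> \<longleftrightarrow> adj \<omega> u v"
proof
  assume "{u, v} \<in> graph_of n \<omega>"
  then obtain i j where "{u, v} = {i, j}" "i < j" "\<omega> (i, j)"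
    by (auto simp: graph_of_def vertex_pairs_def)
  then show "adj \<omega> u v"
    by (auto simp: adj_def doubleton_eq_iff)
next
  assume *: "adj \<omega> u v"
  then have "{u, v} = {min u v, max u v}" "(min u v, max u v) \<in> vertex_pairs n"
    using assms by (auto simp: adj_def vertex_pairs_def min_def max_def)
  with * show "{u, v} \<in> graph_of n \<omega>"
    unfolding graph_of_def adj_def by blast
qed

lemma graph_components_graph_of:
  "graph_components {1..n} (graph_of n \<omega>) = (\<lambda>x. (edge_rel {1..n} \<omega>)\<^sup>* `` {x}) ` {1..n}"
proof -
  have "{(u, v). u \<in> {1..n} \<and> v \<in> {1..n} \<and> {u, v} \<in> graph_of n \<omega>} = edge_rel {1..n} \<omega>"
    using in_graph_of_iff[of _ n] by (auto simp: edge_rel_def simp del: atLeastAtMost_iff)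
  then show ?thesis
    by (auto simp: graph_components_def quotient_def)
qed

text \<open>Component sizes are bounded by \<open>n\<close>, so the maximum behind
  \<open>ARG_MAX\<close> is attained; these two facts determine the size under any
  tie-breaking.\<close>

lemma max_component:
  assumes "1 \<le> n"
  shows "\<exists>x\<in>{1..n}. max_component n \<omega> = card ((edge_rel {1..n} \<omega>)\<^sup>* `` {x})"
    and "x \<in> {1..n} \<Longrightarrow> card ((edge_rel {1..n} \<omega>)\<^sup>* `` {x}) \<le> max_component n \<omega>"
proof -
  let ?P = "\<lambda>C. C \<in> graph_components {1..n} (graph_of n \<omega>)"
  have one: "?P ((edge_rel {1..n} \<omega>)\<^sup>* `` {1})"
    unfolding graph_components_graph_of using assms by (intro imageI) simp
  have bd: "\<forall>C. ?P C \<longrightarrow> card C < Suc n"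
  proof (intro allI impI)
    fix C assume "?P C"
    then obtain x where "x \<in> {1..n}" "C = (edge_rel {1..n} \<omega>)\<^sup>* `` {x}"
      unfolding graph_components_graph_of by blast
    then have "C \<subseteq> {1..n}"
      using edge_rel_Image_subset by simp
    then have "card C \<le> card {1..n}" by (intro card_mono) auto
    then show "card C < Suc n" by simp
  qed
  have *: "?P (arg_max card ?P) \<and> (\<forall>C. ?P C \<longrightarrow> card C \<le> card (arg_max card ?P))"
    using arg_max_nat_lemma[of ?P _ card, OF one bd] .
  show "\<exists>x\<in>{1..n}. max_component n \<omega> = card ((edge_rel {1..n} \<omega>)\<^sup>* `` {x})"
    using * unfolding max_component_def largest_component_def graph_components_graph_of by auto
  show "x \<in> {1..n} \<Longrightarrow> card ((edge_rel {1..n} \<omega>)\<^sup>* `` {x}) \<le> max_component n \<omega>"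
    using * unfolding max_component_def largest_component_def graph_components_graph_of by auto
qed

lemma finite_edge_rel_Image: "x \<in> {1..n} \<Longrightarrow> finite ((edge_rel {1..n} \<omega>)\<^sup>* `` {x})"
  using edge_rel_Image_subset[of x "{1..n}" \<omega>] finite_subset by blast

lemma max_component_pos: "1 \<le> n \<Longrightarrow> 1 \<le> max_component n \<omega>"
proof -
  assume n: "1 \<le> n"
  have "1 \<le> card ((edge_rel {1..n} \<omega>)\<^sup>* `` {1})"
    using finite_edge_rel_Image[of 1 n \<omega>] n card_gt_0_iff[of "(edge_rel {1..n} \<omega>)\<^sup>* `` {1}"] by force
  then show ?thesis
    using max_component(2)[OF n, of 1 \<omega>] n by simp
qed

lemma max_component_le: "1 \<le> n \<Longrightarrow> max_component n \<omega> \<le> n"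
proof -
  assume n: "1 \<le> n"
  then obtain x where "x \<in> {1..n}" "max_component n \<omega> = card ((edge_rel {1..n} \<omega>)\<^sup>* `` {x})"
    using max_component(1) by blast
  then show ?thesis
    using card_mono[OF _ edge_rel_Image_subset[of x "{1..n}" \<omega>]] by simp
qed

lemma mono_max_component: "1 \<le> n \<Longrightarrow> \<omega> \<le> \<omega>' \<Longrightarrow> max_component n \<omega> \<le> max_component n \<omega>'"
proof -
  assume n: "1 \<le> n" and le: "\<omega> \<le> \<omega>'"
  obtain x where x: "x \<in> {1..n}" "max_component n \<omega> = card ((edge_rel {1..n} \<omega>)\<^sup>* `` {x})"
    using max_component(1)[OF n] by blast
  have "edge_rel {1..n} \<omega> \<subseteq> edge_rel {1..n} \<omega>'"
    using le by (auto simp: edge_rel_def adj_def le_fun_def)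
  then have "(edge_rel {1..n} \<omega>)\<^sup>* `` {x} \<subseteq> (edge_rel {1..n} \<omega>')\<^sup>* `` {x}"
    using rtrancl_mono by blast
  then have "card ((edge_rel {1..n} \<omega>)\<^sup>* `` {x}) \<le> card ((edge_rel {1..n} \<omega>')\<^sup>* `` {x})"
    using finite_edge_rel_Image[OF x(1)] by (intro card_mono)
  then show ?thesis
    using max_component(2)[OF n x(1), of \<omega>'] x(2) by linarith
qed

text \<open>Every component is explored from its oldest vertex without looking at older vertices.\<close>

lemma max_component_le_cluster:
  assumes "1 \<le> n"
  shows "\<exists>k\<in>{1..n}. max_component n \<omega> \<le> card (cluster {k} {Suc k..n} \<omega>)"
proof -
  let ?R = "(edge_rel {1..n} \<omega>)\<^sup>*"
  obtain x where x: "x \<in> {1..n}" "max_component n \<omega> = card (?R `` {x})"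
    using max_component(1)[OF assms] by blast
  define C where "C = ?R `` {x}"
  have C: "finite C" "x \<in> C" "C \<subseteq> {1..n}"
    using finite_edge_rel_Image[OF x(1)] edge_rel_Image_subset[OF x(1)] by (auto simp: C_def)
  define k where "k = Min C"
  have k: "k \<in> C" "\<And>y. y \<in> C \<Longrightarrow> k \<le> y"
    unfolding k_def using C by (auto intro: Min_in Min_le)
  have kn: "{k} \<union> {Suc k..n} = {k..n}" using k C by auto
  have "C \<subseteq> (edge_rel {k..n} \<omega>)\<^sup>* `` {k}"
  proof
    fix y assume "y \<in> C"
    then have "(k, y) \<in> ?R"
      using k(1) edge_rel_rtrancl_sym[of x k] rtrancl_trans[of k x _ y] by (auto simp: C_def)
    then have "y \<in> C \<and> (k, y) \<in> (edge_rel {k..n} \<omega>)\<^sup>*"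
    proof (induction rule: rtrancl_induct)
      case base
      then show ?case using k by simp
    next
      case (step y z)
      have z: "z \<in> C"
        using step unfolding C_def by (auto intro: rtrancl_into_rtrancl)
      then have "(y, z) \<in> edge_rel {k..n} \<omega>"
        using step k C by (auto simp: edge_rel_def)
      then show ?case using z step by (auto intro: rtrancl_into_rtrancl)
    qed
    then show "y \<in> (edge_rel {k..n} \<omega>)\<^sup>* `` {k}" by simp
  qed
  then have "C \<subseteq> cluster {k} {Suc k..n} \<omega>"
    by (simp add: cluster_edge_rel kn[simplified] insert_absorb kn)
  then have "card C \<le> card (cluster {k} {Suc k..n} \<omega>)"
    by (intro card_mono finite_cluster) auto
  then show ?thesis
    using k C x by (auto simp: C_def)
qed

text \<open>A cluster grown from several roots is covered by the components of these roots. This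
  turns a large cluster of a bounded number of roots into a large component.\<close>

lemma card_cluster_le_max_component:
  assumes "1 \<le> n" "A \<union> U \<subseteq> {1..n}"
  shows "card (cluster A U \<omega>) \<le> card A * max_component n \<omega>"
proof -
  have fin: "finite A" using assms(2) finite_subset by blast
  have "cluster A U \<omega> \<subseteq> (\<Union>x\<in>A. (edge_rel {1..n} \<omega>)\<^sup>* `` {x})"
  proof -
    have "edge_rel (A \<union> U) \<omega> \<subseteq> edge_rel {1..n} \<omega>"
      using assms(2) by (auto simp: edge_rel_def)
    then show ?thesis
      unfolding cluster_edge_rel using rtrancl_mono by blast
  qed
  then have "card (cluster A U \<omega>) \<le> card (\<Union>x\<in>A. (edge_rel {1..n} \<omega>)\<^sup>* `` {x})"
    using fin assms(2) finite_edge_rel_Image by (intro card_mono) auto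
  also have "\<dots> \<le> (\<Sum>x\<in>A. card ((edge_rel {1..n} \<omega>)\<^sup>* `` {x}))"
    by (rule card_UN_le[OF fin])
  also have "\<dots> \<le> (\<Sum>x\<in>A. max_component n \<omega>)"
    using assms max_component(2)[OF assms(1)] by (intro sum_mono) auto
  finally show ?thesis by simp
qed

section \<open>The law of the largest component size\<close>

definition edge_prob_of :: "real \<Rightarrow> real \<Rightarrow> nat \<times> nat \<Rightarrow> real" where
  "edge_prob_of \<gamma> \<beta> e = edge_prob \<gamma> \<beta> (fst e) (snd e)"

abbreviation edges :: "real \<Rightarrow> real \<Rightarrow> nat \<Rightarrow> (nat \<times> nat \<Rightarrow> bool) pmf" where
  "edges \<gamma> \<beta> n \<equiv> edge_pmf (edge_prob_of \<gamma> \<beta>) (vertex_pairs n)"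

lemma edge_prob_of_bounds: "0 \<le> \<beta> \<Longrightarrow> 0 \<le> edge_prob_of \<gamma> \<beta> e" "edge_prob_of \<gamma> \<beta> e \<le> 1"
  by (simp_all add: edge_prob_of_def edge_prob_def)

lemma finite_vertex_pairs [simp]: "finite (vertex_pairs n)"
  by (rule finite_subset[of _ "{1..n} \<times> {1..n}"]) (auto simp: vertex_pairs_def)

lemma growing_graph_eq: "growing_graph \<gamma> \<beta> n = map_pmf (graph_of n) (edges \<gamma> \<beta> n)"
  by (simp add: growing_graph_def edge_pmf_def edge_prob_of_def graph_of_def[abs_def] case_prod_unfold)

lemma prob_growing_graph:
  "measure (measure_pmf (growing_graph \<gamma> \<beta> n)) {G \<in> space (measure_pmf (growing_graph \<gamma> \<beta> n)). P (card (largest_component {1..n} G))} =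
   measure (measure_pmf (edges \<gamma> \<beta> n)) {\<omega>. P (max_component n \<omega>)}"
  by (simp add: growing_graph_eq max_component_def vimage_def)

text \<open>This allows a parameter to be replaced by a nearby one whose harmonic functions are
  convenient.\<close>

lemma prob_max_component_mono:
  assumes "0 \<le> \<beta>" "\<beta> \<le> \<beta>'" "1 \<le> n"
  shows "measure (measure_pmf (edges \<gamma> \<beta> n)) {\<omega>. x \<le> real (max_component n \<omega>)} \<le>
    measure (measure_pmf (edges \<gamma> \<beta>' n)) {\<omega>. x \<le> real (max_component n \<omega>)}"
proof -
  let ?S = "{\<omega>. x \<le> real (max_component n \<omega>)}"
  have "measure_pmf.expectation (edges \<gamma> \<beta> n) (indicator ?S :: _ \<Rightarrow> real) \<le>
      measure_pmf.expectation (edges \<gamma> \<beta>' n) (indicator ?S)"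
  proof (intro expectation_edge_pmf_coupling monoI)
    fix e show "edge_prob_of \<gamma> \<beta> e \<le> edge_prob_of \<gamma> \<beta>' e"
      unfolding edge_prob_of_def edge_prob_def using assms by (intro min.mono mult_right_mono) auto
  next
    fix \<omega> \<omega>' :: "nat \<times> nat \<Rightarrow> bool" assume "\<omega> \<le> \<omega>'"
    then show "indicator ?S \<omega> \<le> (indicator ?S \<omega>' :: real)"
      using mono_max_component[OF assms(3), of \<omega> \<omega>'] by (auto simp: indicator_def)
  qed (use assms edge_prob_of_bounds in auto)
  then show ?thesis by simp
qed

subsection \<open>Logarithmic scale\<close>

definition lscale :: "nat \<Rightarrow> nat \<Rightarrow> real" where
  "lscale k j = ln (real j / real k)"

lemma lscale_self [simp]: "0 < k \<Longrightarrow> lscale k k = 0"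
  by (simp add: lscale_def)

lemma lscale_mono: "0 < k \<Longrightarrow> 0 < i \<Longrightarrow> i \<le> j \<Longrightarrow> lscale k i \<le> lscale k j"
  by (simp add: lscale_def divide_right_mono)

lemma lscale_nonneg: "0 < k \<Longrightarrow> k \<le> j \<Longrightarrow> 0 \<le> lscale k j"
  using lscale_mono[of k k j] by simp

lemma exp_lscale: "0 < k \<Longrightarrow> 0 < j \<Longrightarrow> exp (lscale k j) = real j / real k"
  by (simp add: lscale_def)

text \<open>In the variable \<open>y = k * exp z\<close> the cell has length one, and the mean value
  theorem gives a single value of the integrand. The Jacobian \<open>1 / y\<close> equals
  \<open>exp (- z) / k\<close>, which lowers the exponent from \<open>s\<close> to
  \<open>s - 1\<close>.\<close>

lemma cell_bounds:
  fixes \<Phi> F :: "real \<Rightarrow> real"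
  assumes "0 < k" "k \<le> j" "lscale k (Suc j) \<le> len"
    and deriv: "\<And>z. 0 \<le> z \<Longrightarrow> z \<le> len \<Longrightarrow> (\<Phi> has_real_derivative exp (s * z) * F z) (at z)"
  shows "\<exists>\<zeta>. lscale k j \<le> \<zeta> \<and> \<zeta> \<le> lscale k (Suc j) \<and>
    real k * (\<Phi> (lscale k (Suc j)) - \<Phi> (lscale k j)) = exp ((s - 1) * \<zeta>) * F \<zeta>"
proof -
  have rk: "0 < real k" and rj: "real k \<le> real j" using assms by auto
  have "\<exists>y>real j. y < real (Suc j) \<and>
      \<Phi> (ln (real (Suc j) / real k)) - \<Phi> (ln (real j / real k)) =
      (real (Suc j) - real j) * (exp (s * ln (y / real k)) * F (ln (y / real k)) * (1 / y))"
  proof (rule MVT2)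
    fix y assume y: "real j \<le> y" "y \<le> real (Suc j)"
    have y0: "0 < y" using y rk rj by linarith
    have "0 \<le> ln (y / real k)"
      using y rk rj by simp
    moreover have "ln (y / real k) \<le> len"
    proof -
      have "ln (y / real k) \<le> lscale k (Suc j)"
        using y y0 rk by (simp add: lscale_def divide_right_mono)
      then show ?thesis using assms(3) by simp
    qed
    moreover have "((\<lambda>y. ln (y / real k)) has_real_derivative (1 / y)) (at y)"
      using y0 rk by (auto intro!: derivative_eq_intros)
    ultimately show "((\<lambda>y. \<Phi> (ln (y / real k))) has_real_derivative
        exp (s * ln (y / real k)) * F (ln (y / real k)) * (1 / y)) (at y)"
      by (intro DERIV_chain2[of \<Phi>] deriv)
  qed auto
  then obtain y where y: "real j < y" "y < real (Suc j)" and
    eq: "\<Phi> (lscale k (Suc j)) - \<Phi> (lscale k j) = exp (s * ln (y / real k)) * F (ln (y / real k)) / y"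
    by (auto simp: lscale_def)
  have y0: "0 < y" using y by linarith
  define \<zeta> where "\<zeta> = ln (y / real k)"
  have "real k * (exp (s * \<zeta>) / y) = exp (s * \<zeta>) * exp (- \<zeta>)"
    using y0 rk by (simp add: \<zeta>_def exp_minus field_simps)
  also have "\<dots> = exp ((s - 1) * \<zeta>)"
    by (simp add: exp_add[symmetric] algebra_simps)
  finally have "real k * (\<Phi> (lscale k (Suc j)) - \<Phi> (lscale k j)) = exp ((s - 1) * \<zeta>) * F \<zeta>"
    unfolding eq \<zeta>_def[symmetric] by (metis mult.assoc mult.commute times_divide_eq_left)
  moreover have "lscale k j \<le> \<zeta>" "\<zeta> \<le> lscale k (Suc j)"
    using y y0 rk rj by (auto simp: lscale_def \<zeta>_def divide_right_mono)
  ultimately show ?thesis by blast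
qed

text \<open>For an antitone integrand the right-endpoint sum lies below the integral and the
  left-endpoint sum above it. The integral appears only through its antiderivative.\<close>

lemma sum_antitone_bounds:
  fixes \<Phi> F :: "real \<Rightarrow> real"
  assumes "0 < k" "k \<le> m" "m \<le> n" "lscale k n \<le> len"
    and deriv: "\<And>z. 0 \<le> z \<Longrightarrow> z \<le> len \<Longrightarrow> (\<Phi> has_real_derivative exp (s * z) * F z) (at z)"
    and anti: "\<And>x y. 0 \<le> x \<Longrightarrow> x \<le> y \<Longrightarrow> y \<le> len \<Longrightarrow> exp ((s - 1) * y) * F y \<le> exp ((s - 1) * x) * F x"
  shows "(\<Sum>j\<in>{m<..n}. exp ((s - 1) * lscale k j) * F (lscale k j)) \<le> real k * (\<Phi> (lscale k n) - \<Phi> (lscale k m))"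
    and "real k * (\<Phi> (lscale k n) - \<Phi> (lscale k m)) \<le> (\<Sum>j\<in>{m..<n}. exp ((s - 1) * lscale k j) * F (lscale k j))"
  using assms(3,4)
proof (induction n rule: dec_induct)
  case base
  {
    case 1
    then show ?case by simp
  next
    case 2
    then show ?case by simp
  }
next
  case (step j)
  have j: "lscale k j \<le> lscale k (Suc j)" "0 \<le> lscale k j"
    using assms(1,2) step lscale_mono[of k j "Suc j"] lscale_nonneg[of k j] by auto
  {
    case 1
    obtain \<zeta> where \<zeta>: "lscale k j \<le> \<zeta>" "\<zeta> \<le> lscale k (Suc j)"
      "real k * (\<Phi> (lscale k (Suc j)) - \<Phi> (lscale k j)) = exp ((s - 1) * \<zeta>) * F \<zeta>"
      using cell_bounds[of k j len \<Phi> s F] assms(1,2) step(1) 1 deriv by auto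
    have "{m<..Suc j} = insert (Suc j) {m<..j}" using step by auto
    then show ?case
      using step.IH(1) anti[of \<zeta> "lscale k (Suc j)"] \<zeta> 1 j by (simp add: algebra_simps)
  next
    case 2
    obtain \<zeta> where \<zeta>: "lscale k j \<le> \<zeta>" "\<zeta> \<le> lscale k (Suc j)"
      "real k * (\<Phi> (lscale k (Suc j)) - \<Phi> (lscale k j)) = exp ((s - 1) * \<zeta>) * F \<zeta>"
      using cell_bounds[of k j len \<Phi> s F] assms(1,2) step(1) 2 deriv by auto
    show ?case
      using step.IH(2) anti[of "lscale k j" \<zeta>] \<zeta> 2 j step(1) by (simp add: algebra_simps)
  }
qed

lemma sum_monotone_bound:
  fixes \<Phi> F :: "real \<Rightarrow> real"
  assumes "0 < k" "k \<le> m" "m \<le> n" "lscale k n \<le> len"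
    and deriv: "\<And>z. 0 \<le> z \<Longrightarrow> z \<le> len \<Longrightarrow> (\<Phi> has_real_derivative exp (s * z) * F z) (at z)"
    and mono: "\<And>x y. 0 \<le> x \<Longrightarrow> x \<le> y \<Longrightarrow> y \<le> len \<Longrightarrow> exp ((s - 1) * x) * F x \<le> exp ((s - 1) * y) * F y"
  shows "real k * (\<Phi> (lscale k n) - \<Phi> (lscale k m)) \<le> (\<Sum>j\<in>{m<..n}. exp ((s - 1) * lscale k j) * F (lscale k j))"
  using sum_antitone_bounds(1)[of k m n len "\<lambda>z. - \<Phi> z" s "\<lambda>z. - F z"] assms(1-4) mono
    DERIV_minus[OF deriv]
  by (simp add: sum_negf algebra_simps)

text \<open>\<open>i powr (- \<gamma>) * j powr (\<gamma> - 1)\<close> is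
  \<open>1 / sqrt (i * j)\<close> times \<open>(i / j) powr (1/2 - \<gamma>)\<close>, which exhibits
  the kernel. The truncation at 1 is never active because \<open>\<beta> \<le> 1\<close> and both
  exponents are at most 0.\<close>

lemma link_edge_prob:
  assumes "0 \<le> \<beta>" "\<beta> \<le> 1" "0 \<le> \<gamma>" "\<gamma> < 1/2" "0 < k" "0 < i" "i < j"
  shows "link (edge_prob_of \<gamma> \<beta>) i j =
      \<beta> / real k * exp (- lscale k i / 2) * exp (- lscale k j / 2) * exp (- (1/2 - \<gamma>) * (lscale k j - lscale k i))"
    and "link (edge_prob_of \<gamma> \<beta>) j i = link (edge_prob_of \<gamma> \<beta>) i j"
proof -
  have pos: "0 < real k" "0 < real i" "0 < real j" "1 \<le> real i" "1 \<le> real j" using assms by auto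
  have "real i powr - \<gamma> * real j powr (\<gamma> - 1) \<le> 1 * 1"
    using pos assms powr_mono[of "- \<gamma>" 0 "real i"] powr_mono[of "\<gamma> - 1" 0 "real j"] by (intro mult_mono) auto
  then have "\<beta> * (real i powr - \<gamma> * real j powr (\<gamma> - 1)) \<le> 1 * 1"
    using assms by (intro mult_mono) auto
  then have "link (edge_prob_of \<gamma> \<beta>) i j = \<beta> * (real i powr - \<gamma> * real j powr (\<gamma> - 1))"
    using assms by (simp add: link_def edge_prob_of_def edge_prob_def)
  also have "real i powr - \<gamma> * real j powr (\<gamma> - 1) = exp (- \<gamma> * ln (real i) + (\<gamma> - 1) * ln (real j))"
    using pos by (simp add: powr_def exp_add[symmetric])
  also have "- \<gamma> * ln (real i) + (\<gamma> - 1) * ln (real j) =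
      - ln (real k) + - lscale k i / 2 + - lscale k j / 2 + - (1/2 - \<gamma>) * (lscale k j - lscale k i)"
    using pos by (simp add: lscale_def ln_div field_simps)
  finally show "link (edge_prob_of \<gamma> \<beta>) i j =
      \<beta> / real k * exp (- lscale k i / 2) * exp (- lscale k j / 2) * exp (- (1/2 - \<gamma>) * (lscale k j - lscale k i))"
    using pos by (simp only: exp_add exp_minus[of "ln (real k)"] exp_ln) (simp add: field_simps)
  show "link (edge_prob_of \<gamma> \<beta>) j i = link (edge_prob_of \<gamma> \<beta>) i j"
    using assms by (simp add: link_def min.commute max.commute)
qed

text \<open>The factors \<open>exp (- z / 2)\<close> of the kernel and of the summand combine to
  \<open>exp (- z)\<close>, so both parts become Riemann sums for \<open>exp (a * z) * F z\<close>
  and \<open>exp (- a * z) * F z\<close>. With \<open>m \<le> Suc i\<close> the sum may start at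
  \<open>Suc k\<close> even for \<open>i = k\<close>.\<close>

lemma sum_link:
  fixes F :: "real \<Rightarrow> real" and \<gamma> :: real
  defines "a \<equiv> 1/2 - \<gamma>"
  assumes "0 \<le> \<beta>" "\<beta> \<le> 1" "0 \<le> \<gamma>" "\<gamma> < 1/2" "0 < k" "0 < i" "0 < m" "m \<le> Suc i" "i \<le> n"
  shows "(\<Sum>j=m..n. link (edge_prob_of \<gamma> \<beta>) i j * (exp (- lscale k j / 2) * F (lscale k j))) =
    \<beta> / real k * exp (- lscale k i / 2) *
      (exp (- a * lscale k i) * (\<Sum>j\<in>{m..<i}. exp ((a - 1) * lscale k j) * F (lscale k j)) +
       exp (a * lscale k i) * (\<Sum>j\<in>{i<..n}. exp ((- a - 1) * lscale k j) * F (lscale k j)))"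
proof -
  let ?f = "\<lambda>j. link (edge_prob_of \<gamma> \<beta>) i j * (exp (- lscale k j / 2) * F (lscale k j))"
  have "{m..n} - {i} = {m..<i} \<union> {i<..n}" using assms by auto
  moreover have "sum ?f {m..n} = sum ?f ({m..n} - {i})"
    by (intro sum.mono_neutral_right) (auto simp: link_def)
  ultimately have "sum ?f {m..n} = sum ?f ({m..<i} \<union> {i<..n})" by simp
  also have "\<dots> = sum ?f {m..<i} + sum ?f {i<..n}"
    by (intro sum.union_disjoint) auto
  also have "sum ?f {m..<i} = \<beta> / real k * exp (- lscale k i / 2) *
      (exp (- a * lscale k i) * (\<Sum>j\<in>{m..<i}. exp ((a - 1) * lscale k j) * F (lscale k j)))"
    unfolding sum_distrib_left
  proof (intro sum.cong refl)
    fix j assume j: "j \<in> {m..<i}"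
    then have "link (edge_prob_of \<gamma> \<beta>) i j = \<beta> / real k * exp (- lscale k j / 2) * exp (- lscale k i / 2) *
        exp (- a * (lscale k i - lscale k j))"
      using link_edge_prob[of \<beta> \<gamma> k j i] assms by auto
    moreover have "exp (- lscale k j / 2) * (exp (- a * (lscale k i - lscale k j)) * exp (- lscale k j / 2)) =
        exp (- a * lscale k i) * exp ((a - 1) * lscale k j)"
      by (simp add: exp_add[symmetric] algebra_simps)
    ultimately show "?f j = \<beta> / real k * exp (- lscale k i / 2) *
        (exp (- a * lscale k i) * (exp ((a - 1) * lscale k j) * F (lscale k j)))"
      by (simp add: algebra_simps)
  qed
  also have "sum ?f {i<..n} = \<beta> / real k * exp (- lscale k i / 2) *
      (exp (a * lscale k i) * (\<Sum>j\<in>{i<..n}. exp ((- a - 1) * lscale k j) * F (lscale k j)))"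
    unfolding sum_distrib_left
  proof (intro sum.cong refl)
    fix j assume j: "j \<in> {i<..n}"
    then have "link (edge_prob_of \<gamma> \<beta>) i j = \<beta> / real k * exp (- lscale k i / 2) * exp (- lscale k j / 2) *
        exp (- a * (lscale k j - lscale k i))"
      using link_edge_prob[of \<beta> \<gamma> k i j] assms by auto
    moreover have "exp (- lscale k j / 2) * (exp (- a * (lscale k j - lscale k i)) * exp (- lscale k j / 2)) =
        exp (a * lscale k i) * exp ((- a - 1) * lscale k j)"
      by (simp add: exp_add[symmetric] algebra_simps)
    ultimately show "?f j = \<beta> / real k * exp (- lscale k i / 2) *
        (exp (a * lscale k i) * (exp ((- a - 1) * lscale k j) * F (lscale k j)))"
      by (simp add: algebra_simps)
  qed
  finally show ?thesis by (simp add: algebra_simps)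
qed

text \<open>The convolution of \<open>F\<close> with \<open>\<lambda>z. exp (- a * \<bar>z\<bar>)\<close> over \<open>[0, len]\<close>, in terms of antiderivatives
  \<open>A\<close> and \<open>B\<close> of \<open>\<lambda>z. exp (a * z) * F z\<close> and \<open>\<lambda>z. exp (- a * z) * F z\<close>.\<close>

definition conv :: "real \<Rightarrow> real \<Rightarrow> (real \<Rightarrow> real) \<Rightarrow> (real \<Rightarrow> real) \<Rightarrow> real \<Rightarrow> real" where
  "conv a len A B z = exp (- a * z) * (A z - A 0) + exp (a * z) * (B len - B z)"

lemma antitone_exp_mult:
  fixes F :: "real \<Rightarrow> real"
  assumes "s \<le> 1/2" "\<And>z. 0 \<le> z \<Longrightarrow> z \<le> len \<Longrightarrow> 0 \<le> F z"
    and anti: "\<And>x y. 0 \<le> x \<Longrightarrow> x \<le> y \<Longrightarrow> y \<le> len \<Longrightarrow> exp (- y / 2) * F y \<le> exp (- x / 2) * F x"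
    and "0 \<le> x" "x \<le> y" "y \<le> len"
  shows "exp ((s - 1) * y) * F y \<le> exp ((s - 1) * x) * F x"
proof -
  have "exp ((s - 1) * z) = exp ((s - 1/2) * z) * exp (- z / 2)" for z :: real
    by (simp add: exp_add[symmetric] algebra_simps)
  then have eq: "exp ((s - 1) * z) * F z = exp ((s - 1/2) * z) * (exp (- z / 2) * F z)" for z
    by simp
  have "exp ((s - 1/2) * y) \<le> exp ((s - 1/2) * x)"
    using assms by (simp add: mult_left_mono_neg)
  then show ?thesis
    unfolding eq using anti[OF assms(4-6)] assms(2)[of y] assms(4-6) by (rule_tac mult_mono) auto
qed

text \<open>Leaving out \<open>k\<close> is what allows right-endpoint sums on both sides of
  \<open>i\<close>: the bound by the convolution then holds without any discretisation
  error.\<close>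

lemma sum_link_upper:
  fixes A B F :: "real \<Rightarrow> real" and \<gamma> :: real
  defines "a \<equiv> 1/2 - \<gamma>"
  assumes "0 \<le> \<beta>" "\<beta> \<le> 1" "0 \<le> \<gamma>" "\<gamma> < 1/2" "0 < k" "k \<le> i" "i \<le> n"
    and A: "\<And>z. 0 \<le> z \<Longrightarrow> z \<le> lscale k n \<Longrightarrow> (A has_real_derivative exp (a * z) * F z) (at z)"
    and B: "\<And>z. 0 \<le> z \<Longrightarrow> z \<le> lscale k n \<Longrightarrow> (B has_real_derivative exp (- a * z) * F z) (at z)"
    and nonneg: "\<And>z. 0 \<le> z \<Longrightarrow> z \<le> lscale k n \<Longrightarrow> 0 \<le> F z"
    and anti: "\<And>x y. 0 \<le> x \<Longrightarrow> x \<le> y \<Longrightarrow> y \<le> lscale k n \<Longrightarrow> exp (- y / 2) * F y \<le> exp (- x / 2) * F x"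
  shows "(\<Sum>j=Suc k..n. link (edge_prob_of \<gamma> \<beta>) i j * (exp (- lscale k j / 2) * F (lscale k j)))
    \<le> \<beta> * exp (- lscale k i / 2) * conv a (lscale k n) A B (lscale k i)"
proof -
  have z: "0 \<le> lscale k i" "lscale k i \<le> lscale k n"
    using assms lscale_nonneg[of k i] lscale_mono[of k i n] by auto
  have "(\<Sum>j\<in>{Suc k..<i}. exp ((a - 1) * lscale k j) * F (lscale k j)) \<le>
      (\<Sum>j\<in>{k<..i}. exp ((a - 1) * lscale k j) * F (lscale k j))"
    using assms lscale_nonneg[of k] lscale_mono[of k _ n] by (intro sum_mono2) (auto intro!: mult_nonneg_nonneg nonneg)
  also have "\<dots> \<le> real k * (A (lscale k i) - A (lscale k k))"
    using assms z antitone_exp_mult[of a "lscale k n" F]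
    by (intro sum_antitone_bounds(1)[where len = "lscale k n"]) auto
  finally have left: "(\<Sum>j\<in>{Suc k..<i}. exp ((a - 1) * lscale k j) * F (lscale k j)) \<le> real k * (A (lscale k i) - A 0)"
    using assms by simp
  have right: "(\<Sum>j\<in>{i<..n}. exp ((- a - 1) * lscale k j) * F (lscale k j)) \<le> real k * (B (lscale k n) - B (lscale k i))"
    using assms z antitone_exp_mult[of "- a" "lscale k n" F]
    by (intro sum_antitone_bounds(1)[where len = "lscale k n"]) auto
  have "(\<Sum>j=Suc k..n. link (edge_prob_of \<gamma> \<beta>) i j * (exp (- lscale k j / 2) * F (lscale k j))) =
    \<beta> / real k * exp (- lscale k i / 2) *
      (exp (- a * lscale k i) * (\<Sum>j\<in>{Suc k..<i}. exp ((a - 1) * lscale k j) * F (lscale k j)) +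
       exp (a * lscale k i) * (\<Sum>j\<in>{i<..n}. exp ((- a - 1) * lscale k j) * F (lscale k j)))"
    unfolding a_def using assms by (intro sum_link) auto
  also have "\<dots> \<le> \<beta> / real k * exp (- lscale k i / 2) *
      (exp (- a * lscale k i) * (real k * (A (lscale k i) - A 0)) +
       exp (a * lscale k i) * (real k * (B (lscale k n) - B (lscale k i))))"
    using assms left right by (intro mult_left_mono add_mono) auto
  also have "\<dots> = \<beta> * exp (- lscale k i / 2) * conv a (lscale k n) A B (lscale k i)"
    using assms by (simp add: conv_def field_simps)
  finally show ?thesis .
qed

lemma exp_neg_mult_antimono:
  fixes F F' :: "real \<Rightarrow> real"
  assumes deriv: "\<And>z. x \<le> z \<Longrightarrow> z \<le> y \<Longrightarrow> (F has_real_derivative F' z) (at z)"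
    and le: "\<And>z. x \<le> z \<Longrightarrow> z \<le> y \<Longrightarrow> F' z \<le> s * F z"
    and "x \<le> y"
  shows "exp (- s * y) * F y \<le> exp (- s * x) * F x"
proof (rule DERIV_nonpos_imp_nonincreasing[of x y "\<lambda>z. exp (- s * z) * F z"])
  fix z assume z: "x \<le> z" "z \<le> y"
  have "((\<lambda>z. exp (- s * z) * F z) has_real_derivative exp (- s * z) * (F' z - s * F z)) (at z)"
    using deriv[OF z] by (auto intro!: derivative_eq_intros simp: algebra_simps)
  moreover have "exp (- s * z) * (F' z - s * F z) \<le> 0"
    using le[OF z] by (simp add: mult_le_0_iff)
  ultimately show "\<exists>d. ((\<lambda>z. exp (- s * z) * F z) has_real_derivative d) (at z) \<and> d \<le> 0"
    by blast
qed fact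

text \<open>The edge kernel on the logarithmic scale is \<open>\<beta> * exp (- a * \<bar>x - y\<bar>)\<close> with
  \<open>2 * a * \<beta> = a\<^sup>2 - \<mu>\<close>, and its harmonic functions solve \<open>F'' = \<mu> * F\<close>. The pair \<open>S\<close>, \<open>C\<close> is
  \<open>sinh\<close>, \<open>cosh\<close> or \<open>sin\<close>, \<open>cos\<close>, suitably scaled; the last assumption keeps \<open>L\<close> away from
  the first positive zero of \<open>S\<close>.\<close>

locale wave =
  fixes a \<mu> :: real and S C :: "real \<Rightarrow> real" and L :: real
  assumes a: "0 < a" "a \<le> 1/2" and mu: "\<bar>\<mu>\<bar> \<le> a\<^sup>2 / 64"
    and S_deriv: "\<And>z. (S has_real_derivative C z) (at z)"
    and C_deriv: "\<And>z. (C has_real_derivative \<mu> * S z) (at z)"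
    and S_0 [simp]: "S 0 = 0" and C_0 [simp]: "C 0 = 1"
    and S_add: "\<And>x y. S (x + y) = S x * C y + C x * S y"
    and S_diff: "\<And>x y. S (x - y) = S x * C y - C x * S y"
    and S_nonneg: "\<And>z. 0 \<le> z \<Longrightarrow> z \<le> L \<Longrightarrow> 0 \<le> S z"
    and S_le: "\<And>z. 0 \<le> z \<Longrightarrow> z \<le> L \<Longrightarrow> S z \<le> 32 * exp (z / 16)"
    and abs_C_le: "\<And>z. 0 \<le> z \<Longrightarrow> z \<le> L \<Longrightarrow> \<bar>C z\<bar> \<le> exp (z / 16)"
    and C_ge: "\<And>z. 0 \<le> z \<Longrightarrow> z \<le> L \<Longrightarrow> - 1 \<le> C z"
    and C_le: "\<And>z. 0 \<le> z \<Longrightarrow> z \<le> L \<Longrightarrow> C z \<le> 1 + a / 8 * S z"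
    and S_large: "\<And>z. 0 \<le> z \<Longrightarrow> z \<le> L \<Longrightarrow> (1/2 \<le> C z \<and> z / 2 \<le> S z) \<or> 100 / a \<le> S z"
begin

definition \<beta> :: real where "\<beta> = (a\<^sup>2 - \<mu>) / (2 * a)"

text \<open>Measured in units of \<open>a\<^sup>2\<close>, the parameter \<open>\<mu>\<close> enters
  the estimates only through numbers close to 1, independently of \<open>a\<close>.\<close>

lemma mu_frac: obtains m where "\<mu> = a\<^sup>2 * m" "\<bar>m\<bar> \<le> 1/64" "\<beta> = a * (1 - m) / 2"
proof
  show "\<mu> = a\<^sup>2 * (\<mu> / a\<^sup>2)" using a by simp
  show "\<bar>\<mu> / a\<^sup>2\<bar> \<le> 1/64" using a mu by (simp add: abs_divide field_simps)
  show "\<beta> = a * (1 - \<mu> / a\<^sup>2) / 2" using a by (simp add: \<beta>_def field_simps power2_eq_square)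
qed

lemma beta_bounds: "a / 4 \<le> \<beta>" "\<beta> \<le> 1/2" "0 < \<beta>" "\<beta> \<le> 1"
proof -
  obtain m where m: "\<bar>m\<bar> \<le> 1/64" "\<beta> = a * (1 - m) / 2" using mu_frac by metis
  have m': "1/2 \<le> 1 - m" "1 - m \<le> 2" using m(1) by auto
  have "a * (1/2) \<le> a * (1 - m)" "a * (1 - m) \<le> (1/2) * 2"
    using a m' by (intro mult_left_mono mult_mono; simp)+
  then show "a / 4 \<le> \<beta>" "\<beta> \<le> 1/2" "0 < \<beta>" "\<beta> \<le> 1"
    using a m(2) by linarith+
qed

section \<open>Explicit solutions and their convolutions\<close>

definition hump :: "real \<Rightarrow> real \<Rightarrow> real" where "hump c z = S z + c * C z"
definition hump' :: "real \<Rightarrow> real \<Rightarrow> real" where "hump' c z = C z + c * \<mu> * S z"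
text \<open>Integrating by parts twice and using \<open>hump'' = \<mu> * hump\<close> gives these
  antiderivatives of \<open>exp (a * z) * hump c z\<close> and, below, of
  \<open>exp (- a * z) * hump c z\<close>.\<close>

definition humpA :: "real \<Rightarrow> real \<Rightarrow> real" where
  "humpA c z = exp (a * z) * (a * hump c z - hump' c z) / (a\<^sup>2 - \<mu>)"
definition humpB :: "real \<Rightarrow> real \<Rightarrow> real" where
  "humpB c z = - (exp (- a * z) * (a * hump c z + hump' c z) / (a\<^sup>2 - \<mu>))"

lemma a2_mu: "0 < a\<^sup>2 - \<mu>"
  using beta_bounds(3) a by (simp add: \<beta>_def zero_less_divide_iff)

lemma hump_deriv: "(hump c has_real_derivative hump' c z) (at z)"
  unfolding hump_def hump'_def
  by (auto intro!: derivative_eq_intros S_deriv C_deriv simp: algebra_simps)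

lemma hump'_deriv: "(hump' c has_real_derivative \<mu> * hump c z) (at z)"
  unfolding hump_def hump'_def
  by (auto intro!: derivative_eq_intros S_deriv C_deriv simp: algebra_simps)

lemma humpA_deriv: "(humpA c has_real_derivative exp (a * z) * hump c z) (at z)"
proof -
  have "(humpA c has_real_derivative
      (exp (a * z) * (a * hump' c z - \<mu> * hump c z) + a * exp (a * z) * (a * hump c z - hump' c z)) / (a\<^sup>2 - \<mu>)) (at z)"
    unfolding humpA_def
    by (intro DERIV_cdivide) (auto intro!: derivative_eq_intros hump_deriv hump'_deriv simp: algebra_simps)
  also have "(exp (a * z) * (a * hump' c z - \<mu> * hump c z) + a * exp (a * z) * (a * hump c z - hump' c z)) / (a\<^sup>2 - \<mu>)
      = exp (a * z) * hump c z * (a\<^sup>2 - \<mu>) / (a\<^sup>2 - \<mu>)"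
    by (intro arg_cong2[where f = "(/)"] refl) (simp add: algebra_simps power2_eq_square)
  finally show ?thesis using a2_mu by simp
qed

lemma humpB_deriv: "(humpB c has_real_derivative exp (- a * z) * hump c z) (at z)"
proof -
  have "(humpB c has_real_derivative
      - ((exp (- a * z) * (a * hump' c z + \<mu> * hump c z) - a * exp (- a * z) * (a * hump c z + hump' c z)) / (a\<^sup>2 - \<mu>))) (at z)"
    unfolding humpB_def
    by (intro DERIV_cdivide DERIV_minus) (auto intro!: derivative_eq_intros hump_deriv hump'_deriv simp: algebra_simps)
  also have "- ((exp (- a * z) * (a * hump' c z + \<mu> * hump c z) - a * exp (- a * z) * (a * hump c z + hump' c z)) / (a\<^sup>2 - \<mu>))
      = exp (- a * z) * hump c z * (a\<^sup>2 - \<mu>) / (a\<^sup>2 - \<mu>)"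
    unfolding minus_divide_left
    by (intro arg_cong2[where f = "(/)"] refl) (simp add: algebra_simps power2_eq_square)
  finally show ?thesis using a2_mu by simp
qed

lemma exp_mult_cancel: "exp (- a * z) * exp (a * z) = (1::real)" "exp (a * z) * exp (- a * z) = (1::real)"
  by (simp_all add: exp_add[symmetric])

text \<open>Both boundary terms are defects in Robin conditions. The one at 0 vanishes exactly for
  \<open>c = 1 / a\<close>; the one at \<open>len\<close> is the mass that the kernel would send
  beyond the end.\<close>

lemma conv_hump:
  "\<beta> * conv a len (humpA c) (humpB c) z = hump c z - exp (- a * z) * ((a * c - 1) / (2 * a))
     - exp (- a * (len - z)) * ((a * hump c len + hump' c len) / (2 * a))"
proof -
  let ?D = "a\<^sup>2 - \<mu>"
  have D: "?D \<noteq> 0" using a2_mu by simp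
  have rearrange: "(x - y) / D - e1 * (p / D) + (- (e2 * (q / D)) + (x + y) / D) = (2 * x - e1 * p - e2 * q) / D"
    if "D \<noteq> 0" for D x y p q e1 e2 :: real
    using that by (simp add: field_simps)
  have e: "exp (- a * (len - z)) = exp (a * z) * exp (- a * len)"
    by (simp add: exp_add[symmetric] algebra_simps)
  have "exp (- a * z) * humpA c z = (a * hump c z - hump' c z) / ?D"
    using exp_mult_cancel(1)[of z] by (simp add: humpA_def mult.assoc[symmetric] del: mult_minus_left)
  moreover have "exp (a * z) * humpB c z = - ((a * hump c z + hump' c z) / ?D)"
    using exp_mult_cancel(2)[of z] by (simp add: humpB_def mult.assoc[symmetric] del: mult_minus_left)
  moreover have "humpA c 0 = (a * c - 1) / ?D"
    by (simp add: humpA_def hump_def hump'_def)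
  moreover have "exp (a * z) * humpB c len = - (exp (- a * (len - z)) * ((a * hump c len + hump' c len) / ?D))"
    unfolding humpB_def e by simp
  ultimately have "conv a len (humpA c) (humpB c) z =
      (a * hump c z - hump' c z) / ?D - exp (- a * z) * ((a * c - 1) / ?D) +
      (- (exp (- a * (len - z)) * ((a * hump c len + hump' c len) / ?D)) + (a * hump c z + hump' c z) / ?D)"
    unfolding conv_def by (simp add: algebra_simps)
  also have "\<dots> = (2 * a * hump c z - exp (- a * z) * (a * c - 1)
      - exp (- a * (len - z)) * (a * hump c len + hump' c len)) / ?D"
    using rearrange[OF D] by (simp only: mult.assoc)
  finally have "\<beta> * conv a len (humpA c) (humpB c) z = (2 * a * hump c z - exp (- a * z) * (a * c - 1)
      - exp (- a * (len - z)) * (a * hump c len + hump' c len)) / (2 * a)"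
    unfolding \<beta>_def using D by simp
  moreover have "(2 * a * x - e1 * p - e2 * q) / (2 * a) = x - e1 * (p / (2 * a)) - e2 * (q / (2 * a))"
    for x e1 e2 p q
    using a by (simp add: field_simps)
  ultimately show ?thesis by simp
qed

definition expA :: "real \<Rightarrow> real" where "expA z = exp (3 * a / 4 * z) / (3 * a / 4)"
definition expB :: "real \<Rightarrow> real" where "expB z = - (exp (- (5 * a / 4) * z) / (5 * a / 4))"

lemma expA_deriv: "(expA has_real_derivative exp (a * z) * exp (- a / 4 * z)) (at z)"
  unfolding expA_def exp_add[symmetric] using a
  by (auto intro!: derivative_eq_intros simp: algebra_simps)

lemma expB_deriv: "(expB has_real_derivative exp (- a * z) * exp (- a / 4 * z)) (at z)"
  unfolding expB_def exp_add[symmetric] using a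
  by (auto intro!: derivative_eq_intros simp: algebra_simps)

text \<open>The factor is \<open>2 * a / (a\<^sup>2 - (a / 4)\<^sup>2) = 32 / (15 * a)\<close>.
  Times \<open>\<beta>\<close>, about \<open>a / 2\<close>, this is about 16/15, so subtracting the
  exponential helps a supersolution and adding it helps a subsolution.\<close>

lemma conv_exp:
  "conv a len expA expB z = exp (- a / 4 * z) * (32 / (15 * a)) - exp (- a * z) * (4 / (3 * a))
     - exp (- a * (len - z)) * exp (- a / 4 * len) * (4 / (5 * a))"
proof -
  have "exp (- a * z) * exp (3 * a / 4 * z) = exp (- a / 4 * z)"
    "exp (a * z) * exp (- (5 * a / 4) * z) = exp (- a / 4 * z)"
    "exp (a * z) * exp (- (5 * a / 4) * len) = exp (- a * (len - z)) * exp (- a / 4 * len)"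
    by (simp_all add: exp_add[symmetric] algebra_simps)
  then show ?thesis
    unfolding conv_def expA_def expB_def using a
    by (simp add: algebra_simps) (simp add: field_simps)?
qed

definition topA :: "real \<Rightarrow> real \<Rightarrow> real" where "topA len z = exp ((1 + a) * z - len) / (1 + a)"
definition topB :: "real \<Rightarrow> real \<Rightarrow> real" where "topB len z = exp ((1 - a) * z - len) / (1 - a)"

lemma topA_deriv: "(topA len has_real_derivative exp (a * z) * exp (z - len)) (at z)"
proof -
  have "((\<lambda>z. exp ((1 + a) * z - len)) has_real_derivative (1 + a) * (exp (a * z) * exp (z - len))) (at z)"
    by (auto intro!: derivative_eq_intros simp: exp_add[symmetric] algebra_simps)
  from DERIV_cdivide[OF this, of "1 + a"] show ?thesis
    using a by (simp add: topA_def[abs_def])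
qed

lemma topB_deriv: "(topB len has_real_derivative exp (- a * z) * exp (z - len)) (at z)"
proof -
  have "((\<lambda>z. exp ((1 - a) * z - len)) has_real_derivative (1 - a) * (exp (- a * z) * exp (z - len))) (at z)"
    by (auto intro!: derivative_eq_intros simp: exp_add[symmetric] algebra_simps)
  from DERIV_cdivide[OF this, of "1 - a"] show ?thesis
    using a by (simp add: topB_def[abs_def])
qed

text \<open>A function concentrated at the right end convolves to a positive multiple of
  \<open>exp (- a * (len - z))\<close>, the shape of the boundary term at \<open>len\<close>, up to
  terms that are themselves concentrated there.\<close>

lemma conv_top:
  "conv a len (topA len) (topB len) z = exp (z - len) * (1 / (1 + a) - 1 / (1 - a))
     - exp (- a * z - len) / (1 + a) + exp (- a * (len - z)) / (1 - a)"
proof -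
  have "exp (- a * z) * exp ((1 + a) * z - len) = exp (z - len)"
    "exp (a * z) * exp ((1 - a) * z - len) = exp (z - len)"
    "exp (- a * z) * exp (- len) = exp (- a * z - len)"
    "exp (a * z) * exp ((1 - a) * len - len) = exp (- a * (len - z))"
    by (simp_all add: exp_add[symmetric] algebra_simps)
  then show ?thesis
    unfolding conv_def topA_def topB_def
    by (simp add: algebra_simps)
qed

end

context wave
begin

subsection \<open>A supersolution\<close>

text \<open>\<open>hump (1 / a)\<close> would be harmonic on the half-line. The exponential makes \<open>F\<close> strictly
  superharmonic, which absorbs the nonlinear term, and the larger coefficient of \<open>C\<close> pays for its
  boundary term at \<open>0\<close>.\<close>

definition F :: "real \<Rightarrow> real" where "F z = hump (1 / a + 4) z - exp (- a / 4 * z)"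
definition F' :: "real \<Rightarrow> real" where "F' z = hump' (1 / a + 4) z + a / 4 * exp (- a / 4 * z)"
definition FA :: "real \<Rightarrow> real" where "FA z = humpA (1 / a + 4) z - expA z"
definition FB :: "real \<Rightarrow> real" where "FB z = humpB (1 / a + 4) z - expB z"

lemma inverse_a_ge: "2 \<le> 1 / a"
  using a by (simp add: field_simps)

text \<open>This case split decides the positivity estimates below: either \<open>C\<close> is
  bounded away from 0, or \<open>C\<close> may be negative but \<open>S\<close> exceeds every
  multiple of \<open>C\<close> that occurs.\<close>

lemma C_nonneg_or_large:
  assumes "0 \<le> z" "z \<le> L"
  obtains "1/2 \<le> C z" "z / 2 \<le> S z" "0 \<le> S z" | "- 1 \<le> C z" "100 * (1 / a) \<le> S z"
  using S_large[OF assms] S_nonneg[OF assms] C_ge[OF assms] by auto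

lemma mu_hump_coeff: "\<bar>c * \<mu>\<bar> \<le> 3 * a / 64" if "\<bar>c\<bar> \<le> 1 / a + 4"
proof -
  have "\<bar>c * \<mu>\<bar> \<le> (1 / a + 4) * (a\<^sup>2 / 64)"
    unfolding abs_mult using that mu a by (intro mult_mono) auto
  also have "\<dots> = (a + 4 * a * a) / 64"
    using a by (simp add: field_simps power2_eq_square)
  also have "4 * a * a \<le> 4 * a * (1/2)"
    using a by (intro mult_left_mono) auto
  finally show ?thesis by simp
qed

lemma F_deriv: "(F has_real_derivative F' z) (at z)"
  unfolding F_def F'_def by (auto intro!: derivative_eq_intros hump_deriv)

lemma FA_deriv: "(FA has_real_derivative exp (a * z) * F z) (at z)"
  unfolding FA_def F_def right_diff_distrib by (intro DERIV_diff humpA_deriv expA_deriv)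

lemma FB_deriv: "(FB has_real_derivative exp (- a * z) * F z) (at z)"
  unfolding FB_def F_def right_diff_distrib by (intro DERIV_diff humpB_deriv expB_deriv)

lemma exp_quarter: "0 \<le> z \<Longrightarrow> exp (- a / 4 * z) \<le> 1" "0 < exp (- a / 4 * z)"
  using a by auto

lemma F_ge_1:
  assumes "0 \<le> z" "z \<le> L"
  shows "1 \<le> F z"
  using assms
proof (cases rule: C_nonneg_or_large)
  case 1
  have "6 * (1/2) \<le> (1 / a + 4) * C z"
    using 1 inverse_a_ge by (intro mult_mono) auto
  then show ?thesis
    using 1(3) exp_quarter(1)[OF assms(1)] unfolding F_def hump_def by linarith
next
  case 2
  have "(1 / a + 4) * (- 1) \<le> (1 / a + 4) * C z"
    using 2 inverse_a_ge by (intro mult_left_mono) auto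
  from add_mono[OF this order.refl[of "S z"]] have "S z - (1 / a + 4) \<le> hump (1 / a + 4) z"
    unfolding hump_def by simp
  then have "S z - (1 / a + 4) - 1 \<le> F z"
    using exp_quarter(1)[OF assms(1)] unfolding F_def by linarith
  then show ?thesis
    using 2 inverse_a_ge by linarith
qed

text \<open>The rate 1/16 is small enough for the nonlinear term: the square of
  \<open>exp (- z / 2) * F z\<close> decays like \<open>exp (- 7/8 * z)\<close>, faster than the
  residual \<open>exp (- z / 2) * exp (- a / 4 * z)\<close>.\<close>

lemma F_le:
  assumes "0 \<le> z" "z \<le> L"
  shows "F z \<le> (36 + 1 / a) * exp (z / 16)"
proof -
  have "(1 / a + 4) * C z \<le> (1 / a + 4) * exp (z / 16)"
    using abs_C_le[OF assms] inverse_a_ge by (intro mult_left_mono) auto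
  then show ?thesis
    using S_le[OF assms] exp_quarter(2)[of z] unfolding F_def hump_def ring_distribs by linarith
qed

text \<open>Equivalently, \<open>exp (- z / 2) * F z\<close> is antitone, as the comparison of sums
  with integrals demands. For negative \<open>C\<close> the large value of \<open>S\<close> takes
  over.\<close>

lemma F_slope:
  assumes "0 \<le> z" "z \<le> L"
  shows "F' z \<le> 1/2 * F z"
proof -
  define c where "c = 1 / a + 4"
  have c: "6 \<le> c" "\<bar>c * \<mu>\<bar> \<le> 3 * a / 64"
    using inverse_a_ge mu_hump_coeff[of c] by (auto simp: c_def)
  then have c': "c * \<mu> \<le> 1/4"
    using a by linarith
  have "1/2 * F z - F' z = (1/2 - c * \<mu>) * S z + (c / 2 - 1) * C z - (1/2 + a / 4) * exp (- a / 4 * z)"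
    by (simp add: F_def F'_def hump_def hump'_def c_def[symmetric] algebra_simps)
  moreover have "(1/2 + a / 4) * exp (- a / 4 * z) \<le> 1 * 1"
    using a exp_quarter(1)[OF assms(1)] by (intro mult_mono) auto
  moreover have "1 \<le> (1/2 - c * \<mu>) * S z + (c / 2 - 1) * C z"
    using assms
  proof (cases rule: C_nonneg_or_large)
    case 1
    have "2 * (1/2) \<le> (c / 2 - 1) * C z" using 1 c by (intro mult_mono) auto
    moreover have "0 \<le> (1/2 - c * \<mu>) * S z" using 1 c' by (intro mult_nonneg_nonneg) auto
    ultimately show ?thesis by simp
  next
    case 2
    have "(c / 2 - 1) * (- 1) \<le> (c / 2 - 1) * C z"
      using 2 c by (intro mult_left_mono) auto
    moreover have "S z / 4 \<le> (1/2 - c * \<mu>) * S z"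
      using c' S_nonneg[OF assms] mult_right_mono[of "1/4" "1/2 - c * \<mu>" "S z"] by simp
    ultimately have "S z / 4 + (c / 2 - 1) * (- 1) \<le> (1/2 - c * \<mu>) * S z + (c / 2 - 1) * C z"
      by (intro add_mono)
    moreover have "1 \<le> S z / 4 + (c / 2 - 1) * (- 1)"
      using 2 inverse_a_ge unfolding c_def by simp
    ultimately show ?thesis by (rule order.trans[rotated])
  qed
  ultimately show ?thesis by linarith
qed

lemma F_antitone:
  assumes "0 \<le> x" "x \<le> y" "y \<le> L"
  shows "exp (- y / 2) * F y \<le> exp (- x / 2) * F x"
  using exp_neg_mult_antimono[of x y F F' "1/2"] assms F_deriv F_slope by simp

lemma beta_conv_exp:
  obtains m where "\<bar>m\<bar> \<le> 1/64"
    "\<And>len z. \<beta> * conv a len expA expB z = 16/15 * (1 - m) * exp (- a / 4 * z)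
      - 2/3 * (1 - m) * exp (- a * z) - 2/5 * (1 - m) * exp (- a / 4 * len) * exp (- a * (len - z))"
proof -
  obtain m where m: "\<bar>m\<bar> \<le> 1/64" "\<beta> = a * (1 - m) / 2" using mu_frac by metis
  have c: "\<beta> * (32 / (15 * a)) = 16/15 * (1 - m)" "\<beta> * (4 / (3 * a)) = 2/3 * (1 - m)"
    "\<beta> * (4 / (5 * a)) = 2/5 * (1 - m)"
    using a unfolding m by (simp_all add: field_simps)
  have "\<beta> * conv a len expA expB z = \<beta> * (32 / (15 * a)) * exp (- a / 4 * z)
      - \<beta> * (4 / (3 * a)) * exp (- a * z) - \<beta> * (4 / (5 * a)) * exp (- a / 4 * len) * exp (- a * (len - z))" for len z
    unfolding conv_exp by (simp add: algebra_simps)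
  then show ?thesis
    using m(1) that unfolding c by blast
qed

text \<open>The first residual term absorbs the nonlinearity; the last one, located at the right
  end, becomes the weight that counts vertices. The coefficient \<open>Q\<close> of the boundary
  term at \<open>len\<close> exceeds the required amount by 1/2, which covers the boundary term of
  the exponential there.\<close>

lemma F_residual:
  assumes "0 \<le> z" "z \<le> len" "len \<le> L"
  shows "\<beta> * conv a len FA FB z \<le>
    F z - 1/20 * exp (- a / 4 * z) - (S len + 1) / 16 * exp (- a * (len - z))"
proof -
  define c where "c = 1 / a + 4"
  have c: "6 \<le> c" "a * c = 1 + 4 * a" "\<bar>c * \<mu>\<bar> \<le> 3 * a / 64"
    using a inverse_a_ge mu_hump_coeff[of c] by (auto simp: c_def field_simps)
  have len: "0 \<le> len" "len \<le> L" using assms by auto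
  obtain m where m: "\<bar>m\<bar> \<le> 1/64"
    and conv_exp': "\<And>len z. \<beta> * conv a len expA expB z = 16/15 * (1 - m) * exp (- a / 4 * z)
      - 2/3 * (1 - m) * exp (- a * z) - 2/5 * (1 - m) * exp (- a / 4 * len) * exp (- a * (len - z))"
    by (rule beta_conv_exp) blast
  define Q where "Q = (a * hump c len + hump' c len) / (2 * a)"
  define E1 E2 E3 where "E1 = exp (- a / 4 * z)" and "E2 = exp (- a * z)" and "E3 = exp (- a * (len - z))"
  have E: "0 < E1" "0 < E2" "0 < E3" by (auto simp: E1_def E2_def E3_def)
  have "conv a len FA FB z = conv a len (humpA c) (humpB c) z - conv a len expA expB z"
    by (simp add: conv_def FA_def FB_def c_def algebra_simps)
  then have "\<beta> * conv a len FA FB z = \<beta> * conv a len (humpA c) (humpB c) z - \<beta> * conv a len expA expB z"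
    by (simp add: right_diff_distrib)
  \<comment> \<open>The excess 4 of \<open>c\<close> over \<open>1 / a\<close> produces this 2,
    which outweighs the coefficient \<open>2/3 * (1 - m)\<close> that the exponential brings in at
    0.\<close>
  moreover have "(a * c - 1) / (2 * a) = 2"
    using a c by simp
  then have "\<beta> * conv a len (humpA c) (humpB c) z = hump c z - E2 * 2 - E3 * Q"
    by (simp only: conv_hump Q_def E2_def E3_def)
  moreover have "\<beta> * conv a len expA expB z = 16/15 * (1 - m) * E1 - 2/3 * (1 - m) * E2
      - 2/5 * (1 - m) * exp (- a / 4 * len) * E3"
    by (simp only: conv_exp' E1_def E2_def E3_def)
  moreover have "F z = hump c z - E1"
    by (simp add: F_def c_def E1_def)
  ultimately have "F z - \<beta> * conv a len FA FB z =
      (16/15 * (1 - m) - 1) * E1 + (2 - 2/3 * (1 - m)) * E2 + (Q - 2/5 * (1 - m) * exp (- a / 4 * len)) * E3"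
    by (simp only: left_diff_distrib mult.commute[of E2] mult.commute[of E3])
  \<comment> \<open>Equality holds at \<open>m = 1/64\<close>, where
    \<open>16/15 * (63/64) = 21/20\<close>. The bound on \<open>\<mu>\<close> in \<open>wave\<close>
    gives exactly this margin.\<close>
  moreover have "1/20 * E1 \<le> (16/15 * (1 - m) - 1) * E1"
    using m E by (intro mult_right_mono) auto
  moreover have "0 \<le> (2 - 2/3 * (1 - m)) * E2"
    using m E by (intro mult_nonneg_nonneg) auto
  moreover have "(S len + 1) / 16 * E3 \<le> (Q - 2/5 * (1 - m) * exp (- a / 4 * len)) * E3"
  proof (intro mult_right_mono)
    have "2/5 * (1 - m) * exp (- a / 4 * len) \<le> (1/2) * 1"
      using m a len by (intro mult_mono) auto
    moreover have "(S len + 1) / 16 + 1/2 \<le> Q"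
    proof -
      have "Q = (a + c * \<mu>) / (2 * a) * S len + (1 / a + 2) * C len"
      proof -
        have "a * hump c len + hump' c len = (a + c * \<mu>) * S len + (a * c + 1) * C len"
          by (simp add: hump_def hump'_def algebra_simps)
        moreover have "(a * c + 1) / (2 * a) = 1 / a + 2"
          using a unfolding c(2) by (simp add: field_simps)
        ultimately show ?thesis
          unfolding Q_def by (simp add: add_divide_distrib flip: times_divide_eq_left)
      qed
      moreover have "S len / 4 \<le> (a + c * \<mu>) / (2 * a) * S len"
      proof -
        have "1/4 \<le> (a + c * \<mu>) / (2 * a)"
          using a c(3) by (simp add: field_simps abs_le_iff)
        from mult_right_mono[OF this S_nonneg[OF len]] show ?thesis by simp
      qed
      ultimately have *: "S len / 4 + (1 / a + 2) * C len \<le> Q" by simp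
      show ?thesis
        using len
      proof (cases rule: C_nonneg_or_large)
        case 1
        have "4 * (1/2) \<le> (1 / a + 2) * C len"
          using 1 inverse_a_ge by (intro mult_mono) auto
        from order.trans[OF add_left_mono[OF this] *] show ?thesis using 1(3) by (simp add: field_simps)
      next
        case 2
        have "(1 / a + 2) * (- 1) \<le> (1 / a + 2) * C len"
          using 2 inverse_a_ge by (intro mult_left_mono) auto
        from order.trans[OF add_left_mono[OF this] *] have "S len / 4 - (1 / a + 2) \<le> Q" by simp
        moreover define r where "r = 1 / a"
        ultimately show ?thesis using 2 inverse_a_ge unfolding r_def[symmetric] by (simp add: field_simps)
      qed
    qed
    ultimately show "(S len + 1) / 16 \<le> Q - 2/5 * (1 - m) * exp (- a / 4 * len)" by linarith
  qed (use E in simp)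
  ultimately show ?thesis
    unfolding E1_def[symmetric] E3_def[symmetric] by linarith
qed

end

text \<open>With \<open>36 + 1 / a\<close> from \<open>F_le\<close>, the nonlinear term is at most
  1/40, half of the residual 1/20; the other half goes into the weight.\<close>

definition super_delta :: "real \<Rightarrow> real" where
  "super_delta a = 1 / (40 * (36 + 1 / a)\<^sup>2)"

text \<open>The wave lives on \<open>[0, ln n]\<close>, which contains every interval
  \<open>[0, lscale k n]\<close>; a single wave therefore serves all roots \<open>k\<close>.\<close>

locale wave_graph = wave "1/2 - \<gamma>" \<mu> S C "ln (real n)" for \<gamma> \<mu> S C and n :: nat +
  assumes \<gamma>: "0 \<le> \<gamma>" "\<gamma> < 1/2" and n: "1 \<le> n"
begin

section \<open>Supersolution on the graph and upper tail\<close>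

abbreviation "a \<equiv> 1/2 - \<gamma>"
abbreviation "p \<equiv> edge_prob_of \<gamma> \<beta>"

lemma lscale_le_L: "0 < k \<Longrightarrow> k \<le> n \<Longrightarrow> lscale k n \<le> ln (real n)"
  using n by (simp add: lscale_def divide_le_eq)

lemma lscale_in_range:
  assumes "0 < k" "k \<le> i" "i \<le> n"
  shows "0 \<le> lscale k i" "lscale k i \<le> lscale k n" "lscale k i \<le> ln (real n)"
  using assms lscale_nonneg[of k i] lscale_mono[of k i n] lscale_le_L[of k] by auto

definition super :: "nat \<Rightarrow> nat \<Rightarrow> real" where
  "super k i = super_delta a * (exp (- lscale k i / 2) * F (lscale k i))"

text \<open>This is what the residual of \<open>F\<close> leaves after the nonlinear term: half of
  its first part and all of its second part.\<close>

definition super_weight :: "nat \<Rightarrow> nat \<Rightarrow> real" where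
  "super_weight k i = super_delta a * exp (- lscale k i / 2) *
     (1/40 * exp (- a / 4 * lscale k i) + (S (lscale k n) + 1) / 16 * exp (- a * (lscale k n - lscale k i)))"

lemma super_delta_pos: "0 < super_delta a"
  using inverse_a_ge by (auto simp: super_delta_def intro!: mult_pos_pos zero_less_power)

lemma super_bounds:
  assumes "0 < k" "k \<le> i" "i \<le> n"
  shows "0 \<le> super k i" "super k i \<le> 1" "(super k i)\<^sup>2 \<le> super_delta a / 40 * (exp (- lscale k i / 2) * exp (- a / 4 * lscale k i))"
proof -
  let ?z = "lscale k i" and ?d = "super_delta a"
  define G where "G = 36 + 1 / a"
  have G: "38 \<le> G" "?d * G\<^sup>2 = 1/40"
    using inverse_a_ge by (auto simp: G_def super_delta_def)
  note z = lscale_in_range[OF assms]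
  have F: "1 \<le> F ?z" "F ?z \<le> G * exp (?z / 16)"
    using F_ge_1 F_le z by (auto simp: G_def)
  show nonneg: "0 \<le> super k i"
    using F super_delta_pos by (simp add: super_def)
  have "(super k i)\<^sup>2 = ?d * (?d * (exp (- ?z / 2) * F ?z)\<^sup>2)"
    by (simp add: super_def power2_eq_square)
  also have "(exp (- ?z / 2) * F ?z)\<^sup>2 \<le> (exp (- ?z / 2) * (G * exp (?z / 16)))\<^sup>2"
    using F by (intro power_mono mult_left_mono) auto
  also have "\<dots> = G\<^sup>2 * (exp (- ?z / 2) * exp (- ?z / 2 + ?z / 8))"
    by (simp add: power2_eq_square exp_add[symmetric])
  also have "\<dots> \<le> G\<^sup>2 * (exp (- ?z / 2) * exp (- a / 4 * ?z))"
  proof -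
    have "a / 4 * ?z \<le> 3/8 * ?z" using a z by (intro mult_right_mono) auto
    then have "- ?z / 2 + ?z / 8 \<le> - (a / 4 * ?z)" by linarith
    also have "\<dots> = - a / 4 * ?z" by (simp only: minus_divide_left mult_minus_left)
    finally have "exp (- ?z / 2 + ?z / 8) \<le> exp (- a / 4 * ?z)" by (simp only: exp_le_cancel_iff)
    then show ?thesis by (intro mult_left_mono) auto
  qed
  finally have "(super k i)\<^sup>2 \<le> ?d * (?d * (G\<^sup>2 * (exp (- ?z / 2) * exp (- a / 4 * ?z))))"
    using super_delta_pos by simp
  also have "\<dots> = ?d * (?d * G\<^sup>2) * (exp (- ?z / 2) * exp (- a / 4 * ?z))"
    by simp
  finally show sq: "(super k i)\<^sup>2 \<le> ?d / 40 * (exp (- ?z / 2) * exp (- a / 4 * ?z))"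
    unfolding G by simp
  have "?d \<le> 1"
  proof -
    have "?d * 1 \<le> ?d * G\<^sup>2"
      using super_delta_pos G by (intro mult_left_mono) (auto intro!: one_le_power)
    then show ?thesis using G by simp
  qed
  moreover have "exp (- ?z / 2) * exp (- a / 4 * ?z) \<le> 1 * 1"
    using z exp_quarter(1)[of ?z] by (intro mult_mono) auto
  ultimately have "?d / 40 * (exp (- ?z / 2) * exp (- a / 4 * ?z)) \<le> 1 * 1"
    using super_delta_pos by (intro mult_mono) auto
  with sq have "(super k i)\<^sup>2 \<le> 1\<^sup>2" by simp
  then show "super k i \<le> 1" by (rule power2_le_imp_le) simp
qed

lemma link_nonneg: "0 \<le> link p i j"
  using beta_bounds(3) by (simp add: link_def edge_prob_of_bounds)

text \<open>Since \<open>ln (1 + v) \<ge> v - v\<^sup>2\<close>, the logarithm costs a square, which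
  half of the first residual term pays. The case \<open>i = k\<close> is included: the root is
  explored but never found, so the sum over neighbours starts at \<open>Suc k\<close>.\<close>

lemma super_ineq:
  assumes k: "0 < k" "k \<le> i" "i \<le> n" and U: "U \<subseteq> {Suc k..n}"
  shows "exp (super_weight k i + (\<Sum>j\<in>U. link p i j * ((1 + super k j) - 1))) \<le> 1 + super k i"
proof -
  let ?z = "lscale k i" and ?l = "lscale k n" and ?d = "super_delta a"
  note z = lscale_in_range[OF k]
  have k': "k \<le> n" using k by simp
  have "(\<Sum>j\<in>U. link p i j * ((1 + super k j) - 1)) \<le> (\<Sum>j=Suc k..n. link p i j * super k j)"
  proof -
    have "(\<Sum>j\<in>U. link p i j * super k j) \<le> (\<Sum>j=Suc k..n. link p i j * super k j)"
    proof (rule sum_mono2[OF _ U])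
      fix j assume "j \<in> {Suc k..n} - U"
      then show "0 \<le> link p i j * super k j"
        using super_bounds(1)[of k j] k link_nonneg by (intro mult_nonneg_nonneg) auto
    qed simp
    then show ?thesis by simp
  qed
  also have "\<dots> = ?d * (\<Sum>j=Suc k..n. link p i j * (exp (- lscale k j / 2) * F (lscale k j)))"
    by (simp add: super_def sum_distrib_left algebra_simps)
  also have "\<dots> \<le> ?d * (\<beta> * exp (- ?z / 2) * conv a ?l FA FB ?z)"
  proof (intro mult_left_mono sum_link_upper)
    show "0 \<le> \<beta>" "\<beta> \<le> 1" using beta_bounds by auto
    show "0 \<le> F z" if "0 \<le> z" "z \<le> ?l" for z
      using F_ge_1[of z] that lscale_le_L[OF k(1) k'] by simp
    show "exp (- y / 2) * F y \<le> exp (- x / 2) * F x" if "0 \<le> x" "x \<le> y" "y \<le> ?l" for x y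
      using F_antitone[OF that(1,2)] that lscale_le_L[OF k(1) k'] by simp
    show "0 \<le> super_delta a" using super_delta_pos by simp
  qed (fact k \<gamma> | rule FA_deriv FB_deriv)+
  also have "\<dots> = ?d * exp (- ?z / 2) * (\<beta> * conv a ?l FA FB ?z)"
    by simp
  also have "\<dots> \<le> ?d * exp (- ?z / 2) * (F ?z - 1/20 * exp (- a / 4 * ?z) - (S ?l + 1) / 16 * exp (- a * (?l - ?z)))"
    using F_residual[OF z(1,2) lscale_le_L[OF k(1) k']] super_delta_pos by (intro mult_left_mono) auto
  finally have "super_weight k i + (\<Sum>j\<in>U. link p i j * ((1 + super k j) - 1)) \<le>
      super k i - ?d / 40 * (exp (- ?z / 2) * exp (- a / 4 * ?z))"
    unfolding super_weight_def super_def by (simp add: algebra_simps)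
  also have "\<dots> \<le> super k i - (super k i)\<^sup>2"
    using super_bounds(3)[OF k] by simp
  also have "\<dots> \<le> ln (1 + super k i)"
    using ln_one_plus_pos_lower_bound[OF super_bounds(1,2)[OF k]] .
  finally show ?thesis
    using super_bounds(1)[OF k] by (simp add: ln_ge_iff)
qed

text \<open>The upper tail uses a single root, the loss estimate for the lower bound uses several;
  each contributes a factor \<open>1 + super k j \<le> 2\<close>.\<close>

lemma expectation_super_weight:
  assumes k: "0 < k" and A: "A \<subseteq> {k..n}" "U \<subseteq> {Suc k..n}" "A \<inter> U = {}"
  shows "measure_pmf.expectation (edges \<gamma> \<beta> n) (\<lambda>\<omega>. exp (\<Sum>j\<in>cluster A U \<omega>. super_weight k j)) \<le> 2 ^ card A"
proof -
  have "measure_pmf.expectation (edges \<gamma> \<beta> n) (\<lambda>\<omega>. exp (\<Sum>j\<in>cluster A U \<omega>. super_weight k j)) \<le> (\<Prod>j\<in>A. 1 + super k j)"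
  proof (rule cluster_exp_upper[where V = "{k..n}" and U\<^sub>0 = U])
    show "pairs (A \<union> U) \<subseteq> vertex_pairs n"
      using A k by (auto simp: pairs_def vertex_pairs_def)
    show "exp (super_weight k i + (\<Sum>j\<in>U. link p i j * (1 + super k j - 1))) \<le> 1 + super k i" if "i \<in> {k..n}" for i
      using super_ineq[of k i U] that k A by auto
    show "finite U" "finite A" using finite_subset[OF A(1)] finite_subset[OF A(2)] by simp_all
    show "A \<union> U \<subseteq> {k..n}" "U \<subseteq> {k..n}" using A by force+
    show "1 \<le> 1 + super k j" if "j \<in> {k..n}" for j
      using super_bounds(1)[of k j] that k by simp
    show "0 \<le> p e" "p e \<le> 1" for e
      using edge_prob_of_bounds beta_bounds(3) by auto
    show "A \<inter> U = {}" by fact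
  qed simp_all
  also have "\<dots> \<le> (\<Prod>j\<in>A. 2)"
  proof (intro prod_mono conjI)
    fix j assume "j \<in> A"
    then have "k \<le> j" "j \<le> n" using A by auto
    then show "0 \<le> 1 + super k j" "1 + super k j \<le> 2"
      using super_bounds(1,2)[of k j] k by simp_all
  qed
  finally show ?thesis by (simp only: prod_constant)
qed

text \<open>The first bound is uniform in \<open>i\<close>, because \<open>a \<le> 1/2\<close> makes
  \<open>exp (- z / 2 - a * (len - z))\<close> smallest at \<open>z = len\<close>; it counts
  vertices. The second one controls the loss of the exploration.\<close>

lemma super_weight_ge:
  assumes "0 < k" "k \<le> i" "i \<le> n"
  shows "super_delta a * (S (lscale k n) + 1) / 16 * exp (- lscale k n / 2) \<le> super_weight k i"
    and "super_delta a / 40 * (exp (- lscale k i / 2) * exp (- a / 4 * lscale k i)) \<le> super_weight k i"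
proof -
  let ?z = "lscale k i" and ?l = "lscale k n" and ?d = "super_delta a"
  note z = lscale_in_range[OF assms]
  have S: "0 \<le> S ?l" using S_nonneg[of ?l] z lscale_le_L[of k] assms by auto
  have "- ?l / 2 \<le> - ?z / 2 + - a * (?l - ?z)"
  proof -
    have "a * (?l - ?z) \<le> 1/2 * (?l - ?z)" using a z by (intro mult_right_mono) auto
    then show ?thesis by (simp add: algebra_simps)
  qed
  then have "exp (- ?l / 2) \<le> exp (- ?z / 2) * exp (- a * (?l - ?z))"
    by (simp add: exp_add[symmetric])
  then have "?d * (S ?l + 1) / 16 * exp (- ?l / 2) \<le> ?d * (S ?l + 1) / 16 * (exp (- ?z / 2) * exp (- a * (?l - ?z)))"
    using S super_delta_pos by (intro mult_left_mono) auto
  moreover have "0 \<le> ?d / 40 * (exp (- ?z / 2) * exp (- a / 4 * ?z))"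
    using super_delta_pos by simp
  moreover have "0 \<le> ?d * (S ?l + 1) / 16 * (exp (- ?z / 2) * exp (- a * (?l - ?z)))"
    using super_delta_pos S by simp
  moreover have "super_weight k i = ?d / 40 * (exp (- ?z / 2) * exp (- a / 4 * ?z)) +
      ?d * (S ?l + 1) / 16 * (exp (- ?z / 2) * exp (- a * (?l - ?z)))"
    by (simp add: super_weight_def algebra_simps)
  ultimately show "?d * (S ?l + 1) / 16 * exp (- ?l / 2) \<le> super_weight k i"
    "?d / 40 * (exp (- ?z / 2) * exp (- a / 4 * ?z)) \<le> super_weight k i"
    by linarith+
qed

text \<open>The addition formula at \<open>ln n = lscale k n + ln k\<close> costs only the power
  1/16 of \<open>k\<close>, much less than the \<open>sqrt k\<close> contained in
  \<open>exp (- lscale k n / 2)\<close>.\<close>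

lemma S_lscale_ge:
  assumes "0 < k" "k \<le> n"
  shows "S (ln (real n)) \<le> 33 * (S (lscale k n) + 1) * exp (ln (real k) / 16)"
proof -
  define t where "t = ln (real k)"
  have t: "0 \<le> t" "t \<le> ln (real n)" using assms by (auto simp: t_def)
  have l: "0 \<le> lscale k n" "lscale k n \<le> ln (real n)"
    using lscale_in_range[of k n] assms by auto
  have sum: "ln (real n) = lscale k n + t"
    using assms by (simp add: t_def lscale_def ln_div)
  have S: "0 \<le> S (lscale k n)" "0 \<le> S t" "S t \<le> 32 * exp (t / 16)" "C t \<le> exp (t / 16)"
    using S_nonneg S_le abs_C_le[of t] l t by auto
  have "C (lscale k n) \<le> 1 + S (lscale k n) * 1"
  proof -
    have "a / 8 * S (lscale k n) \<le> 1 * S (lscale k n)"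
      using a S by (intro mult_right_mono) auto
    then show ?thesis using C_le[OF l] by simp
  qed
  then have "S (lscale k n) * C t + C (lscale k n) * S t \<le>
      (S (lscale k n) + 1) * exp (t / 16) + (S (lscale k n) + 1) * (32 * exp (t / 16))"
  proof (intro add_mono)
    have "S (lscale k n) * C t \<le> S (lscale k n) * exp (t / 16)"
      using S by (intro mult_left_mono) auto
    also have "\<dots> \<le> (S (lscale k n) + 1) * exp (t / 16)"
      by (intro mult_right_mono) auto
    finally show "S (lscale k n) * C t \<le> (S (lscale k n) + 1) * exp (t / 16)" .
  qed (use S in \<open>auto intro!: mult_mono\<close>)
  then show ?thesis
    unfolding sum S_add t_def by (simp add: algebra_simps)
qed

text \<open>Markov's inequality for the exponential moment. The constants are
  \<open>528 = 16 * 33\<close> and \<open>7/16 = 1/2 - 1/16\<close>, from the weight and from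
  \<open>S_lscale_ge\<close>.\<close>

lemma prob_cluster_ge:
  assumes k: "0 < k" "k \<le> n" and x: "0 \<le> x" and n2: "0 < S (ln (real n))"
  shows "measure (measure_pmf (edges \<gamma> \<beta> n)) {\<omega>. x \<le> real (card (cluster {k} {Suc k..n} \<omega>))} \<le>
    2 * exp (- (super_delta a / 528 * real k powr (7/16) * (S (ln (real n)) / sqrt (real n)) * x))"
proof -
  define s where "s = super_delta a * (S (lscale k n) + 1) / 16 * exp (- lscale k n / 2)"
  let ?C = "\<lambda>\<omega>. cluster {k} {Suc k..n} \<omega>"
  have l: "0 \<le> lscale k n" "lscale k n \<le> ln (real n)"
    using lscale_in_range[of k n] k by auto
  have s0: "0 \<le> s"
    using super_delta_pos S_nonneg[OF l] by (simp add: s_def)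
  have s_ge: "super_delta a / 528 * real k powr (7/16) * (S (ln (real n)) / sqrt (real n)) \<le> s"
  proof -
    have e1: "exp (- lscale k n / 2) = sqrt (real k) / sqrt (real n)"
    proof -
      have "lscale k n / 2 = ln (sqrt (real n)) - ln (sqrt (real k))"
        using k by (simp add: lscale_def ln_div ln_sqrt diff_divide_distrib)
      then have "- lscale k n / 2 = ln (sqrt (real k)) - ln (sqrt (real n))"
        by linarith
      then have "exp (- lscale k n / 2) = exp (ln (sqrt (real k))) / exp (ln (sqrt (real n)))"
        by (simp only: exp_diff)
      then show ?thesis using k by simp
    qed
    have e2: "real k powr (7/16) * exp (ln (real k) / 16) = sqrt (real k)"
    proof -
      have "real k powr (7/16) * exp (ln (real k) / 16) = exp (7/16 * ln (real k) + ln (real k) / 16)"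
        using k by (simp only: powr_def exp_add) simp
      also have "7/16 * ln (real k) + ln (real k) / 16 = ln (sqrt (real k))"
        using k by (simp add: ln_sqrt)
      finally show ?thesis using k by simp
    qed
    have regroup: "d / 528 * r * (33 * s * e / q) = d / 16 * s * (r * e) / q" for d r s e q :: real
      by simp
    have "super_delta a / 528 * real k powr (7/16) * (S (ln (real n)) / sqrt (real n)) \<le>
        super_delta a / 528 * real k powr (7/16) * (33 * (S (lscale k n) + 1) * exp (ln (real k) / 16) / sqrt (real n))"
      using S_lscale_ge[OF k] super_delta_pos k by (intro mult_left_mono divide_right_mono) auto
    also have "\<dots> = super_delta a / 16 * (S (lscale k n) + 1) * (real k powr (7/16) * exp (ln (real k) / 16)) / sqrt (real n)"
      by (rule regroup)
    also have "\<dots> = s"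
      unfolding e2 s_def e1 by simp
    finally show ?thesis .
  qed
  have exp_le: "exp (s * real (card (?C \<omega>))) \<le> exp (\<Sum>j\<in>?C \<omega>. super_weight k j)" for \<omega>
  proof -
    have "s * real (card (?C \<omega>)) = (\<Sum>j\<in>?C \<omega>. s)" by simp
    also have "\<dots> \<le> (\<Sum>j\<in>?C \<omega>. super_weight k j)"
      using cluster_subset[of "{k}" "{Suc k..n}" \<omega>] super_weight_ge(1)[of k] k
      by (intro sum_mono) (auto simp: s_def)
    finally show ?thesis by simp
  qed
  have "measure (measure_pmf (edges \<gamma> \<beta> n)) {\<omega>. x \<le> real (card (?C \<omega>))} \<le>
      measure (measure_pmf (edges \<gamma> \<beta> n)) {\<omega>. exp (s * x) \<le> exp (\<Sum>j\<in>?C \<omega>. super_weight k j)}"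
    using exp_le s0 by (intro measure_pmf.finite_measure_mono)
      (auto intro!: order.trans[OF _ exp_le] mult_left_mono simp del: exp_le_cancel_iff simp: exp_le_cancel_iff[of "s * x" "s * _"])
  also have "\<dots> \<le> measure_pmf.expectation (edges \<gamma> \<beta> n) (\<lambda>\<omega>. exp (\<Sum>j\<in>?C \<omega>. super_weight k j)) / exp (s * x)"
    by (intro Markov_edge_pmf) auto
  also have "\<dots> \<le> 2 ^ card {k} / exp (s * x)"
    using k by (intro divide_right_mono expectation_super_weight) auto
  also have "\<dots> = 2 * exp (- (s * x))"
    by (simp add: exp_minus field_simps)
  also have "\<dots> \<le> 2 * exp (- (super_delta a / 528 * real k powr (7/16) * (S (ln (real n)) / sqrt (real n)) * x))"
    using mult_right_mono[OF s_ge x] by (simp only: mult_le_cancel_left_pos zero_less_numeral exp_le_cancel_iff neg_le_iff_le)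
  finally show ?thesis .
qed

text \<open>The stretched exponential bound for the cluster of \<open>k\<close> is summable in \<open>k\<close>.\<close>

lemma max_component_upper:
  assumes x: "0 < x" and S: "0 < S (ln (real n))"
  shows "measure (measure_pmf (edges \<gamma> \<beta> n)) {\<omega>. x \<le> real (max_component n \<omega>)} \<le>
    12500 / (super_delta a / 528 * (S (ln (real n)) / sqrt (real n)) * x) ^ 5"
proof -
  let ?P = "measure_pmf.prob (edges \<gamma> \<beta> n)"
  let ?E = "\<lambda>k. {\<omega>. x \<le> real (card (cluster {k} {Suc k..n} \<omega>))}"
  define t where "t = super_delta a / 528 * (S (ln (real n)) / sqrt (real n)) * x"
  have t: "0 < t"
    using super_delta_pos S x n by (simp add: t_def)
  have "{\<omega>. x \<le> real (max_component n \<omega>)} \<subseteq> (\<Union>k\<in>{1..n}. ?E k)"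
  proof
    fix \<omega> assume \<omega>: "\<omega> \<in> {\<omega>. x \<le> real (max_component n \<omega>)}"
    obtain k where "k \<in> {1..n}" "max_component n \<omega> \<le> card (cluster {k} {Suc k..n} \<omega>)"
      using max_component_le_cluster[OF n] by blast
    then show "\<omega> \<in> (\<Union>k\<in>{1..n}. ?E k)" using \<omega> by force
  qed
  then have "?P {\<omega>. x \<le> real (max_component n \<omega>)} \<le> ?P (\<Union>k\<in>{1..n}. ?E k)"
    by (intro measure_pmf.finite_measure_mono) auto
  also have "\<dots> \<le> (\<Sum>k\<in>{1..n}. ?P (?E k))"
    by (intro measure_pmf.finite_measure_subadditive_finite) auto
  also have "\<dots> \<le> (\<Sum>k\<in>{1..n}. 6250 / t ^ 5 * (1 / (real k)\<^sup>2))"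
  proof (intro sum_mono)
    fix k assume k: "k \<in> {1..n}"
    define y where "y = t * real k powr (7/16)"
    have y: "0 < y" using t k by (simp add: y_def)
    have "?P (?E k) \<le> 2 * exp (- y)"
      using prob_cluster_ge[of k x] k x S by (simp add: y_def t_def algebra_simps)
    \<comment> \<open>A fifth power suffices: \<open>5 * 7/16 = 35/16\<close> exceeds 2, so the
      bounds are dominated by multiples of the inverse squares of \<open>k\<close>, whose sum is at
      most 2.\<close>
    also have "(y / 5) ^ 5 \<le> exp y"
    proof -
      have "(y / 5) ^ 5 \<le> (1 + y / real 5) ^ 5" using y by (intro power_mono) auto
      also have "\<dots> \<le> exp y" using y by (intro exp_ge_one_plus_x_over_n_power_n) auto
      finally show ?thesis .
    qed
    then have "exp (- y) \<le> 3125 / y ^ 5"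
      using y by (simp add: exp_minus field_simps power_divide)
    also have "\<dots> \<le> 3125 / (t ^ 5 * (real k)\<^sup>2)"
    proof -
      have "(real k)\<^sup>2 = real k powr 2" using k by simp
      also have "\<dots> \<le> real k powr (35/16)" using k by (intro powr_mono) auto
      also have "\<dots> = (real k powr (7/16)) ^ 5" using k by (simp add: powr_power)
      finally have "t ^ 5 * (real k)\<^sup>2 \<le> y ^ 5"
        using t by (simp add: y_def power_mult_distrib)
      then show ?thesis using t y k by (intro divide_left_mono mult_pos_pos zero_less_power) auto
    qed
    finally show "?P (?E k) \<le> 6250 / t ^ 5 * (1 / (real k)\<^sup>2)" by simp
  qed
  also have "\<dots> = 6250 / t ^ 5 * (\<Sum>k=1..n. 1 / (real k)\<^sup>2)"
    by (simp add: sum_distrib_left)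
  also have "\<dots> \<le> 6250 / t ^ 5 * 2"
  proof (intro mult_left_mono)
    have "(\<Sum>k=1..m. 1 / (real k)\<^sup>2) \<le> 2 - 1 / real m" if "1 \<le> m" for m
      using that
    proof (induction m rule: dec_induct)
      case (step m)
      have "1 / (real (Suc m))\<^sup>2 \<le> 1 / real m - 1 / real (Suc m)"
      proof -
        have "1 / (real (Suc m))\<^sup>2 \<le> 1 / (real m * real (Suc m))"
          using step(1) by (intro frac_le) (auto simp: power2_eq_square)
        also have "\<dots> = 1 / real m - 1 / real (Suc m)"
          using step(1) by (simp add: field_simps)
        finally show ?thesis .
      qed
      then show ?case using step by simp
    qed simp
    from this[OF n] show "(\<Sum>k=1..n. 1 / (real k)\<^sup>2) \<le> 2"
      using n by (smt (verit) of_nat_0_le_iff zero_le_divide_1_iff)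
  qed (use t in simp)
  finally show ?thesis by (simp add: t_def)
qed

end

text \<open>Here \<open>33 + 1 / a\<close> dominates \<open>H\<close>, and
  \<open>264 = 8 * 33\<close> stems from the crest, both relative to
  \<open>exp (z / 16)\<close>.\<close>

definition sub_bound :: "real \<Rightarrow> real" where "sub_bound a = 33 + 1 / a + 264 / a\<^sup>2"
text \<open>Summing squares of the subsolution over neighbours costs a factor 3, so 1/960 turns into
  1/320; the residual left after discretisation is 3/320.\<close>

definition sub_delta :: "real \<Rightarrow> real" where "sub_delta a = 1 / (960 * (sub_bound a)\<^sup>2)"

context wave
begin

subsection \<open>A subsolution\<close>

text \<open>The last summand of \<open>G\<close> cancels the boundary term of the convolution at \<open>len\<close>.\<close>

definition H :: "real \<Rightarrow> real" where "H z = hump (1 / a - 1/2) z + 1/4 * exp (- a / 4 * z)"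
definition H' :: "real \<Rightarrow> real" where "H' z = hump' (1 / a - 1/2) z - a / 16 * exp (- a / 4 * z)"
definition crest :: "real \<Rightarrow> real" where "crest len = 8 / a\<^sup>2 * (S len + 1)"
definition G :: "real \<Rightarrow> real \<Rightarrow> real" where "G len z = H z + crest len * exp (z - len)"
definition HA :: "real \<Rightarrow> real" where "HA z = humpA (1 / a - 1/2) z + 1/4 * expA z"
definition HB :: "real \<Rightarrow> real" where "HB z = humpB (1 / a - 1/2) z + 1/4 * expB z"
definition GA :: "real \<Rightarrow> real \<Rightarrow> real" where "GA len z = HA z + crest len * topA len z"
definition GB :: "real \<Rightarrow> real \<Rightarrow> real" where "GB len z = HB z + crest len * topB len z"

lemma H_deriv: "(H has_real_derivative H' z) (at z)"
  unfolding H_def H'_def by (auto intro!: derivative_eq_intros hump_deriv)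

lemma HA_deriv: "(HA has_real_derivative exp (a * z) * H z) (at z)"
proof -
  have "(HA has_real_derivative exp (a * z) * hump (1 / a - 1/2) z + 1/4 * (exp (a * z) * exp (- a / 4 * z))) (at z)"
    unfolding HA_def by (intro DERIV_add DERIV_cmult humpA_deriv expA_deriv)
  then show ?thesis by (simp add: H_def algebra_simps)
qed

lemma HB_deriv: "(HB has_real_derivative exp (- a * z) * H z) (at z)"
proof -
  have "(HB has_real_derivative exp (- a * z) * hump (1 / a - 1/2) z + 1/4 * (exp (- a * z) * exp (- a / 4 * z))) (at z)"
    unfolding HB_def by (intro DERIV_add DERIV_cmult humpB_deriv expB_deriv)
  then show ?thesis by (simp add: H_def algebra_simps)
qed

lemma GB_deriv: "(GB len has_real_derivative exp (- a * z) * G len z) (at z)"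
proof -
  have "(GB len has_real_derivative exp (- a * z) * H z + crest len * (exp (- a * z) * exp (z - len))) (at z)"
    unfolding GB_def by (intro DERIV_add DERIV_cmult HB_deriv topB_deriv)
  then show ?thesis by (simp add: G_def algebra_simps)
qed

lemma crest_pos: "0 \<le> len \<Longrightarrow> len \<le> L \<Longrightarrow> 0 < crest len"
  using S_nonneg[of len] a unfolding crest_def by (intro mult_pos_pos) auto

lemma H_ge:
  assumes "0 \<le> z" "z \<le> L"
  shows "1/2 \<le> H z"
  using assms
proof (cases rule: C_nonneg_or_large)
  case 1
  have "3/2 * (1/2) \<le> (1 / a - 1/2) * C z"
    using 1 inverse_a_ge by (intro mult_mono) auto
  then have "3/4 \<le> hump (1 / a - 1/2) z"
    using 1(3) unfolding hump_def by simp
  then show ?thesis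
    using exp_quarter(2)[of z] unfolding H_def by linarith
next
  case 2
  have "(1 / a - 1/2) * (- 1) \<le> (1 / a - 1/2) * C z"
    using 2 inverse_a_ge by (intro mult_left_mono) auto
  then have "S z - (1 / a - 1/2) \<le> hump (1 / a - 1/2) z"
    unfolding hump_def by simp
  then show ?thesis
    using 2 inverse_a_ge exp_quarter(2)[of z] unfolding H_def by linarith
qed

text \<open>The crest grows with \<open>len\<close> like \<open>exp (len / 16)\<close> at most,
  slower than \<open>exp (z - len)\<close> decays. Its contribution is thus bounded independently of
  \<open>len\<close>.\<close>

lemma S_grow:
  assumes "0 \<le> z" "z \<le> len" "len \<le> L"
  shows "crest len * exp (z - len) \<le> 264 / a\<^sup>2 * exp (z / 16)"
proof -
  have "S len + 1 \<le> 33 * exp (len / 16)"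
    using S_le[of len] assms by (smt (verit) one_le_exp_iff divide_nonneg_nonneg)
  then have "crest len * exp (z - len) \<le> 8 / a\<^sup>2 * (33 * exp (len / 16)) * exp (z - len)"
    unfolding crest_def using a by (intro mult_right_mono mult_left_mono) auto
  also have "\<dots> = 264 / a\<^sup>2 * exp (len / 16 + (z - len))"
    unfolding exp_add by simp
  also have "\<dots> \<le> 264 / a\<^sup>2 * exp (z / 16)"
    using assms by (intro mult_left_mono) auto
  finally show ?thesis .
qed

lemma G_bounds:
  assumes "0 \<le> z" "z \<le> len" "len \<le> L"
  shows "1/2 \<le> G len z" "G len z \<le> sub_bound a * exp (z / 16)"
proof -
  have z: "0 \<le> z" "z \<le> L" using assms by auto
  show "1/2 \<le> G len z"
    using H_ge[OF z] crest_pos[of len] assms by (simp add: G_def add_increasing2)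
  have "(1 / a - 1/2) * C z \<le> (1 / a - 1/2) * exp (z / 16)"
    using abs_C_le[OF z] inverse_a_ge by (intro mult_left_mono) auto
  then have "hump (1 / a - 1/2) z \<le> (32 + 1 / a - 1/2) * exp (z / 16)"
    unfolding hump_def using S_le[OF z] by (simp add: algebra_simps)
  moreover have "1/4 * exp (- a / 4 * z) \<le> 1/4 * exp (z / 16)"
  proof -
    have "exp (- a / 4 * z) \<le> 1" "1 \<le> exp (z / 16)" using exp_quarter(1)[OF z(1)] z by auto
    then show ?thesis by simp
  qed
  moreover have "0 < exp (z / 16)" by simp
  ultimately show "G len z \<le> sub_bound a * exp (z / 16)"
    using S_grow[OF assms] unfolding G_def H_def sub_bound_def ring_distribs by linarith
qed

lemma mu_hump_coeff_H: "\<bar>(1 / a - 1/2) * \<mu>\<bar> \<le> 3 * a / 64" "(1 / a - 1/2) * \<mu> \<le> 1/32"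
proof -
  show *: "\<bar>(1 / a - 1/2) * \<mu>\<bar> \<le> 3 * a / 64"
    using inverse_a_ge by (intro mu_hump_coeff) auto
  have "3 * a / 64 \<le> 1/32" using a by simp
  then show "(1 / a - 1/2) * \<mu> \<le> 1/32" using * by linarith
qed

text \<open>For \<open>\<gamma> = 0\<close> the function \<open>\<lambda>z. exp (- z / 2) * H z\<close> is not antitone near \<open>0\<close>; adding a
  multiple of \<open>\<lambda>z. exp (- a / 4 * z)\<close> repairs this.\<close>

lemma H_antitone:
  assumes "0 \<le> x" "x \<le> y" "y \<le> L"
  shows "exp (- y / 2) * (H y + 1/4 * exp (- a / 4 * y)) \<le> exp (- x / 2) * (H x + 1/4 * exp (- a / 4 * x))"
proof -
  define c where "c = 1 / a - 1/2"
  have c: "3/2 \<le> c" "c * \<mu> \<le> 1/32"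
    using inverse_a_ge mu_hump_coeff_H by (auto simp: c_def)
  have slope: "H' z - a / 16 * exp (- a / 4 * z) \<le> 1/2 * (H z + 1/4 * exp (- a / 4 * z))"
    if "x \<le> z" "z \<le> y" for z
  proof -
    have z: "0 \<le> z" "z \<le> L" using that assms by auto
    define E where "E = exp (- a / 4 * z)"
    \<comment> \<open>At \<open>z = 0\<close> and \<open>a = 1/2\<close> the terms
      \<open>(c / 2 - 1) * C z\<close> and \<open>E / 4\<close> are -1/4 and 1/4 and cancel exactly,
      so \<open>E\<close> is needed to first order; the growth \<open>z / 2 \<le> S z\<close> then
      beats its decay.\<close>
    have E: "0 < E" "E \<le> 1" "1 - z / 8 \<le> E"
    proof -
      have "a / 4 * z \<le> 1/8 * z" using a z by (intro mult_right_mono) auto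
      then show "1 - z / 8 \<le> E"
        using exp_ge_add_one_self[of "- a / 4 * z"] by (simp add: E_def)
    qed (use exp_quarter[of z] z in \<open>auto simp: E_def\<close>)
    have aE: "0 \<le> a * E" using a E by simp
    have eq: "1/2 * (H z + 1/4 * E) - (H' z - a / 16 * E) =
        (1/2 - c * \<mu>) * S z + (c / 2 - 1) * C z + E / 4 + a * E / 8"
      unfolding H_def H'_def hump_def hump'_def c_def[symmetric] E_def[symmetric] by (simp add: algebra_simps)
    have S: "0 \<le> S z" using S_nonneg[OF z] .
    have muS: "15/32 * S z \<le> (1/2 - c * \<mu>) * S z"
      using c S by (intro mult_right_mono) auto
    have CS: "C z \<le> 1 + S z / 16"
    proof -
      have "a / 8 * S z \<le> 1/16 * S z" using a S by (intro mult_right_mono) auto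
      then show ?thesis using C_le[OF z] by simp
    qed
    have "0 \<le> 15/32 * S z + (c / 2 - 1) * C z + E / 4"
      using z
    proof (cases rule: C_nonneg_or_large)
      case 1
      have "- 1/4 * C z \<le> (c / 2 - 1) * C z"
        using 1 c by (intro mult_right_mono) auto
      then have "- 1/4 - S z / 64 \<le> (c / 2 - 1) * C z" using CS by simp
      then show ?thesis using 1(2,3) E(3) by (simp add: field_simps)
    next
      case 2
      have "- (1/4 + S z / 64) - 1 / (2 * a) \<le> (c / 2 - 1) * C z"
      proof (cases "0 \<le> C z")
        case True
        then have "- 1/4 * C z \<le> (c / 2 - 1) * C z"
          using c by (intro mult_right_mono) auto
        then have "- 1/4 - S z / 64 \<le> (c / 2 - 1) * C z" using CS by simp
        moreover have "0 < 1 / (2 * a)" using a by simp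
        ultimately show ?thesis by linarith
      next
        case False
        have "(c / 2 - 1) * C z \<ge> - (1 / (2 * a))"
        proof (cases "0 \<le> c / 2 - 1")
          case True
          then have "(c / 2 - 1) * (- 1) \<le> (c / 2 - 1) * C z" using 2 by (intro mult_left_mono) auto
          moreover have "c / 2 - 1 \<le> 1 / (2 * a)" by (simp add: c_def field_simps)
          ultimately show ?thesis by simp
        next
          case neg: False
          then have "0 \<le> (c / 2 - 1) * C z" using False by (intro mult_nonpos_nonpos) auto
          then show ?thesis using a by (smt (verit) zero_le_divide_1_iff mult_nonneg_nonneg)
        qed
        then show ?thesis using S by simp
      qed
      moreover define r where "r = 1 / a"
      moreover have "1 / (2 * a) = r / 2" by (simp add: r_def)
      ultimately show ?thesis using 2(2) S E(1) inverse_a_ge unfolding r_def[symmetric] by (simp add: field_simps)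
    qed
    then show ?thesis
      using eq muS aE unfolding E_def[symmetric] by linarith
  qed
  have "((\<lambda>z. H z + 1/4 * exp (- a / 4 * z)) has_real_derivative (H' z - a / 16 * exp (- a / 4 * z))) (at z)" for z
    by (auto intro!: derivative_eq_intros H_deriv)
  then show ?thesis
    using exp_neg_mult_antimono[of x y "\<lambda>z. H z + 1/4 * exp (- a / 4 * z)" "\<lambda>z. H' z - a / 16 * exp (- a / 4 * z)" "1/2"]
      slope assms by simp
qed

text \<open>This serves the sum to the right of \<open>i\<close>. There the exponent contains
  \<open>- z\<close>, which makes the crest constant and leaves only \<open>H' \<le> H\<close> to be
  checked. To the left the crest is increasing and has to be treated on its own.\<close>

lemma G_antitone:
  assumes "0 \<le> x" "x \<le> y" "y \<le> len" "len \<le> L"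
  shows "exp ((- a - 1) * y) * G len y \<le> exp ((- a - 1) * x) * G len x"
proof -
  define c where "c = 1 / a - 1/2"
  have c: "3/2 \<le> c" "c * \<mu> \<le> 1/32"
    using inverse_a_ge mu_hump_coeff_H by (auto simp: c_def)
  have slope: "H' z \<le> 1 * H z" if "x \<le> z" "z \<le> y" for z
  proof -
    have z: "0 \<le> z" "z \<le> L" using that assms by auto
    define E where "E = exp (- a / 4 * z)"
    have aE: "0 \<le> E" "0 \<le> a * E" using a by (auto simp: E_def)
    have eq: "H z - H' z = (1 - c * \<mu>) * S z + (c - 1) * C z + E / 4 + a * E / 16"
      unfolding H_def H'_def hump_def hump'_def c_def[symmetric] E_def[symmetric] by (simp add: algebra_simps)
    have "0 \<le> (1 - c * \<mu>) * S z + (c - 1) * C z"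
      using z
    proof (cases rule: C_nonneg_or_large)
      case 1
      then show ?thesis using c by (intro add_nonneg_nonneg mult_nonneg_nonneg) auto
    next
      case 2
      have "15/16 * S z \<le> (1 - c * \<mu>) * S z"
        using c S_nonneg[OF z] by (intro mult_right_mono) auto
      moreover have "(c - 1) * (- 1) \<le> (c - 1) * C z"
        using 2 c by (intro mult_left_mono) auto
      ultimately have "15/16 * S z - (c - 1) \<le> (1 - c * \<mu>) * S z + (c - 1) * C z" by simp
      moreover have "0 \<le> 15/16 * S z - (c - 1)"
        using 2 inverse_a_ge unfolding c_def by linarith
      ultimately show ?thesis by linarith
    qed
    then show ?thesis using eq aE by linarith
  qed
  have H: "exp (- y) * H y \<le> exp (- x) * H x"
    using exp_neg_mult_antimono[of x y H H' 1] slope assms H_deriv by simp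
  have split: "exp ((- a - 1) * z) * G len z = exp (- a * z) * (exp (- z) * H z + crest len * exp (- len))" for z
  proof -
    have "exp ((- a - 1) * z) = exp (- a * z) * exp (- z)" "exp (- z) * exp (z - len) = exp (- len)"
      by (simp_all add: exp_add[symmetric] algebra_simps)
    then have "exp ((- a - 1) * z) * G len z = exp (- a * z) * (exp (- z) * H z + crest len * (exp (- z) * exp (z - len)))"
      by (simp only: G_def) (simp add: algebra_simps)
    then show ?thesis using \<open>exp (- z) * exp (z - len) = exp (- len)\<close> by simp
  qed
  show ?thesis
    unfolding split
  proof (rule mult_mono)
    show "exp (- a * y) \<le> exp (- a * x)" using a assms by simp
    show "exp (- y) * H y + crest len * exp (- len) \<le> exp (- x) * H x + crest len * exp (- len)"
      using H by simp
    show "0 \<le> exp (- y) * H y + crest len * exp (- len)"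
      using H_ge[of y] crest_pos[of len] assms by (intro add_nonneg_nonneg mult_nonneg_nonneg) auto
  qed simp
qed

text \<open>The crest is not reproduced by the convolution, and its own convolution has a negative
  part near the right end. Each deficit costs at most one crest, and the weight of the vertices has
  to pay for both.\<close>

lemma G_residual:
  assumes "0 \<le> z" "z \<le> len" "len \<le> L"
  shows "G len z + 1/80 * exp (- a / 4 * z) - 2 * crest len * exp (z - len) \<le> \<beta> * conv a len (GA len) (GB len) z"
proof -
  define c where "c = 1 / a - 1/2"
  have c: "3/2 \<le> c" "a * c = 1 - a / 2" "\<bar>c * \<mu>\<bar> \<le> 3 * a / 64"
    using a inverse_a_ge mu_hump_coeff_H by (auto simp: c_def field_simps)
  have len: "0 \<le> len" "len \<le> L" using assms by auto
  obtain m where m: "\<bar>m\<bar> \<le> 1/64"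
    and conv_exp': "\<And>len z. \<beta> * conv a len expA expB z = 16/15 * (1 - m) * exp (- a / 4 * z)
      - 2/3 * (1 - m) * exp (- a * z) - 2/5 * (1 - m) * exp (- a / 4 * len) * exp (- a * (len - z))"
    by (rule beta_conv_exp) blast
  define Q where "Q = (a * hump c len + hump' c len) / (2 * a)"
  define t where "t = crest len"
  define E1 E2 E3 E4 E5 where "E1 = exp (- a / 4 * z)" and "E2 = exp (- a * z)"
    and "E3 = exp (- a * (len - z))" and "E4 = exp (z - len)" and "E5 = exp (- a * z - len)"
  have E: "0 < E1" "0 < E2" "0 < E3" "0 < E4" "0 < E5" "E5 \<le> E4"
  proof -
    have "0 \<le> a * z" using a assms by simp
    then have "- a * z - len \<le> z - len" using assms by simp
    then show "E5 \<le> E4" unfolding E4_def E5_def by (simp only: exp_le_cancel_iff)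
  qed (simp_all add: E1_def E2_def E3_def E4_def E5_def)
  have t: "0 < t" using crest_pos[OF len] by (simp add: t_def)
  have "conv a len (GA len) (GB len) z = conv a len (humpA c) (humpB c) z + 1/4 * conv a len expA expB z
      + t * conv a len (topA len) (topB len) z"
    by (simp add: conv_def GA_def GB_def HA_def HB_def c_def t_def algebra_simps)
  then have "\<beta> * conv a len (GA len) (GB len) z = \<beta> * conv a len (humpA c) (humpB c) z
      + 1/4 * (\<beta> * conv a len expA expB z) + t * (\<beta> * conv a len (topA len) (topB len) z)"
    by (simp add: algebra_simps)
  \<comment> \<open>The deficit 1/2 of \<open>c\<close> below \<open>1 / a\<close> makes the
    boundary term at 0 a gain of 1/4, more than the loss \<open>1/6 * (1 - m)\<close> caused by the
    exponential.\<close>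
  moreover have "(a * c - 1) / (2 * a) = - 1/4"
    using a c by simp
  then have "\<beta> * conv a len (humpA c) (humpB c) z = hump c z + E2 / 4 - E3 * Q"
    by (simp add: conv_hump Q_def E2_def E3_def)
  moreover have "\<beta> * conv a len expA expB z = 16/15 * (1 - m) * E1 - 2/3 * (1 - m) * E2
      - 2/5 * (1 - m) * exp (- a / 4 * len) * E3"
    by (simp only: conv_exp' E1_def E2_def E3_def)
  moreover have "\<beta> * conv a len (topA len) (topB len) z \<ge> \<beta> * E3 - E4"
  proof -
    have "conv a len (topA len) (topB len) z =
        E4 * (1 / (1 + a) - 1 / (1 - a)) - E5 / (1 + a) + E3 / (1 - a)"
      by (simp only: conv_top E3_def E4_def E5_def)
    also have "\<dots> = (E4 - E5) / (1 + a) - E4 / (1 - a) + E3 / (1 - a)"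
      by (simp add: algebra_simps diff_divide_distrib)
    also have "\<dots> \<ge> 0 - E4 * 2 + E3"
    proof -
      have "0 \<le> (E4 - E5) / (1 + a)" using E a by simp
      moreover have "E4 / (1 - a) \<le> E4 * 2"
      proof -
        have "E4 * 1 \<le> E4 * (2 * (1 - a))" using E a by (intro mult_left_mono) auto
        then show ?thesis using a by (simp add: field_simps)
      qed
      moreover have "E3 \<le> E3 / (1 - a)"
      proof -
        have "E3 * (1 - a) \<le> E3 * 1" using E a by (intro mult_left_mono) auto
        then show ?thesis using a by (simp add: field_simps)
      qed
      ultimately show ?thesis by linarith
    qed
    finally have "\<beta> * (E3 - 2 * E4) \<le> \<beta> * conv a len (topA len) (topB len) z"
      using beta_bounds by (intro mult_left_mono) auto
    moreover have "2 * \<beta> * E4 \<le> 1 * E4" using beta_bounds E by (intro mult_right_mono) auto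
    ultimately show ?thesis by (simp add: algebra_simps)
  qed
  then have "t * (\<beta> * E3 - E4) \<le> t * (\<beta> * conv a len (topA len) (topB len) z)"
    using t by (intro mult_left_mono) auto
  ultimately have "\<beta> * conv a len (GA len) (GB len) z \<ge> (hump c z + E2 / 4 - E3 * Q) +
      1/4 * (16/15 * (1 - m) * E1 - 2/3 * (1 - m) * E2 - 2/5 * (1 - m) * exp (- a / 4 * len) * E3) +
      t * (\<beta> * E3 - E4)"
    by (simp only: add_le_cancel_left)
  moreover have "(hump c z + E2 / 4 - E3 * Q) +
      1/4 * (16/15 * (1 - m) * E1 - 2/3 * (1 - m) * E2 - 2/5 * (1 - m) * x * E3) +
      t * (\<beta> * E3 - E4) = (hump c z + E1 / 4 + t * E4) - 2 * t * E4 +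
      ((4/15 * (1 - m) - 1/4) * E1 + (1/4 - 1/6 * (1 - m)) * E2 + (t * \<beta> - Q - 1/10 * (1 - m) * x) * E3)" for x
    by (simp add: field_simps)
  moreover have "G len z = hump c z + E1 / 4 + t * E4"
    by (simp add: G_def H_def c_def t_def E1_def E4_def)
  ultimately have "\<beta> * conv a len (GA len) (GB len) z \<ge> G len z - 2 * t * E4 +
      ((4/15 * (1 - m) - 1/4) * E1 + (1/4 - 1/6 * (1 - m)) * E2 + (t * \<beta> - Q - 1/10 * (1 - m) * exp (- a / 4 * len)) * E3)"
    by (simp only:)
  \<comment> \<open>Again sharp at \<open>m = 1/64\<close>:
    \<open>4/15 * (63/64) - 1/4 = 1/80\<close>.\<close>
  moreover have "1/80 * E1 \<le> (4/15 * (1 - m) - 1/4) * E1"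
    using m E by (intro mult_right_mono) auto
  moreover have "0 \<le> (1/4 - 1/6 * (1 - m)) * E2"
    using m E by (intro mult_nonneg_nonneg) auto
  moreover have "0 \<le> (t * \<beta> - Q - 1/10 * (1 - m) * exp (- a / 4 * len)) * E3"
  proof (intro mult_nonneg_nonneg)
    have "1/10 * (1 - m) * exp (- a / 4 * len) \<le> 1 * 1"
      using m exp_quarter(1)[OF len(1)] by (intro mult_mono) auto
    moreover have "Q + 1 \<le> 2 / a * (S len + 1)"
    proof -
      have S: "0 \<le> S len" using S_nonneg[OF len] .
      have "C len \<le> 1 + 1 * S len"
      proof -
        have "a / 8 * S len \<le> 1 * S len" using a S by (intro mult_right_mono) auto
        then show ?thesis using C_le[OF len] by simp
      qed
      have "a * hump c len + hump' c len = (a + c * \<mu>) * S len + (a * c + 1) * C len"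
        by (simp add: hump_def hump'_def algebra_simps)
      also have "\<dots> \<le> 1 * S len + 2 * (1 + S len)"
      proof (intro add_mono mult_right_mono)
        show "a + c * \<mu> \<le> 1" using a c(3) by (auto simp: abs_le_iff)
        have "(a * c + 1) * C len \<le> (a * c + 1) * (1 + S len)"
          using \<open>C len \<le> 1 + 1 * S len\<close> a unfolding c(2) by (intro mult_left_mono) auto
        also have "\<dots> \<le> 2 * (1 + S len)"
          using a S unfolding c(2) by (intro mult_right_mono) auto
        finally show "(a * c + 1) * C len \<le> 2 * (1 + S len)" .
      qed fact
      finally have "Q \<le> (3 * S len + 2) / (2 * a)"
        unfolding Q_def using a by (intro divide_right_mono) auto
      moreover have "(3 * S len + 2) / (2 * a) + 1 \<le> 2 / a * (S len + 1)"
      proof -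
        have "a * a \<le> a" using a by (simp add: mult_le_cancel_left1)
        moreover have "0 \<le> a * S len" using a S by simp
        ultimately have "(3 * S len + 2 + 2 * a) * a \<le> 2 * (S len + 1) * (2 * a)"
          by (simp add: algebra_simps)
        then show ?thesis using a by (simp add: divide_simps)
      qed
      ultimately show ?thesis by linarith
    qed
    \<comment> \<open>The factor \<open>8 / a\<^sup>2\<close> of the crest is fixed here: with
      \<open>a / 4 \<le> \<beta>\<close> it yields the \<open>2 / a * (S len + 1)\<close> that
      dominates \<open>Q + 1\<close>.\<close>
    moreover have "2 / a * (S len + 1) \<le> t * \<beta>"
    proof -
      have "2 / a * (S len + 1) = t * (a / 4)"
        using a by (simp add: t_def crest_def power2_eq_square field_simps)
      also have "\<dots> \<le> t * \<beta>" using beta_bounds t by (intro mult_left_mono) auto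
      finally show ?thesis .
    qed
    ultimately show "0 \<le> t * \<beta> - Q - 1/10 * (1 - m) * exp (- a / 4 * len)" by linarith
  qed (use E in simp)
  ultimately show ?thesis
    unfolding E1_def[symmetric] E4_def[symmetric] t_def[symmetric] by linarith
qed

end

lemma one_minus_exp_ge: "v - v\<^sup>2 \<le> 1 - exp (- v)" if "0 \<le> v" for v :: real
proof -
  have "1 \<le> (1 - v + v\<^sup>2) * (1 + v)"
    using that by (simp add: algebra_simps power2_eq_square)
  also have "\<dots> \<le> (1 - v + v\<^sup>2) * exp v"
  proof (intro mult_left_mono exp_ge_add_one_self)
    have "0 \<le> (v - 1/2)\<^sup>2" by simp
    then show "0 \<le> 1 - v + v\<^sup>2" by (simp add: power2_eq_square algebra_simps)
  qed
  finally have "exp (- v) \<le> 1 - v + v\<^sup>2"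
    by (simp add: exp_minus field_simps)
  then show ?thesis by simp
qed

lemma sum_shift_ends:
  fixes f :: "nat \<Rightarrow> real"
  assumes "m \<le> n"
  shows "sum f {m..<n} + f n = f m + sum f {m<..n}"
proof -
  have "sum f {m..<n} + f n = sum f {m..n}"
    using assms by (simp add: sum.last_plus)
  also have "\<dots> = f m + sum f {m<..n}"
    using assms by (simp add: sum.head)
  finally show ?thesis .
qed

context wave_graph
begin

section \<open>Subsolution on the graph\<close>

definition sub :: "nat \<Rightarrow> nat \<Rightarrow> real" where
  "sub k i = sub_delta a * (exp (- lscale k i / 2) * G (lscale k n) (lscale k i))"

text \<open>Two of the three crests are the deficit in \<open>G_residual\<close>, the third pays for
  discretisation.\<close>

definition sub_weight :: "nat \<Rightarrow> nat \<Rightarrow> real" where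
  "sub_weight k i = 3 * sub_delta a * crest (lscale k n) * (exp (- lscale k i / 2) * exp (lscale k i - lscale k n))"

lemma sub_bound_ge: "33 \<le> sub_bound a"
proof -
  have "0 \<le> 264 / a\<^sup>2" by simp
  then show ?thesis using inverse_a_ge unfolding sub_bound_def by linarith
qed

lemma sub_delta: "0 < sub_delta a" "sub_delta a * (sub_bound a)\<^sup>2 = 1/960"
  using sub_bound_ge by (auto simp: sub_delta_def intro!: mult_pos_pos zero_less_power)

lemma exp_a_le: "0 \<le> z \<Longrightarrow> a / 4 \<le> c \<Longrightarrow> exp (- c * z) \<le> exp (- a / 4 * z)"
proof -
  assume "0 \<le> z" "a / 4 \<le> c"
  then have "a / 4 * z \<le> c * z" by (intro mult_right_mono)
  then have "- c * z \<le> - (a / 4 * z)" by simp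
  also have "\<dots> = - a / 4 * z" by (simp only: minus_divide_left mult_minus_left)
  finally show ?thesis by (simp only: exp_le_cancel_iff)
qed

lemma sub_bounds:
  assumes "0 < k" "k \<le> i" "i \<le> n"
  shows "0 \<le> sub k i"
    and "sub k i \<le> sub_delta a * sub_bound a * exp (- (7/16) * lscale k i)"
    and "(sub k i)\<^sup>2 \<le> sub_delta a / 960 * (exp (- lscale k i / 2) * exp (- a / 4 * lscale k i))"
proof -
  let ?z = "lscale k i" and ?l = "lscale k n" and ?d = "sub_delta a"
  define B where "B = sub_bound a"
  note z = lscale_in_range[OF assms]
  have "k \<le> n" using assms by simp
  then have G: "1/2 \<le> G ?l ?z" "G ?l ?z \<le> B * exp (?z / 16)"
    using G_bounds[OF z(1,2) lscale_le_L] assms by (auto simp: B_def)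
  show nonneg: "0 \<le> sub k i"
    using G sub_delta by (simp add: sub_def)
  have "sub k i \<le> ?d * (exp (- ?z / 2) * (B * exp (?z / 16)))"
    unfolding sub_def using G sub_delta by (intro mult_left_mono) auto
  also have "\<dots> = ?d * B * exp (- (7/16) * ?z)"
  proof -
    have "exp (- ?z / 2) * exp (?z / 16) = exp (- (7/16) * ?z)"
      unfolding exp_add[symmetric] by simp
    then show ?thesis by (metis mult.assoc mult.left_commute)
  qed
  finally show le: "sub k i \<le> ?d * sub_bound a * exp (- (7/16) * ?z)"
    unfolding B_def .
  have "(sub k i)\<^sup>2 \<le> (?d * B * exp (- (7/16) * ?z))\<^sup>2"
    using le nonneg unfolding B_def by (intro power_mono)
  also have "\<dots> = ?d * (?d * B\<^sup>2) * (exp (- ?z / 2) * exp (- (3/8) * ?z))"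
    by (simp add: power2_eq_square exp_add[symmetric])
  also have "\<dots> = ?d / 960 * (exp (- ?z / 2) * exp (- (3/8) * ?z))"
    unfolding B_def sub_delta(2) by simp
  also have "\<dots> \<le> ?d / 960 * (exp (- ?z / 2) * exp (- a / 4 * ?z))"
    using sub_delta(1) a by (intro mult_left_mono exp_a_le z) auto
  finally show "(sub k i)\<^sup>2 \<le> ?d / 960 * (exp (- ?z / 2) * exp (- a / 4 * ?z))" .
qed

text \<open>\<open>G\<close> splits into a part antitone after damping, a subtracted exponential and
  the increasing crest, and each is compared with its integral in the favourable direction. The
  errors are the first term of the exponential and the last one of the crest.\<close>

lemma sum_left_lower:
  assumes k: "0 < k" "k \<le> i" "i \<le> n"
  shows "real k * (GA (lscale k n) (lscale k i) - GA (lscale k n) 0) - 1/4 - crest (lscale k n) * exp (a * lscale k i - lscale k n)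
    \<le> (\<Sum>j\<in>{k..<i}. exp ((a - 1) * lscale k j) * G (lscale k n) (lscale k j))"
proof -
  let ?z = "lscale k" and ?l = "lscale k n"
  note z = lscale_in_range[OF k]
  have l: "0 \<le> ?l" "?l \<le> ln (real n)" using lscale_in_range[of k n] k by auto
  define R where "R z = H z + 1/4 * exp (- a / 4 * z)" for z
  define f where "f F j = exp ((a - 1) * ?z j) * F (?z j)" for F :: "real \<Rightarrow> real" and j
  have R: "real k * ((HA (?z i) + 1/4 * expA (?z i)) - (HA (?z k) + 1/4 * expA (?z k))) \<le> sum (f R) {k..<i}"
    unfolding f_def
  proof (rule sum_antitone_bounds(2)[where len = ?l])
    show "((\<lambda>z. HA z + 1/4 * expA z) has_real_derivative exp (a * z) * R z) (at z)" for z
      unfolding R_def distrib_left[of "exp (a * z)"] mult.left_commute[of "exp (a * z)" "1/4"]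
      by (intro DERIV_add DERIV_cmult HA_deriv expA_deriv)
    show "exp ((a - 1) * y) * R y \<le> exp ((a - 1) * x) * R x" if "0 \<le> x" "x \<le> y" "y \<le> ?l" for x y
    proof (rule antitone_exp_mult[where len = ?l])
      show "0 \<le> R z" if "0 \<le> z" "z \<le> ?l" for z
        using H_ge[of z] that l exp_quarter(2)[of z] by (simp add: R_def)
      show "exp (- y / 2) * R y \<le> exp (- x / 2) * R x" if "0 \<le> x" "x \<le> y" "y \<le> ?l" for x y
        unfolding R_def using H_antitone[of x y] that l by simp
    qed (use that a in auto)
  qed (use k z in auto)
  have E: "sum (f (\<lambda>z. exp (- a / 4 * z))) {k..<i} \<le> 1 + real k * (expA (?z i) - expA (?z k))"
  proof -
    let ?E = "\<lambda>z. exp (- a / 4 * z)"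
    have "sum (f ?E) {k..<i} \<le> sum (f ?E) {k..<i} + f ?E i"
      by (simp add: f_def)
    also have "\<dots> = f ?E k + sum (f ?E) {k<..i}"
      by (rule sum_shift_ends) fact
    also have "f ?E k = 1" using k by (simp add: f_def)
    also have "sum (f ?E) {k<..i} \<le> real k * (expA (?z i) - expA (?z k))"
      unfolding f_def
    proof (rule sum_antitone_bounds(1)[where len = ?l])
      show "(expA has_real_derivative exp (a * z) * exp (- a / 4 * z)) (at z)" for z
        by (rule expA_deriv)
      show "exp ((a - 1) * y) * exp (- a / 4 * y) \<le> exp ((a - 1) * x) * exp (- a / 4 * x)" if "0 \<le> x" "x \<le> y" for x y
        using that a mult_left_mono_neg[of x y "a - 1"] by (intro mult_mono) auto
    qed (use k z in auto)
    finally show ?thesis by simp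
  qed
  have T: "real k * (topA ?l (?z i) - topA ?l (?z k)) - exp (a * ?z i - ?l) \<le> sum (f (\<lambda>z. exp (z - ?l))) {k..<i}"
  proof -
    let ?T = "\<lambda>z. exp (z - ?l)"
    have fT: "f ?T j = exp (a * ?z j - ?l)" for j
      unfolding f_def exp_add[symmetric] by (simp add: algebra_simps)
    have "real k * (topA ?l (?z i) - topA ?l (?z k)) \<le> sum (f ?T) {k<..i}"
      unfolding f_def
    proof (rule sum_monotone_bound[where len = ?l])
      show "(topA ?l has_real_derivative exp (a * z) * exp (z - ?l)) (at z)" for z
        by (rule topA_deriv)
      show "exp ((a - 1) * x) * exp (x - ?l) \<le> exp ((a - 1) * y) * exp (y - ?l)" if "0 \<le> x" "x \<le> y" for x y
        unfolding exp_add[symmetric] using that a mult_left_mono[of x y a] by (simp add: algebra_simps)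
    qed (use k z in auto)
    also have "\<dots> \<le> f ?T k + sum (f ?T) {k<..i}" by (simp add: f_def)
    also have "\<dots> = sum (f ?T) {k..<i} + f ?T i"
      using sum_shift_ends[OF k(2), of "f ?T"] by simp
    finally show ?thesis by (simp add: fT)
  qed
  have "(\<Sum>j\<in>{k..<i}. exp ((a - 1) * ?z j) * G ?l (?z j)) =
      sum (f R) {k..<i} - 1/4 * sum (f (\<lambda>z. exp (- a / 4 * z))) {k..<i} + crest ?l * sum (f (\<lambda>z. exp (z - ?l))) {k..<i}"
    unfolding sum_distrib_left sum_subtractf[symmetric] sum.distrib[symmetric]
    by (intro sum.cong refl) (simp add: f_def G_def R_def algebra_simps)
  moreover have "crest ?l * (real k * (topA ?l (?z i) - topA ?l (?z k)) - exp (a * ?z i - ?l)) \<le>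
      crest ?l * sum (f (\<lambda>z. exp (z - ?l))) {k..<i}"
    using T crest_pos[OF l] by (intro mult_left_mono) auto
  moreover have "1/4 * sum (f (\<lambda>z. exp (- a / 4 * z))) {k..<i} \<le> 1/4 * (1 + real k * (expA (?z i) - expA (?z k)))"
    using E by (intro mult_left_mono) auto
  ultimately have "real k * ((HA (?z i) + 1/4 * expA (?z i)) - (HA (?z k) + 1/4 * expA (?z k)))
      - 1/4 * (1 + real k * (expA (?z i) - expA (?z k)))
      + crest ?l * (real k * (topA ?l (?z i) - topA ?l (?z k)) - exp (a * ?z i - ?l))
      \<le> (\<Sum>j\<in>{k..<i}. exp ((a - 1) * ?z j) * G ?l (?z j))"
    using R by linarith
  then show ?thesis
    using k by (simp add: GA_def algebra_simps)
qed

text \<open>The lower Riemann comparison wants left endpoints and so starts at \<open>i\<close>,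
  which is not its own neighbour; the term at \<open>i\<close> is the error.\<close>

lemma sum_right_lower:
  assumes k: "0 < k" "k \<le> i" "i \<le> n"
  shows "real k * (GB (lscale k n) (lscale k n) - GB (lscale k n) (lscale k i))
      - exp ((- a - 1) * lscale k i) * G (lscale k n) (lscale k i)
    \<le> (\<Sum>j\<in>{i<..n}. exp ((- a - 1) * lscale k j) * G (lscale k n) (lscale k j))"
proof -
  let ?z = "lscale k" and ?l = "lscale k n"
  define f where "f j = exp ((- a - 1) * ?z j) * G ?l (?z j)" for j
  have l: "0 \<le> ?l" "?l \<le> ln (real n)" using lscale_in_range[of k n] k by auto
  have "real k * (GB ?l (?z n) - GB ?l (?z i)) \<le> sum f {i..<n}"
    unfolding f_def
  proof (rule sum_antitone_bounds(2)[where len = ?l])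
    show "(GB ?l has_real_derivative exp (- a * z) * G ?l z) (at z)" for z
      by (rule GB_deriv)
    show "exp ((- a - 1) * y) * G ?l y \<le> exp ((- a - 1) * x) * G ?l x" if "0 \<le> x" "x \<le> y" "y \<le> ?l" for x y
      using G_antitone[OF that l(2)] .
  qed (use k in auto)
  also have "\<dots> \<le> sum f {i..<n} + f n"
    using G_bounds(1)[OF l(1) order.refl l(2)] by (simp add: f_def)
  also have "\<dots> = f i + sum f {i<..n}"
    by (rule sum_shift_ends) fact
  finally show ?thesis by (simp add: f_def)
qed

text \<open>Discretisation errors carry a factor \<open>1 / k\<close>. For \<open>k\<close> at least
  200 times \<open>sub_bound a\<close> they use up 1/320 of the residual 1/80 and leave 3/320, apart
  from one more crest.\<close>

lemma sum_link_G_lower: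
  assumes k: "0 < k" "k \<le> i" "i \<le> n" and big: "200 * sub_bound a \<le> real k"
  shows "exp (- lscale k i / 2) * (G (lscale k n) (lscale k i) + 3/320 * exp (- a / 4 * lscale k i)
      - 3 * crest (lscale k n) * exp (lscale k i - lscale k n))
    \<le> (\<Sum>j=k..n. link p i j * (exp (- lscale k j / 2) * G (lscale k n) (lscale k j)))"
proof -
  let ?z = "lscale k i" and ?l = "lscale k n"
  define E X where "E = exp (- a / 4 * ?z)" and "X = exp (?z - ?l)"
  define Y where "Y = exp (- a * ?z) * (1/4 + crest ?l * exp (a * ?z - ?l)) + exp (a * ?z) * (exp ((- a - 1) * ?z) * G ?l ?z)"
  note z = lscale_in_range[OF k]
  have l: "0 \<le> ?l" "?l \<le> ln (real n)" using lscale_in_range[of k n] k by auto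
  have rk: "0 < real k" "1 \<le> real k" using k by auto
  have "(\<Sum>j=k..n. link p i j * (exp (- lscale k j / 2) * G ?l (lscale k j))) =
    \<beta> / real k * exp (- ?z / 2) *
      (exp (- a * ?z) * (\<Sum>j\<in>{k..<i}. exp ((a - 1) * lscale k j) * G ?l (lscale k j)) +
       exp (a * ?z) * (\<Sum>j\<in>{i<..n}. exp ((- a - 1) * lscale k j) * G ?l (lscale k j)))"
    using k \<gamma> beta_bounds by (intro sum_link) auto
  also have "\<dots> \<ge> \<beta> / real k * exp (- ?z / 2) *
      (exp (- a * ?z) * (real k * (GA ?l ?z - GA ?l 0) - 1/4 - crest ?l * exp (a * ?z - ?l)) +
       exp (a * ?z) * (real k * (GB ?l ?l - GB ?l ?z) - exp ((- a - 1) * ?z) * G ?l ?z))"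
    using sum_left_lower[OF k] sum_right_lower[OF k] beta_bounds rk
    by (intro mult_left_mono add_mono) auto
  also have "\<beta> / real k * exp (- ?z / 2) *
      (exp (- a * ?z) * (real k * (GA ?l ?z - GA ?l 0) - 1/4 - crest ?l * exp (a * ?z - ?l)) +
       exp (a * ?z) * (real k * (GB ?l ?l - GB ?l ?z) - exp ((- a - 1) * ?z) * G ?l ?z)) =
     \<beta> / real k * exp (- ?z / 2) * (real k * conv a ?l (GA ?l) (GB ?l) ?z - Y)"
    unfolding conv_def Y_def by (simp add: algebra_simps)
  also have "\<dots> = exp (- ?z / 2) * (\<beta> * conv a ?l (GA ?l) (GB ?l) ?z - \<beta> / real k * Y)"
    using rk by (simp add: algebra_simps)
  finally have main: "exp (- ?z / 2) * (\<beta> * conv a ?l (GA ?l) (GB ?l) ?z - \<beta> / real k * Y) \<le>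
      (\<Sum>j=k..n. link p i j * (exp (- lscale k j / 2) * G ?l (lscale k j)))" .
  have Y: "Y \<le> (1/4 + sub_bound a) * E + crest ?l * X"
  proof -
    have expand: "x * (1/4 + c * y) + u * (v * g) = 1/4 * x + c * (x * y) + (u * v) * g" for x y u v c g :: real
      by (simp add: algebra_simps)
    have "exp (- a * ?z) * exp (a * ?z - ?l) = exp (- ?l)" "exp (a * ?z) * exp ((- a - 1) * ?z) = exp (- ?z)"
      by (simp_all add: exp_add[symmetric] algebra_simps)
    then have "Y = 1/4 * exp (- a * ?z) + crest ?l * exp (- ?l) + exp (- ?z) * G ?l ?z"
      unfolding Y_def expand by (simp only:)
    moreover have "exp (- a * ?z) \<le> E"
      unfolding E_def using a by (intro exp_a_le z) auto
    moreover have "crest ?l * exp (- ?l) \<le> crest ?l * X"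
      using crest_pos[OF l] z by (simp add: X_def)
    moreover have "exp (- ?z) * G ?l ?z \<le> sub_bound a * E"
    proof -
      have "exp (- ?z) * G ?l ?z \<le> exp (- ?z) * (sub_bound a * exp (?z / 16))"
        using G_bounds(2)[OF z(1,2) l(2)] by (intro mult_left_mono) auto
      also have "\<dots> = sub_bound a * exp (- (15/16) * ?z)"
        by (simp add: exp_add[symmetric])
      also have "\<dots> \<le> sub_bound a * E"
        unfolding E_def using a sub_bound_ge by (intro mult_left_mono exp_a_le z) auto
      finally show ?thesis .
    qed
    ultimately show ?thesis unfolding ring_distribs by linarith
  qed
  have bk: "0 \<le> \<beta> / real k" "\<beta> / real k \<le> 1" "\<beta> / real k * (1/4 + sub_bound a) \<le> 1/320"
  proof -
    show "0 \<le> \<beta> / real k" "\<beta> / real k \<le> 1" using beta_bounds rk by (auto simp: divide_le_eq)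
    have "\<beta> * (1/4 + sub_bound a) \<le> 1/2 * (5/4 * sub_bound a)"
      using beta_bounds sub_bound_ge by (intro mult_mono) auto
    also have "\<dots> \<le> 1/320 * real k" using big by simp
    finally show "\<beta> / real k * (1/4 + sub_bound a) \<le> 1/320" using rk by (simp add: field_simps)
  qed
  have "\<beta> / real k * Y \<le> \<beta> / real k * ((1/4 + sub_bound a) * E + crest ?l * X)"
    using Y bk by (intro mult_left_mono) auto
  also have "\<dots> = \<beta> / real k * (1/4 + sub_bound a) * E + \<beta> / real k * (crest ?l * X)"
    by (simp only: distrib_left[of "\<beta> / real k" "(1/4 + sub_bound a) * E"] mult.assoc)
  also have "\<dots> \<le> 1/320 * E + 1 * (crest ?l * X)"
    using bk crest_pos[OF l] by (intro add_mono mult_right_mono) (auto simp: E_def X_def)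
  finally have "G ?l ?z + 3/320 * E - 3 * crest ?l * X \<le> \<beta> * conv a ?l (GA ?l) (GB ?l) ?z - \<beta> / real k * Y"
    using G_residual[OF z(1,2) l(2)] unfolding E_def[symmetric] X_def[symmetric] by linarith
  then have "exp (- ?z / 2) * (G ?l ?z + 3/320 * E - 3 * crest ?l * X) \<le>
      exp (- ?z / 2) * (\<beta> * conv a ?l (GA ?l) (GB ?l) ?z - \<beta> / real k * Y)"
    by (intro mult_left_mono) auto
  with main show ?thesis
    unfolding E_def X_def by (rule order.trans[rotated])
qed

text \<open>The squares are dominated by an exponential profile that the convolution at most
  doubles. The vertex \<open>k\<close>, which the comparison leaves out, adds at most once the
  profile, whence the total factor 3.\<close>

lemma sum_link_sub_sq:
  assumes k: "0 < k" "k \<le> i" "i \<le> n"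
  shows "(\<Sum>j=k..n. link p i j * (sub k j)\<^sup>2) \<le> sub_delta a / 320 * (exp (- lscale k i / 2) * exp (- a / 4 * lscale k i))"
proof -
  let ?z = "lscale k i" and ?l = "lscale k n"
  let ?e = "\<lambda>j. exp (- lscale k j / 2) * exp (- a / 4 * lscale k j)"
  note z = lscale_in_range[OF k]
  have rk: "0 < real k" "1 \<le> real k" using k by auto
  have "(\<Sum>j=Suc k..n. link p i j * ?e j) \<le> \<beta> * exp (- ?z / 2) * conv a ?l expA expB ?z"
  proof (rule sum_link_upper)
    show "0 \<le> \<beta>" "\<beta> \<le> 1" using beta_bounds by auto
    show "exp (- y / 2) * exp (- a / 4 * y) \<le> exp (- x / 2) * exp (- a / 4 * x)" if "0 \<le> x" "x \<le> y" for x y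
      using that a mult_left_mono_neg[of x y "- a / 4"] by (intro mult_mono) auto
  qed ((fact k \<gamma>) | rule expA_deriv expB_deriv | simp)+
  also have "\<dots> = exp (- ?z / 2) * (\<beta> * conv a ?l expA expB ?z)" by simp
  also have "\<dots> \<le> exp (- ?z / 2) * (2 * exp (- a / 4 * ?z))"
  proof (rule mult_left_mono)
    obtain m where m: "\<bar>m\<bar> \<le> 1/64"
      and conv_exp': "\<And>len z. \<beta> * conv a len expA expB z = 16/15 * (1 - m) * exp (- a / 4 * z)
        - 2/3 * (1 - m) * exp (- a * z) - 2/5 * (1 - m) * exp (- a / 4 * len) * exp (- a * (len - z))"
      by (rule beta_conv_exp) blast
    have "0 \<le> 2/3 * (1 - m) * exp (- a * ?z)" "0 \<le> 2/5 * (1 - m) * exp (- a / 4 * ?l) * exp (- a * (?l - ?z))"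
      using m by (auto intro!: mult_nonneg_nonneg)
    moreover have "16/15 * (1 - m) * exp (- a / 4 * ?z) \<le> 2 * exp (- a / 4 * ?z)"
      using m by (intro mult_right_mono) auto
    ultimately show "\<beta> * conv a ?l expA expB ?z \<le> 2 * exp (- a / 4 * ?z)"
      unfolding conv_exp' by linarith
  qed simp
  finally have "(\<Sum>j=Suc k..n. link p i j * ?e j) \<le> 2 * ?e i" by simp
  moreover have "link p i k * ?e k \<le> ?e i"
  proof (cases "i = k")
    case True
    then show ?thesis by (simp add: link_def)
  next
    case False
    then have "link p i k = \<beta> / real k * exp (- lscale k k / 2) * exp (- ?z / 2) * exp (- a * (?z - lscale k k))"
      using link_edge_prob[of \<beta> \<gamma> k k i] beta_bounds \<gamma> k by auto
    then have "link p i k * ?e k = \<beta> / real k * (exp (- ?z / 2) * exp (- a * ?z))"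
      using k by simp
    also have "\<dots> \<le> 1 * (exp (- ?z / 2) * exp (- a / 4 * ?z))"
      using beta_bounds rk a z by (intro mult_mono mult_left_mono exp_a_le) (auto simp: divide_le_eq)
    finally show ?thesis by simp
  qed
  moreover have "(\<Sum>j=k..n. link p i j * ?e j) = link p i k * ?e k + (\<Sum>j=Suc k..n. link p i j * ?e j)"
    using k by (intro sum.atLeast_Suc_atMost) auto
  ultimately have e: "(\<Sum>j=k..n. link p i j * ?e j) \<le> 3 * ?e i" by linarith
  have "(\<Sum>j=k..n. link p i j * (sub k j)\<^sup>2) \<le> (\<Sum>j=k..n. link p i j * (sub_delta a / 960 * ?e j))"
    using sub_bounds(3)[of k] k link_nonneg by (intro sum_mono mult_left_mono) auto
  also have "\<dots> = sub_delta a / 960 * (\<Sum>j=k..n. link p i j * ?e j)"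
    by (simp add: sum_distrib_left algebra_simps)
  also have "\<dots> \<le> sub_delta a / 960 * (3 * ?e i)"
    using e sub_delta by (intro mult_left_mono) auto
  finally show ?thesis by simp
qed

lemma sub_ineq:
  assumes k: "0 < k" "k \<le> i" "i \<le> n" and big: "200 * sub_bound a \<le> real k"
  shows "sub k i \<le> sub_weight k i + (\<Sum>j\<in>{k..n}. link p i j * (1 - exp (- sub k j)))"
proof -
  let ?z = "lscale k i" and ?l = "lscale k n" and ?d = "sub_delta a"
  define e where "e = exp (- ?z / 2)"
  define E where "E = exp (- a / 4 * ?z)"
  have pos: "0 < e" "0 < E" "0 < ?d" using sub_delta by (auto simp: e_def E_def)
  have "?d * (e * (G ?l ?z + 3/320 * E - 3 * crest ?l * exp (?z - ?l))) \<le>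
      ?d * (\<Sum>j=k..n. link p i j * (exp (- lscale k j / 2) * G ?l (lscale k j)))"
    using sum_link_G_lower[OF assms] pos unfolding e_def E_def by (intro mult_left_mono) auto
  also have "\<dots> = (\<Sum>j=k..n. link p i j * sub k j)"
    by (simp add: sub_def sum_distrib_left algebra_simps)
  finally have 1: "?d * (e * (G ?l ?z + 3/320 * E - 3 * crest ?l * exp (?z - ?l))) \<le> (\<Sum>j=k..n. link p i j * sub k j)" .
  have 2: "(\<Sum>j=k..n. link p i j * (sub k j)\<^sup>2) \<le> ?d / 320 * (e * E)"
    using sum_link_sub_sq[OF k] unfolding e_def E_def .
  have "(\<Sum>j=k..n. link p i j * sub k j) - (\<Sum>j=k..n. link p i j * (sub k j)\<^sup>2) =
      (\<Sum>j=k..n. link p i j * (sub k j - (sub k j)\<^sup>2))"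
    by (simp add: sum_subtractf[symmetric] algebra_simps)
  also have "\<dots> \<le> (\<Sum>j=k..n. link p i j * (1 - exp (- sub k j)))"
    using k sub_bounds(1)[of k] link_nonneg one_minus_exp_ge by (intro sum_mono mult_left_mono) auto
  finally have 3: "(\<Sum>j=k..n. link p i j * sub k j) - (\<Sum>j=k..n. link p i j * (sub k j)\<^sup>2)
      \<le> (\<Sum>j=k..n. link p i j * (1 - exp (- sub k j)))" .
  have "?d * (e * (G ?l ?z + 3/320 * E - 3 * crest ?l * exp (?z - ?l))) =
      sub k i + 3 * (?d / 320 * (e * E)) - sub_weight k i"
    unfolding sub_def sub_weight_def e_def[symmetric] by (simp add: algebra_simps)
  moreover have "0 \<le> ?d / 320 * (e * E)" using pos by simp
  ultimately show ?thesis using 1 2 3 by linarith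
qed

end

text \<open>The constant in front of \<open>2 ^ K / k\<close> that bounds the loss from exploring without replacement.\<close>

definition loss_const :: "real \<Rightarrow> real" where
  "loss_const a = 2 * (sub_delta a * sub_bound a) * (40 / super_delta a)\<^sup>2"

context wave_graph
begin

section \<open>Loss of the exploration and lower tail\<close>

lemma link_le:
  assumes "0 < k" "k \<le> i" "k \<le> j"
  shows "link p i j \<le> 1 / real k * exp (- lscale k i / 2) * exp (- lscale k j / 2) * exp (- a * \<bar>lscale k i - lscale k j\<bar>)"
proof (cases i j rule: linorder_cases)
  case less
  then have "link p i j = \<beta> / real k * exp (- lscale k i / 2) * exp (- lscale k j / 2) * exp (- a * (lscale k j - lscale k i))"
    using link_edge_prob[of \<beta> \<gamma> k i j] beta_bounds \<gamma> assms by auto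
  moreover have "\<bar>lscale k i - lscale k j\<bar> = lscale k j - lscale k i"
    using lscale_mono[of k i j] less assms by simp
  ultimately show ?thesis
    using beta_bounds assms by (simp add: mult_right_mono divide_right_mono)
next
  case equal
  then show ?thesis using assms by (simp add: link_def)
next
  case greater
  then have "link p i j = \<beta> / real k * exp (- lscale k j / 2) * exp (- lscale k i / 2) * exp (- a * (lscale k i - lscale k j))"
    using link_edge_prob[of \<beta> \<gamma> k j i] beta_bounds \<gamma> assms by auto
  moreover have "\<bar>lscale k i - lscale k j\<bar> = lscale k i - lscale k j"
    using lscale_mono[of k j i] greater assms by simp
  ultimately have "link p i j = \<beta> / real k * exp (- lscale k i / 2) * exp (- lscale k j / 2) * exp (- a * \<bar>lscale k i - lscale k j\<bar>)"
    by simp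
  then show ?thesis
    using beta_bounds assms by (simp add: mult_right_mono divide_right_mono)
qed

text \<open>A bound of product form turns the double sum over a cluster into a square. If
  \<open>j\<close> is younger than \<open>i\<close>, the decay of \<open>sub\<close> pays for both
  factors; otherwise it does so together with the decay of the kernel.\<close>

lemma link_sub_le:
  assumes k: "0 < k" "k \<le> i" "i \<le> n" "k \<le> j" "j \<le> n"
  shows "link p i j * sub k j \<le> sub_delta a * sub_bound a / real k *
    ((exp (- lscale k i / 2) * exp (- a / 4 * lscale k i)) * (exp (- lscale k j / 2) * exp (- a / 4 * lscale k j)))"
proof -
  let ?x = "lscale k i" and ?y = "lscale k j"
  have xy: "0 \<le> ?x" "0 \<le> ?y" using lscale_nonneg k by auto
  have "t / 4 * (x + y) \<le> t * \<bar>x - y\<bar> + 7/16 * y" if "0 \<le> x" "0 \<le> y" "0 < t" "t \<le> 1/2" for t x y :: real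
  proof (cases "x \<le> y")
    case True
    have "t / 4 * (x + y) \<le> 1/8 * (y + y)" using True that by (intro mult_mono) auto
    also have "\<dots> \<le> 7/16 * y" using that by simp
    also have "\<dots> \<le> t * \<bar>x - y\<bar> + 7/16 * y" using that by simp
    finally show ?thesis .
  next
    case False
    have *: "(u + w) / 4 \<le> u - w + 7/16 * y" if "w \<le> u" "w \<le> y / 2" for u w
      using that \<open>0 \<le> y\<close> by (simp add: field_simps)
    have "t * y \<le> t * x" using False that by (intro mult_left_mono) auto
    moreover have "t * y \<le> y / 2" using that mult_right_mono[of t "1/2" y] by simp
    ultimately have "(t * x + t * y) / 4 \<le> t * x - t * y + 7/16 * y" by (rule *)
    moreover have "t / 4 * (x + y) = (t * x + t * y) / 4" "t * \<bar>x - y\<bar> = t * x - t * y"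
      using False by (simp_all add: field_simps)
    ultimately show ?thesis by (simp only:)
  qed
  from this[OF xy a] have e: "a / 4 * (?x + ?y) \<le> a * \<bar>?x - ?y\<bar> + 7/16 * ?y" .
  have "link p i j * sub k j \<le> (1 / real k * exp (- ?x / 2) * exp (- ?y / 2) * exp (- a * \<bar>?x - ?y\<bar>)) *
      (sub_delta a * sub_bound a * exp (- (7/16) * ?y))"
    using link_le[of k i j] sub_bounds(1,2)[of k j] k by (intro mult_mono) auto
  also have "\<dots> = sub_delta a * sub_bound a / real k * exp (- ?x / 2) * exp (- ?y / 2) *
      exp (- (a * \<bar>?x - ?y\<bar> + 7/16 * ?y))"
  proof -
    have "(1 / m * e1 * e2 * exp (- t * r)) * (d * e * exp (- (7/16) * y)) = d * e / m * e1 * e2 * exp (- (t * r + 7/16 * y))"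
      for m e1 e2 t r d e y :: real
      by (simp add: exp_add[symmetric])
    then show ?thesis .
  qed
  also have "\<dots> \<le> sub_delta a * sub_bound a / real k * exp (- ?x / 2) * exp (- ?y / 2) * exp (- (a / 4 * (?x + ?y)))"
    using e sub_delta sub_bound_ge by (intro mult_left_mono mult_nonneg_nonneg divide_nonneg_nonneg) auto
  also have "exp (- (a / 4 * (?x + ?y))) = exp (- a / 4 * ?x) * exp (- a / 4 * ?y)"
  proof -
    have "exp (- (t / 4 * (x + y))) = exp (- t / 4 * x) * exp (- t / 4 * y)" for t x y :: real
      unfolding exp_add[symmetric] by (intro arg_cong[of _ _ exp]) (simp add: field_simps)
    then show ?thesis .
  qed
  finally show ?thesis by (simp only: mult.assoc mult.left_commute mult.commute)
qed

lemma sub_weight_le: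
  assumes "0 < k" "k \<le> i" "i \<le> n"
  shows "sub_weight k i \<le> 3 * sub_delta a * crest (lscale k n) * exp (- lscale k n / 2)"
proof -
  have l: "0 \<le> lscale k n" "lscale k n \<le> ln (real n)" using lscale_in_range[of k n] assms by auto
  have "exp (- lscale k i / 2) * exp (lscale k i - lscale k n) \<le> exp (- lscale k n / 2)"
    using lscale_in_range[OF assms] by (simp add: exp_add[symmetric])
  then show ?thesis
    unfolding sub_weight_def using sub_delta crest_pos[OF l] by (intro mult_left_mono) auto
qed

lemma sub_ge:
  assumes "0 < k" "k \<le> i" "i \<le> n" "i \<le> 4 * k"
  shows "sub_delta a / 4 \<le> sub k i"
proof -
  let ?z = "lscale k i"
  have "exp (?z / 2) \<le> 2"
  proof -
    have "(exp (?z / 2))\<^sup>2 = exp ?z" by (simp add: power2_eq_square exp_add[symmetric])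
    also have "\<dots> \<le> 2\<^sup>2" using exp_lscale[of k i] assms by (simp add: divide_le_eq)
    finally show ?thesis by (rule power2_le_imp_le) simp
  qed
  then have "1/2 \<le> exp (- ?z / 2)" by (simp add: exp_minus field_simps)
  moreover have "1/2 \<le> G (lscale k n) ?z"
    using G_bounds(1)[OF lscale_in_range(1,2)[OF assms(1-3)]] lscale_le_L[of k] assms by simp
  ultimately have "1/2 * (1/2) \<le> exp (- ?z / 2) * G (lscale k n) ?z"
    by (intro mult_mono) auto
  then show ?thesis
    using sub_delta mult_left_mono[of "1/4" "exp (- ?z / 2) * G (lscale k n) ?z" "sub_delta a"] by (simp add: sub_def)
qed

text \<open>The loss is at most quadratic in the total \<open>super_weight\<close> of the cluster,
  hence dominated by its exponential. The supersolution bounds the mean of that, while the prefactor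
  \<open>1 / k\<close> makes the loss small.\<close>

lemma expectation_loss:
  assumes k: "0 < k" and A: "A \<subseteq> {k..n}" "U \<subseteq> {Suc k..n}" "A \<inter> U = {}"
  shows "measure_pmf.expectation (edges \<gamma> \<beta> n)
      (\<lambda>\<omega>. \<Sum>i\<in>cluster A U \<omega>. \<Sum>j\<in>cluster A U \<omega>. link p i j * sub k j) \<le> loss_const a / real k * 2 ^ card A"
proof -
  let ?C = "\<lambda>\<omega>. cluster A U \<omega>"
  let ?e = "\<lambda>i. exp (- lscale k i / 2) * exp (- a / 4 * lscale k i)"
  let ?s = "super_delta a"
  define B where "B = sub_delta a * sub_bound a / real k"
  have B: "0 \<le> B" using sub_delta sub_bound_ge by (simp add: B_def)
  have range: "k \<le> i" "i \<le> n" if "i \<in> ?C \<omega>" for i \<omega>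
    using cluster_subset[of A U \<omega>] A that by force+
  have bound: "(\<Sum>i\<in>?C \<omega>. \<Sum>j\<in>?C \<omega>. link p i j * sub k j) \<le>
      loss_const a / real k * exp (\<Sum>i\<in>?C \<omega>. super_weight k i)" for \<omega>
  proof -
    define y where "y = (\<Sum>i\<in>?C \<omega>. super_weight k i)"
    have "(\<Sum>i\<in>?C \<omega>. \<Sum>j\<in>?C \<omega>. link p i j * sub k j) \<le> (\<Sum>i\<in>?C \<omega>. \<Sum>j\<in>?C \<omega>. B * (?e i * ?e j))"
      unfolding B_def using range k by (intro sum_mono link_sub_le) auto
    also have "\<dots> = B * (\<Sum>i\<in>?C \<omega>. ?e i)\<^sup>2"
    proof -
      have "(\<Sum>i\<in>I. \<Sum>j\<in>I. B * (f i * f j)) = B * (sum f I)\<^sup>2" for f :: "nat \<Rightarrow> real" and I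
        unfolding power2_eq_square sum_product by (simp only: sum_distrib_left)
      then show ?thesis .
    qed
    also have "\<dots> \<le> B * (40 / ?s * y)\<^sup>2"
    proof (intro mult_left_mono power_mono sum_nonneg)
      have "(\<Sum>i\<in>?C \<omega>. ?e i) \<le> (\<Sum>i\<in>?C \<omega>. 40 / ?s * super_weight k i)"
      proof (rule sum_mono)
        fix i assume "i \<in> ?C \<omega>"
        then have "40 / ?s * (?s / 40 * ?e i) \<le> 40 / ?s * super_weight k i"
          using super_weight_ge(2)[of k i] range[of i \<omega>] k super_delta_pos by (intro mult_left_mono) auto
        then show "?e i \<le> 40 / ?s * super_weight k i"
          using super_delta_pos by simp
      qed
      then show "(\<Sum>i\<in>?C \<omega>. ?e i) \<le> 40 / ?s * y" by (simp add: y_def sum_distrib_left)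
    qed (use B in auto)
    also have "\<dots> = B * (40 / ?s)\<^sup>2 * y\<^sup>2" by (simp add: power_mult_distrib power2_eq_square)
    also have "\<dots> \<le> B * (40 / ?s)\<^sup>2 * (2 * exp y)"
    proof (intro mult_left_mono)
      have "0 \<le> y"
        unfolding y_def
      proof (rule sum_nonneg)
        fix i assume i: "i \<in> ?C \<omega>"
        have "0 \<le> ?s / 40 * ?e i" using super_delta_pos by simp
        then show "0 \<le> super_weight k i"
          using super_weight_ge(2)[of k i] range[OF i] k by linarith
      qed
      then show "y\<^sup>2 \<le> 2 * exp y"
        using exp_lower_Taylor_quadratic[of y] by simp
    qed (use B in simp)
    also have "\<dots> = loss_const a / real k * exp y"
      by (simp add: loss_const_def B_def)
    finally show ?thesis by (simp add: y_def)
  qed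
  have "measure_pmf.expectation (edges \<gamma> \<beta> n) (\<lambda>\<omega>. \<Sum>i\<in>?C \<omega>. \<Sum>j\<in>?C \<omega>. link p i j * sub k j) \<le>
      measure_pmf.expectation (edges \<gamma> \<beta> n) (\<lambda>\<omega>. loss_const a / real k * exp (\<Sum>i\<in>?C \<omega>. super_weight k i))"
    using bound by (intro expectation_edge_pmf_mono) auto
  also have "\<dots> = loss_const a / real k * measure_pmf.expectation (edges \<gamma> \<beta> n) (\<lambda>\<omega>. exp (\<Sum>i\<in>?C \<omega>. super_weight k i))"
    by simp
  also have "\<dots> \<le> loss_const a / real k * 2 ^ card A"
    using expectation_super_weight[OF k A] sub_delta sub_bound_ge
    by (intro mult_left_mono) (auto simp: loss_const_def)
  finally show ?thesis .
qed

text \<open>The subtraction formula at \<open>lscale k n = ln n - ln k\<close>, with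
  \<open>- C \<le> 1\<close>. The factor \<open>sqrt k\<close> is harmless because \<open>k\<close>
  stays fixed while \<open>n\<close> grows.\<close>

lemma S_lscale_le:
  assumes "0 < k" "k \<le> n"
  shows "S (lscale k n) + 1 \<le> 34 * sqrt (real k) * (S (ln (real n)) + 1)"
proof -
  let ?L = "ln (real n)"
  define t where "t = ln (real k)"
  have t: "0 \<le> t" "t \<le> ?L" "0 \<le> ?L" using assms by (auto simp: t_def)
  have S: "0 \<le> S ?L" "0 \<le> S t" "S t \<le> 32 * exp (t / 16)" "C t \<le> exp (t / 16)" "1 \<le> exp (t / 16)"
    using S_nonneg S_le abs_C_le[of t] t by auto
  have lt: "lscale k n = ?L - t"
    using assms by (simp add: t_def lscale_def ln_div)
  have "S ?L * C t \<le> S ?L * exp (t / 16)" using S by (intro mult_left_mono) auto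
  moreover have "- C ?L * S t \<le> (S ?L + 1) * (32 * exp (t / 16))"
    using S C_ge[of ?L] t by (intro mult_mono) auto
  ultimately have "S (lscale k n) \<le> S ?L * exp (t / 16) + (S ?L + 1) * (32 * exp (t / 16))"
    unfolding lt S_diff by simp
  also have "\<dots> + 1 \<le> 34 * exp (t / 16) * (S ?L + 1)"
  proof -
    define e where "e = exp (t / 16)"
    have "0 \<le> S ?L * e" "1 \<le> e" using S by (auto simp: e_def)
    then show ?thesis unfolding e_def[symmetric] by (simp add: algebra_simps)
  qed
  also have "exp (t / 16) \<le> sqrt (real k)"
  proof -
    have "exp (t / 16) \<le> exp (ln (sqrt (real k)))"
      using assms t by (simp add: ln_sqrt t_def)
    then show ?thesis using assms by simp
  qed
  finally show ?thesis using S by (simp add: mult_right_mono)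
qed

text \<open>The roots are \<open>K\<close> consecutive vertices from \<open>k\<close> on, each with
  \<open>sub\<close> at least \<open>sub_delta a / 4\<close>. A large \<open>K\<close> makes the
  Laplace transform small, and then \<open>k\<close> large compared with \<open>2 ^ K\<close> makes
  the loss small.\<close>

lemma max_component_lower:
  assumes K: "1 \<le> K" "K \<le> k" "2 * k \<le> n" and big: "200 * sub_bound a \<le> real k"
  shows "1 - exp (- (real K * sub_delta a / 8)) - 16 * loss_const a * 2 ^ K / (real k * real K * sub_delta a)
    \<le> measure (measure_pmf (edges \<gamma> \<beta> n))
        {\<omega>. a\<^sup>2 / (13056 * real k) * (sqrt (real n) / (S (ln (real n)) + 1)) \<le> real (max_component n \<omega>)}"
proof -
  let ?P = "measure_pmf.prob (edges \<gamma> \<beta> n)" and ?d = "sub_delta a" and ?l = "lscale k n"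
  define A U where "A = {k..<k + K}" and "U = {k + K..n}"
  define \<Lambda> where "\<Lambda> = real K * ?d / 4"
  let ?C = "\<lambda>\<omega>. cluster A U \<omega>"
  define W where "W \<omega> = (\<Sum>i\<in>?C \<omega>. sub_weight k i)" for \<omega>
  define D where "D \<omega> = (\<Sum>i\<in>?C \<omega>. \<Sum>j\<in>?C \<omega>. link p i j * sub k j)" for \<omega>
  have k: "0 < k" "k \<le> n" using K by auto
  have l: "0 \<le> ?l" "?l \<le> ln (real n)" using lscale_in_range[of k n] k by auto
  have AU: "A \<union> U = {k..n}" "A \<inter> U = {}" "A \<subseteq> {k..n}" "U \<subseteq> {Suc k..n}" "card A = K"
    using K by (auto simp: A_def U_def)
  have range: "k \<le> i" "i \<le> n" if "i \<in> ?C \<omega>" for i \<omega>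
    using cluster_subset[of A U \<omega>] AU that by force+
  have \<Lambda>: "0 < \<Lambda>" using K sub_delta by (simp add: \<Lambda>_def)
  have D0: "0 \<le> D \<omega>" for \<omega>
    unfolding D_def using range sub_bounds(1)[of k] k link_nonneg by (intro sum_nonneg mult_nonneg_nonneg) auto
  have "measure_pmf.expectation (edges \<gamma> \<beta> n)
      (\<lambda>\<omega>. exp (- (\<Sum>i\<in>?C \<omega>. sub_weight k i + (\<Sum>j\<in>{} \<union> ?C \<omega>. link p i j * sub k j)))) \<le> exp (- (\<Sum>j\<in>A. sub k j))"
  proof (rule cluster_exp_lower[where V = "{k..n}"])
    show "0 \<le> p e" "p e \<le> 1" for e
      using edge_prob_of_bounds beta_bounds(3) by auto
    show "0 \<le> sub k j" if "j \<in> {k..n}" for j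
      using sub_bounds(1)[of k j] that k by simp
    show "sub k i \<le> sub_weight k i + (\<Sum>j\<in>{k..n}. link p i j * (1 - exp (- sub k j)))" if "i \<in> {k..n}" for i
      using sub_ineq[of k i] that k big by simp
    show "pairs (A \<union> U) \<subseteq> vertex_pairs n"
      unfolding AU(1) using k by (auto simp: pairs_def vertex_pairs_def)
  qed (use AU in simp_all)
  moreover have "(\<Sum>i\<in>?C \<omega>. sub_weight k i + (\<Sum>j\<in>{} \<union> ?C \<omega>. link p i j * sub k j)) = W \<omega> + D \<omega>" for \<omega>
    by (simp add: W_def D_def sum.distrib)
  ultimately have EWD: "measure_pmf.expectation (edges \<gamma> \<beta> n) (\<lambda>\<omega>. exp (- (W \<omega> + D \<omega>))) \<le> exp (- (\<Sum>j\<in>A. sub k j))"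
    by simp
  also have "\<dots> \<le> exp (- \<Lambda>)"
  proof -
    have "(\<Sum>j\<in>A. ?d / 4) \<le> (\<Sum>j\<in>A. sub k j)"
      using K by (intro sum_mono sub_ge) (auto simp: A_def)
    then show ?thesis using AU(5) by (simp add: \<Lambda>_def)
  qed
  finally have E: "measure_pmf.expectation (edges \<gamma> \<beta> n) (\<lambda>\<omega>. exp (- (W \<omega> + D \<omega>))) \<le> exp (- \<Lambda>)" .
  have "?P {\<omega>. exp (- (\<Lambda> / 2)) \<le> exp (- (W \<omega> + D \<omega>))} \<le>
      measure_pmf.expectation (edges \<gamma> \<beta> n) (\<lambda>\<omega>. exp (- (W \<omega> + D \<omega>))) / exp (- (\<Lambda> / 2))"
    by (intro Markov_edge_pmf) auto
  also have "\<dots> \<le> exp (- \<Lambda>) / exp (- (\<Lambda> / 2))"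
    using E by (intro divide_right_mono) auto
  also have "\<dots> = exp (- (\<Lambda> / 2))"
    by (simp add: exp_diff[symmetric])
  also have "{\<omega>. exp (- (\<Lambda> / 2)) \<le> exp (- (W \<omega> + D \<omega>))} = {\<omega>. W \<omega> + D \<omega> \<le> \<Lambda> / 2}"
    unfolding exp_le_cancel_iff by auto
  finally have P1: "?P {\<omega>. W \<omega> + D \<omega> \<le> \<Lambda> / 2} \<le> exp (- (\<Lambda> / 2))" .
  have "?P {\<omega>. \<Lambda> / 4 \<le> D \<omega>} \<le> measure_pmf.expectation (edges \<gamma> \<beta> n) D / (\<Lambda> / 4)"
    using D0 \<Lambda> by (intro Markov_edge_pmf) auto
  also have "\<dots> \<le> loss_const a / real k * 2 ^ K / (\<Lambda> / 4)"
    using expectation_loss[OF k(1) AU(3,4,2)] \<Lambda> AU(5) unfolding D_def by (intro divide_right_mono) auto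
  also have "\<dots> = 16 * loss_const a * 2 ^ K / (real k * real K * ?d)"
    by (simp add: \<Lambda>_def ac_simps)
  finally have P2: "?P {\<omega>. \<Lambda> / 4 \<le> D \<omega>} \<le> 16 * loss_const a * 2 ^ K / (real k * real K * ?d)" .
  let ?good = "{\<omega>. a\<^sup>2 / (13056 * real k) * (sqrt (real n) / (S (ln (real n)) + 1)) \<le> real (max_component n \<omega>)}"
  \<comment> \<open>Outside both events on the right, the weight \<open>W\<close> alone exceeds
    \<open>\<Lambda> / 4\<close>, which forces many vertices.\<close>
  have "- ?good \<subseteq> {\<omega>. W \<omega> + D \<omega> \<le> \<Lambda> / 2} \<union> {\<omega>. \<Lambda> / 4 \<le> D \<omega>}"
  proof
    fix \<omega> assume bad: "\<omega> \<in> - ?good"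
    show "\<omega> \<in> {\<omega>. W \<omega> + D \<omega> \<le> \<Lambda> / 2} \<union> {\<omega>. \<Lambda> / 4 \<le> D \<omega>}"
    proof (rule ccontr)
      assume "\<not> ?thesis"
      then have WD: "\<Lambda> / 4 < W \<omega>" by auto
      define x where "x = real (max_component n \<omega>)"
      have S: "0 \<le> S ?l" "0 \<le> S (ln (real n))" using S_nonneg l by auto
      have "W \<omega> \<le> (\<Sum>i\<in>?C \<omega>. 3 * ?d * crest ?l * exp (- ?l / 2))"
        unfolding W_def using sub_weight_le[of k] range k by (intro sum_mono) auto
      also have "\<dots> = 3 * ?d * crest ?l * exp (- ?l / 2) * real (card (?C \<omega>))" by simp
      also have "\<dots> \<le> 3 * ?d * crest ?l * exp (- ?l / 2) * (real K * x)"
      proof (intro mult_left_mono)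
        have "card (?C \<omega>) \<le> K * max_component n \<omega>"
          using card_cluster_le_max_component[OF n, of A U \<omega>] AU k by auto
        then show "real (card (?C \<omega>)) \<le> real K * x"
          unfolding x_def by (metis of_nat_le_iff of_nat_mult)
      qed (use sub_delta crest_pos[OF l] in auto)
      \<comment> \<open>The factor \<open>K\<close> from the number of roots cancels the
        \<open>K\<close> from the number of components that may share the cluster. The final
        constant is \<open>13056 = 16 * 3 * 8 * 34\<close>.\<close>
      finally have "real K * ?d * (1 / 16) < real K * ?d * (3 * crest ?l * exp (- ?l / 2) * x)"
        using WD by (simp add: \<Lambda>_def algebra_simps)
      then have "1 / 16 < 3 * crest ?l * exp (- ?l / 2) * x"
        using mult_less_cancel_left_pos[of "real K * ?d"] K sub_delta by simp
      moreover have "exp (- ?l / 2) = sqrt (real k) / sqrt (real n)"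
      proof -
        have "exp (?l / 2) = sqrt (real n) / sqrt (real k)"
        proof (rule power2_eq_imp_eq)
          have "(exp (?l / 2))\<^sup>2 = exp ?l" by (simp add: power2_eq_square exp_add[symmetric])
          then show "(exp (?l / 2))\<^sup>2 = (sqrt (real n) / sqrt (real k))\<^sup>2"
            using exp_lscale[of k n] k by (simp add: power_divide)
        qed auto
        then show ?thesis by (simp add: exp_minus)
      qed
      moreover have "crest ?l \<le> 8 / a\<^sup>2 * (34 * sqrt (real k) * (S (ln (real n)) + 1))"
        unfolding crest_def using S_lscale_le[OF k] by (intro mult_left_mono) auto
      ultimately have "1 / 16 < 3 * (8 / a\<^sup>2 * (34 * sqrt (real k) * (S (ln (real n)) + 1))) * (sqrt (real k) / sqrt (real n)) * x"
        by (smt (verit, best) divide_nonneg_nonneg mult_right_mono of_nat_0_le_iff real_sqrt_ge_zero x_def mult_left_mono)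
      also have "\<dots> = 816 / a\<^sup>2 * real k * (S (ln (real n)) + 1) / sqrt (real n) * x"
        by simp
      finally have "a\<^sup>2 * sqrt (real n) < 13056 * real k * (S (ln (real n)) + 1) * x"
        using a k by (simp add: field_simps)
      then have "a\<^sup>2 / (13056 * real k) * (sqrt (real n) / (S (ln (real n)) + 1)) < x"
      proof -
        assume *: "a\<^sup>2 * sqrt (real n) < 13056 * real k * (S (ln (real n)) + 1) * x"
        have "a\<^sup>2 / (13056 * real k) * (sqrt (real n) / (S (ln (real n)) + 1)) =
            a\<^sup>2 * sqrt (real n) / (13056 * real k * (S (ln (real n)) + 1))"
          by (simp only: times_divide_times_eq)
        moreover have "0 < 13056 * real k * (S (ln (real n)) + 1)"
          using k S by (intro mult_pos_pos) auto
        ultimately show ?thesis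
          using * by (simp only: pos_divide_less_eq) (simp only: mult.commute)
      qed
      then show False using bad by (simp add: x_def)
    qed
  qed
  then have "?P (- ?good) \<le> ?P ({\<omega>. W \<omega> + D \<omega> \<le> \<Lambda> / 2} \<union> {\<omega>. \<Lambda> / 4 \<le> D \<omega>})"
    by (intro measure_pmf.finite_measure_mono) auto
  also have "\<dots> \<le> ?P {\<omega>. W \<omega> + D \<omega> \<le> \<Lambda> / 2} + ?P {\<omega>. \<Lambda> / 4 \<le> D \<omega>}"
    by (intro measure_Un_le) auto
  finally have "?P (- ?good) \<le> exp (- (\<Lambda> / 2)) + 16 * loss_const a * 2 ^ K / (real k * real K * ?d)"
    using P1 P2 by linarith
  moreover have "?P (- ?good) = 1 - ?P ?good"
    using measure_pmf.prob_compl[of ?good "edges \<gamma> \<beta> n"] by (simp add: Compl_eq_Diff_UNIV)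
  ultimately show ?thesis by (simp add: \<Lambda>_def)
qed

end

subsection \<open>Hyperbolic and trigonometric waves\<close>

lemma sinh_ge_self: "x \<le> sinh x" if "0 \<le> x" for x :: real
proof -
  have "sinh 0 - 0 \<le> sinh x - x"
  proof (rule DERIV_nonneg_imp_nondecreasing[of 0 x "\<lambda>x. sinh x - x"])
    fix y :: real
    have "((\<lambda>x. sinh x - x) has_real_derivative (cosh y - 1)) (at y)"
      by (auto intro!: derivative_eq_intros)
    moreover have "0 \<le> cosh y - 1" using cosh_real_ge_1[of y] by simp
    ultimately show "\<exists>d. ((\<lambda>x. sinh x - x) has_real_derivative d) (at y) \<and> 0 \<le> d" by blast
  qed fact
  then show ?thesis by simp
qed

lemma sinh_le_mult_cosh: "sinh x \<le> x * cosh x" if "0 \<le> x" for x :: real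
proof -
  have "0 * cosh 0 - sinh 0 \<le> x * cosh x - sinh x"
  proof (rule DERIV_nonneg_imp_nondecreasing[of 0 x "\<lambda>x. x * cosh x - sinh x"])
    fix y :: real assume "0 \<le> y"
    have "((\<lambda>x. x * cosh x - sinh x) has_real_derivative (y * sinh y)) (at y)"
      by (auto intro!: derivative_eq_intros)
    moreover have "0 \<le> y * sinh y" using \<open>0 \<le> y\<close> by simp
    ultimately show "\<exists>d. ((\<lambda>x. x * cosh x - sinh x) has_real_derivative d) (at y) \<and> 0 \<le> d" by blast
  qed fact
  then show ?thesis by simp
qed

lemma half_le_sin: "x / 2 \<le> sin x" if "0 \<le> x" "x \<le> pi / 3" for x :: real
proof -
  have "sin 0 - 0 / 2 \<le> sin x - x / 2"
  proof (rule DERIV_nonneg_imp_nondecreasing[of 0 x "\<lambda>x. sin x - x / 2"])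
    fix y :: real assume y: "0 \<le> y" "y \<le> x"
    have "((\<lambda>x. sin x - x / 2) has_real_derivative (cos y - 1 / 2)) (at y)"
      by (auto intro!: derivative_eq_intros)
    moreover have "cos (pi / 3) \<le> cos y"
      using that y by (intro cos_monotone_0_pi_le) auto
    then have "0 \<le> cos y - 1 / 2" by (simp add: cos_60)
    ultimately show "\<exists>d. ((\<lambda>x. sin x - x / 2) has_real_derivative d) (at y) \<and> 0 \<le> d" by blast
  qed fact
  then show ?thesis by simp
qed

lemma le_exp_scaled: "z \<le> c * exp (z / c)" if "0 < c" for z c :: real
  using exp_ge_add_one_self[of "z / c"] that by (simp add: field_simps)

text \<open>As \<open>\<theta> \<le> 1/32\<close>, the rate 1/16 can be shared equally by
  \<open>z \<le> 32 * exp (z / 32)\<close> and \<open>cosh (\<theta> * z)\<close>. There is no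
  positive zero, so \<open>L\<close> is arbitrary.\<close>

lemma wave_sinh:
  assumes a: "0 < a" "a \<le> 1/2" and \<theta>: "0 < \<theta>" "\<theta> \<le> a / 16"
  shows "wave a (\<theta>\<^sup>2) (\<lambda>z. sinh (\<theta> * z) / \<theta>) (\<lambda>z. cosh (\<theta> * z)) L"
proof
  show "0 < a" "a \<le> 1/2" by fact+
  have "\<theta>\<^sup>2 \<le> (a / 8)\<^sup>2" using \<theta> a by (intro power_mono) auto
  then show "\<bar>\<theta>\<^sup>2\<bar> \<le> a\<^sup>2 / 64" by (simp add: power_divide)
  show "((\<lambda>z. sinh (\<theta> * z) / \<theta>) has_real_derivative cosh (\<theta> * z)) (at z)" for z
    using \<theta> by (auto intro!: derivative_eq_intros)
  show "((\<lambda>z. cosh (\<theta> * z)) has_real_derivative \<theta>\<^sup>2 * (sinh (\<theta> * z) / \<theta>)) (at z)" for z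
    using \<theta> by (auto intro!: derivative_eq_intros simp: power2_eq_square)
  show "sinh (\<theta> * (x + y)) / \<theta> = sinh (\<theta> * x) / \<theta> * cosh (\<theta> * y) + cosh (\<theta> * x) * (sinh (\<theta> * y) / \<theta>)"
    "sinh (\<theta> * (x - y)) / \<theta> = sinh (\<theta> * x) / \<theta> * cosh (\<theta> * y) - cosh (\<theta> * x) * (sinh (\<theta> * y) / \<theta>)" for x y
    using \<theta> by (simp_all add: distrib_left right_diff_distrib sinh_add sinh_diff add_divide_distrib diff_divide_distrib)
  fix z :: real assume z: "0 \<le> z"
  have tz: "0 \<le> \<theta> * z" using \<theta> z by simp
  have tz': "\<theta> * z \<le> z / 32" using \<theta> a z mult_right_mono[of \<theta> "1/32" z] by simp
  show "0 \<le> sinh (\<theta> * z) / \<theta>" using \<theta> tz by simp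
  have cosh_le: "cosh (\<theta> * z) \<le> exp (z / 32)"
  proof -
    have "cosh (\<theta> * z) \<le> exp (\<theta> * z)"
      using tz by (simp add: cosh_def)
    also have "\<dots> \<le> exp (z / 32)" using tz' by simp
    finally show ?thesis .
  qed
  also have "\<dots> \<le> exp (z / 16)" using z by simp
  finally show "\<bar>cosh (\<theta> * z)\<bar> \<le> exp (z / 16)" by simp
  have "sinh (\<theta> * z) / \<theta> \<le> z * cosh (\<theta> * z)"
    using sinh_le_mult_cosh[OF tz] \<theta> by (simp add: divide_le_eq ac_simps)
  also have "\<dots> \<le> (32 * exp (z / 32)) * exp (z / 32)"
    using cosh_le le_exp_scaled[of 32 z] z by (intro mult_mono) auto
  also have "\<dots> = 32 * exp (z / 16)" by (simp add: exp_add[symmetric])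
  finally show "sinh (\<theta> * z) / \<theta> \<le> 32 * exp (z / 16)" .
  show "- 1 \<le> cosh (\<theta> * z)" using cosh_real_ge_1[of "\<theta> * z"] by linarith
  have "cosh (\<theta> * z) - sinh (\<theta> * z) \<le> 1"
    using tz by (simp add: cosh_minus_sinh)
  moreover have "sinh (\<theta> * z) \<le> a / 8 * (sinh (\<theta> * z) / \<theta>)"
    using \<theta> a tz mult_right_mono[of \<theta> "a / 8" "sinh (\<theta> * z)"] by (simp add: field_simps)
  ultimately show "cosh (\<theta> * z) \<le> 1 + a / 8 * (sinh (\<theta> * z) / \<theta>)" by linarith
  have "z / 2 \<le> sinh (\<theta> * z) / \<theta>"
  proof -
    have "\<theta> * z \<le> 2 * sinh (\<theta> * z)" using sinh_ge_self[OF tz] tz by linarith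
    then show ?thesis using \<theta> by (simp add: field_simps)
  qed
  moreover have "1/2 \<le> cosh (\<theta> * z)" using cosh_real_ge_1[of "\<theta> * z"] by linarith
  ultimately show "1/2 \<le> cosh (\<theta> * z) \<and> z / 2 \<le> sinh (\<theta> * z) / \<theta> \<or> 100 / a \<le> sinh (\<theta> * z) / \<theta>"
    by simp
qed auto

text \<open>Up to the angle \<open>pi / 3\<close> the wave is close to its tangent. Beyond it
  \<open>sin (\<theta> * z)\<close> stays above the smaller of its values at \<open>pi / 3\<close>
  and \<open>x\<close>, and division by the small \<open>\<theta>\<close> gives the required
  \<open>100 / a\<close>.\<close>

lemma wave_sin:
  assumes a: "0 < a" "a \<le> 1/2" and \<theta>: "0 < \<theta>" "\<theta> \<le> a / 16"
    and x: "\<theta> * L \<le> x" "x < pi" and small: "100 * \<theta> \<le> a * min (sin (pi / 3)) (sin x)"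
  shows "wave a (- \<theta>\<^sup>2) (\<lambda>z. sin (\<theta> * z) / \<theta>) (\<lambda>z. cos (\<theta> * z)) L"
proof
  show "0 < a" "a \<le> 1/2" by fact+
  have "\<theta>\<^sup>2 \<le> (a / 8)\<^sup>2" using \<theta> a by (intro power_mono) auto
  then show "\<bar>- \<theta>\<^sup>2\<bar> \<le> a\<^sup>2 / 64" by (simp add: power_divide)
  show "((\<lambda>z. sin (\<theta> * z) / \<theta>) has_real_derivative cos (\<theta> * z)) (at z)" for z
    using \<theta> by (auto intro!: derivative_eq_intros)
  show "((\<lambda>z. cos (\<theta> * z)) has_real_derivative - \<theta>\<^sup>2 * (sin (\<theta> * z) / \<theta>)) (at z)" for z
    using \<theta> by (auto intro!: derivative_eq_intros simp: power2_eq_square)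
  show "sin (\<theta> * (x + y)) / \<theta> = sin (\<theta> * x) / \<theta> * cos (\<theta> * y) + cos (\<theta> * x) * (sin (\<theta> * y) / \<theta>)"
    "sin (\<theta> * (x - y)) / \<theta> = sin (\<theta> * x) / \<theta> * cos (\<theta> * y) - cos (\<theta> * x) * (sin (\<theta> * y) / \<theta>)" for x y
    using \<theta> by (simp_all add: distrib_left right_diff_distrib sin_add sin_diff add_divide_distrib diff_divide_distrib)
  fix z :: real assume z: "0 \<le> z" "z \<le> L"
  have tz: "0 \<le> \<theta> * z" using \<theta> z by simp
  have tz': "\<theta> * z \<le> x" using x(1) mult_left_mono[of z L \<theta>] \<theta> z by linarith
  have sin0: "0 \<le> sin (\<theta> * z)" using tz tz' x by (intro sin_ge_zero) auto
  show S0: "0 \<le> sin (\<theta> * z) / \<theta>" using \<theta> sin0 by simp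
  have "\<bar>cos (\<theta> * z)\<bar> \<le> 1" "1 \<le> exp (z / 16)" using z by auto
  then show "\<bar>cos (\<theta> * z)\<bar> \<le> exp (z / 16)" by linarith
  have "sin (\<theta> * z) / \<theta> \<le> z"
    using sin_x_le_x[OF tz] \<theta> by (simp add: divide_le_eq ac_simps)
  also have "\<dots> \<le> 32 * exp (z / 32)" by (rule le_exp_scaled) simp
  also have "\<dots> \<le> 32 * exp (z / 16)" using z by simp
  finally show "sin (\<theta> * z) / \<theta> \<le> 32 * exp (z / 16)" .
  show "- 1 \<le> cos (\<theta> * z)" by simp
  have "0 \<le> a / 8 * (sin (\<theta> * z) / \<theta>)" using a S0 by (intro mult_nonneg_nonneg) auto
  then show "cos (\<theta> * z) \<le> 1 + a / 8 * (sin (\<theta> * z) / \<theta>)"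
    using cos_le_one[of "\<theta> * z"] by linarith
  show "1/2 \<le> cos (\<theta> * z) \<and> z / 2 \<le> sin (\<theta> * z) / \<theta> \<or> 100 / a \<le> sin (\<theta> * z) / \<theta>"
  proof (cases "\<theta> * z \<le> pi / 3")
    case True
    have "cos (pi / 3) \<le> cos (\<theta> * z)" using True tz by (intro cos_monotone_0_pi_le) auto
    moreover have "z / 2 \<le> sin (\<theta> * z) / \<theta>"
      using half_le_sin[OF tz True] \<theta> z by (simp add: field_simps)
    ultimately show ?thesis by (simp add: cos_60)
  next
    case False
    have "min (sin (pi / 3)) (sin x) \<le> sin (\<theta> * z)"
    proof (cases "\<theta> * z \<le> pi / 2")
      case True
      have "sin (pi / 3) \<le> sin (\<theta> * z)" using False True by (intro sin_monotone_2pi_le) auto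
      then show ?thesis by simp
    next
      case gt: False
      have "sin (pi - x) \<le> sin (pi - \<theta> * z)" using gt x tz' by (intro sin_monotone_2pi_le) auto
      then show ?thesis by simp
    qed
    then have "100 * \<theta> \<le> a * sin (\<theta> * z)"
      using small a by (meson mult_left_mono order.trans less_imp_le)
    then show ?thesis using a \<theta> by (simp add: field_simps)
  qed
qed auto

lemma wave_graph_sinh:
  assumes "0 \<le> \<gamma>" "\<gamma> < 1/2" "1 \<le> n" "0 < \<theta>" "\<theta> \<le> (1/2 - \<gamma>) / 16"
  shows "wave_graph \<gamma> (\<theta>\<^sup>2) (\<lambda>z. sinh (\<theta> * z) / \<theta>) (\<lambda>z. cosh (\<theta> * z)) n"
  unfolding wave_graph_def wave_graph_axioms_def using assms by (auto intro!: wave_sinh)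

lemma wave_graph_sin:
  assumes "0 \<le> \<gamma>" "\<gamma> < 1/2" "1 \<le> n" "0 < \<theta>" "\<theta> \<le> (1/2 - \<gamma>) / 16"
    and "\<theta> * ln (real n) \<le> x" "x < pi" "100 * \<theta> \<le> (1/2 - \<gamma>) * min (sin (pi / 3)) (sin x)"
  shows "wave_graph \<gamma> (- \<theta>\<^sup>2) (\<lambda>z. sin (\<theta> * z) / \<theta>) (\<lambda>z. cos (\<theta> * z)) n"
  unfolding wave_graph_def wave_graph_axioms_def using assms by (auto intro!: wave_sin[where x = x])

subsection \<open>Tightness\<close>

definition wave_param :: "real \<Rightarrow> real \<Rightarrow> real" where
  "wave_param \<gamma> \<mu> = ((1/2 - \<gamma>)\<^sup>2 - \<mu>) / (2 * (1/2 - \<gamma>))"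

definition prob_ge :: "real \<Rightarrow> real \<Rightarrow> nat \<Rightarrow> real \<Rightarrow> real" where
  "prob_ge \<gamma> \<beta> n x = measure (measure_pmf (edges \<gamma> \<beta> n)) {\<omega>. x \<le> real (max_component n \<omega>)}"

lemma prob_ge_antimono: "x \<le> y \<Longrightarrow> prob_ge \<gamma> \<beta> n y \<le> prob_ge \<gamma> \<beta> n x"
  unfolding prob_ge_def by (intro measure_pmf.finite_measure_mono) auto

lemma prob_ge_mono: "0 \<le> \<beta> \<Longrightarrow> \<beta> \<le> \<beta>' \<Longrightarrow> 1 \<le> n \<Longrightarrow> prob_ge \<gamma> \<beta> n x \<le> prob_ge \<gamma> \<beta>' n x"
  unfolding prob_ge_def by (rule prob_max_component_mono)

lemma wave_graph_upper:
  assumes "wave_graph \<gamma> \<mu> S C n" "0 < S (ln (real n))" "0 < x"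
  shows "prob_ge \<gamma> (wave_param \<gamma> \<mu>) n x \<le>
    12500 / (super_delta (1/2 - \<gamma>) / 528 * (S (ln (real n)) / sqrt (real n)) * x) ^ 5"
proof -
  interpret wave_graph \<gamma> \<mu> S C n by fact
  show ?thesis
    using max_component_upper[OF assms(3,2)] by (simp add: prob_ge_def wave_param_def \<beta>_def)
qed

lemma wave_param_pos: "wave_graph \<gamma> \<mu> S C n \<Longrightarrow> 0 < wave_param \<gamma> \<mu>"
proof -
  assume "wave_graph \<gamma> \<mu> S C n"
  then interpret wave_graph \<gamma> \<mu> S C n .
  show ?thesis using beta_bounds(3) by (simp add: wave_param_def \<beta>_def)
qed

text \<open>The constants depend on \<gamma> and \<open>\<eta>\<close> only, so the wave may vary
  with \<open>n\<close>. First \<open>K'\<close> is chosen from \<open>\<eta>\<close>, then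
  \<open>k\<close> from \<open>K'\<close> and \<open>\<eta>\<close>, and \<open>n\<close> from
  \<open>2 * k\<close> on.\<close>

lemma wave_graph_lower:
  assumes \<gamma>: "0 \<le> \<gamma>" "\<gamma> < 1/2" and \<eta>: "0 < \<eta>"
  obtains c N where "0 < c" "\<And>n \<mu> S C. N \<le> n \<Longrightarrow> wave_graph \<gamma> \<mu> S C n \<Longrightarrow>
    1 - \<eta> \<le> prob_ge \<gamma> (wave_param \<gamma> \<mu>) n (c * (sqrt (real n) / (S (ln (real n)) + 1)))"
proof -
  define a where "a = 1/2 - \<gamma>"
  have a: "0 < a" using \<gamma> by (simp add: a_def)
  have d: "0 < sub_delta a"
  proof -
    have "0 < sub_bound a" using a by (simp add: sub_bound_def add_pos_pos)
    then show ?thesis by (simp add: sub_delta_def)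
  qed
  obtain K where K: "8 / sub_delta a * ln (2 / \<eta>) + 1 < real K"
    using reals_Archimedean2 by blast
  define K' where "K' = max 1 K"
  have K': "1 \<le> K'" "8 / sub_delta a * ln (2 / \<eta>) \<le> real K'"
    using K by (auto simp: K'_def)
  have "ln (2 / \<eta>) \<le> real K' * sub_delta a / 8"
    using K'(2) d by (simp add: field_simps)
  then have "exp (- (real K' * sub_delta a / 8)) \<le> exp (- ln (2 / \<eta>))" by simp
  also have "\<dots> = \<eta> / 2" using \<eta> by (simp add: exp_minus)
  finally have 1: "exp (- (real K' * sub_delta a / 8)) \<le> \<eta> / 2" .
  define Q where "Q = 16 * loss_const a * 2 ^ K' / (real K' * sub_delta a)"
  obtain k where k: "max (real K') (max (200 * sub_bound a) (2 * Q / \<eta>)) < real k"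
    using reals_Archimedean2 by blast
  then have k': "K' \<le> k" "200 * sub_bound a \<le> real k" "2 * Q / \<eta> < real k" by auto
  have k0: "0 < real k" using k'(1) K' by auto
  have "Q / real k \<le> \<eta> / 2" using k'(3) \<eta> k0 by (simp add: field_simps)
  then have 2: "16 * loss_const a * 2 ^ K' / (real k * real K' * sub_delta a) \<le> \<eta> / 2"
    by (simp add: Q_def ac_simps)
  show ?thesis
  proof (rule that[of "a\<^sup>2 / (13056 * real k)" "2 * k"])
    show "0 < a\<^sup>2 / (13056 * real k)" using a k0 by simp
    fix n \<mu> S C assume kn: "2 * k \<le> n" and "wave_graph \<gamma> \<mu> S C n"
    then interpret wave_graph \<gamma> \<mu> S C n by simp
    have param: "wave_param \<gamma> \<mu> = \<beta>" by (simp add: wave_param_def \<beta>_def)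
    show "1 - \<eta> \<le> prob_ge \<gamma> (wave_param \<gamma> \<mu>) n (a\<^sup>2 / (13056 * real k) * (sqrt (real n) / (S (ln (real n)) + 1)))"
      using max_component_lower[OF K'(1) k'(1) kn] k'(2) 1 2
      unfolding prob_ge_def param a_def[symmetric] by simp
  qed
qed

definition tight_above :: "real \<Rightarrow> (nat \<Rightarrow> real) \<Rightarrow> (nat \<Rightarrow> real) \<Rightarrow> bool" where
  "tight_above \<gamma> \<beta> a \<longleftrightarrow> (\<forall>\<eta>>0. \<exists>K>0. \<forall>\<^sub>F n in sequentially. prob_ge \<gamma> (\<beta> n) n (K * a n) \<le> \<eta>)"

definition tight_below :: "real \<Rightarrow> (nat \<Rightarrow> real) \<Rightarrow> (nat \<Rightarrow> real) \<Rightarrow> bool" where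
  "tight_below \<gamma> \<beta> a \<longleftrightarrow> (\<forall>\<eta>>0. \<exists>c>0. \<forall>\<^sub>F n in sequentially. 1 - \<eta> \<le> prob_ge \<gamma> (\<beta> n) n (c * a n))"

text \<open>Monotonicity in \<beta> admits any wave with a larger parameter, chosen separately for
  each \<open>n\<close>. The criterion for \<open>tight_below\<close> uses smaller
  parameters.\<close>

lemma tight_aboveI:
  assumes \<gamma>: "0 \<le> \<gamma>" "\<gamma> < 1/2" and c: "0 < c"
    and ev: "\<forall>\<^sub>F n in sequentially. \<exists>\<mu> S C. wave_graph \<gamma> \<mu> S C n \<and> 0 \<le> \<beta> n \<and> \<beta> n \<le> wave_param \<gamma> \<mu> \<and>
      0 < S (ln (real n)) \<and> c * (sqrt (real n) / S (ln (real n))) \<le> a n"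
  shows "tight_above \<gamma> \<beta> a"
  unfolding tight_above_def
proof (intro allI impI)
  fix \<eta> :: real assume \<eta>: "0 < \<eta>"
  define d where "d = super_delta (1/2 - \<gamma>) / 528"
  have d: "0 < d"
  proof -
    have "0 < 36 + 1 / (1/2 - \<gamma>)" using \<gamma> by (intro add_pos_pos) auto
    then show ?thesis by (simp add: d_def super_delta_def)
  qed
  obtain K :: nat where K: "max 1 (12500 / ((d * c) ^ 5 * \<eta>)) < real K"
    using reals_Archimedean2 by blast
  have K1: "0 < real K" "1 \<le> real K" using K by auto
  have "12500 / (d * c * real K) ^ 5 \<le> \<eta>"
  proof -
    have "12500 / ((d * c) ^ 5 * \<eta>) \<le> real K" using K by simp
    also have "\<dots> \<le> real K ^ 5" using K1 by (intro self_le_power) auto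
    finally show ?thesis using d c \<eta> K1 by (simp add: field_simps power_mult_distrib)
  qed
  moreover have "\<forall>\<^sub>F n in sequentially. prob_ge \<gamma> (\<beta> n) n (real K * a n) \<le> 12500 / (d * c * real K) ^ 5"
    using ev
  proof eventually_elim
    case (elim n)
    then obtain \<mu> S C where wave: "wave_graph \<gamma> \<mu> S C n" and b: "0 \<le> \<beta> n" "\<beta> n \<le> wave_param \<gamma> \<mu>"
      and S: "0 < S (ln (real n))" and le: "c * (sqrt (real n) / S (ln (real n))) \<le> a n" by blast
    have n: "1 \<le> n" using wave by (simp add: wave_graph_def wave_graph_axioms_def)
    define x where "x = real K * (c * (sqrt (real n) / S (ln (real n))))"
    have x: "0 < x" using K1 c S n by (simp add: x_def)
    have "prob_ge \<gamma> (\<beta> n) n (real K * a n) \<le> prob_ge \<gamma> (\<beta> n) n x"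
      unfolding x_def using le K1 by (intro prob_ge_antimono mult_left_mono) auto
    also have "\<dots> \<le> prob_ge \<gamma> (wave_param \<gamma> \<mu>) n x"
      using b n by (rule prob_ge_mono)
    also have "\<dots> \<le> 12500 / (d * (S (ln (real n)) / sqrt (real n)) * x) ^ 5"
      using wave_graph_upper[OF wave S x] by (simp add: d_def)
    also have "d * (S (ln (real n)) / sqrt (real n)) * x = d * c * real K"
      using S n by (simp add: x_def)
    finally show ?case .
  qed
  ultimately show "\<exists>K>0. \<forall>\<^sub>F n in sequentially. prob_ge \<gamma> (\<beta> n) n (K * a n) \<le> \<eta>"
    using K1 by (intro exI[of _ "real K"]) (auto elim!: eventually_mono)
qed

lemma tight_belowI:
  assumes \<gamma>: "0 \<le> \<gamma>" "\<gamma> < 1/2" and c: "0 < c"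
    and ev: "\<forall>\<^sub>F n in sequentially. \<exists>\<mu> S C. wave_graph \<gamma> \<mu> S C n \<and> wave_param \<gamma> \<mu> \<le> \<beta> n \<and>
      c * a n \<le> sqrt (real n) / (S (ln (real n)) + 1)"
  shows "tight_below \<gamma> \<beta> a"
  unfolding tight_below_def
proof (intro allI impI)
  fix \<eta> :: real assume \<eta>: "0 < \<eta>"
  obtain c' N where c': "0 < c'" and N: "\<And>n \<mu> S C. N \<le> n \<Longrightarrow> wave_graph \<gamma> \<mu> S C n \<Longrightarrow>
    1 - \<eta> \<le> prob_ge \<gamma> (wave_param \<gamma> \<mu>) n (c' * (sqrt (real n) / (S (ln (real n)) + 1)))"
    using wave_graph_lower[OF \<gamma> \<eta>] by blast
  have "\<forall>\<^sub>F n in sequentially. 1 - \<eta> \<le> prob_ge \<gamma> (\<beta> n) n (c' * c * a n)"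
    using ev eventually_ge_at_top[of N]
  proof eventually_elim
    case (elim n)
    then obtain \<mu> S C where wave: "wave_graph \<gamma> \<mu> S C n" and b: "wave_param \<gamma> \<mu> \<le> \<beta> n"
      and le: "c * a n \<le> sqrt (real n) / (S (ln (real n)) + 1)" by blast
    have n: "1 \<le> n" using wave by (simp add: wave_graph_def wave_graph_axioms_def)
    have "1 - \<eta> \<le> prob_ge \<gamma> (wave_param \<gamma> \<mu>) n (c' * (sqrt (real n) / (S (ln (real n)) + 1)))"
      using N elim wave by blast
    also have "\<dots> \<le> prob_ge \<gamma> (wave_param \<gamma> \<mu>) n (c' * (c * a n))"
      using le c' by (intro prob_ge_antimono mult_left_mono) auto
    also have "\<dots> \<le> prob_ge \<gamma> (\<beta> n) n (c' * (c * a n))"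
      using wave_param_pos[OF wave] b n by (intro prob_ge_mono) auto
    finally show ?case by (simp add: mult.assoc)
  qed
  then show "\<exists>c>0. \<forall>\<^sub>F n in sequentially. 1 - \<eta> \<le> prob_ge \<gamma> (\<beta> n) n (c * a n)"
    using c c' by (intro exI[of _ "c' * c"]) auto
qed

text \<open>The infimum in \<open>prob_same_order\<close> runs over all \<open>n\<close> from a
  fixed index on that must not depend on \<open>K\<close>, whereas the tightness bounds hold
  eventually, depending on \<open>\<eta>\<close>. The finitely many remaining \<open>n\<close> are
  settled by the deterministic bounds 1 and \<open>n\<close> for the component size.\<close>

lemma prob_same_order_of_tight:
  assumes above: "tight_above \<gamma> \<beta> a" and below: "tight_below \<gamma> \<beta> a"
    and pos: "\<forall>\<^sub>F n in sequentially. 0 < a n"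
  shows "prob_same_order (\<lambda>n. measure_pmf (growing_graph \<gamma> (\<beta> n) n))
    (\<lambda>n G. real (card (largest_component {1..n} G))) a"
proof -
  let ?p = "\<lambda>K n. measure (measure_pmf (edges \<gamma> (\<beta> n) n))
    {\<omega>. 1 / K \<le> real (max_component n \<omega>) / a n \<and> real (max_component n \<omega>) / a n \<le> K}"
  obtain n\<^sub>0 where n\<^sub>0: "1 \<le> n\<^sub>0" "\<And>n. n\<^sub>0 \<le> n \<Longrightarrow> 0 < a n"
  proof -
    obtain m where "\<And>n. m \<le> n \<Longrightarrow> 0 < a n" using pos by (auto simp: eventually_sequentially)
    then show ?thesis using that[of "max 1 m"] by auto
  qed
  have key: "\<forall>\<^sub>F K in at_top. \<forall>n\<ge>n\<^sub>0. 1 - \<eta> \<le> ?p K n" if \<eta>: "0 < \<eta>" for \<eta>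
  proof -
    obtain K\<^sub>1 where K\<^sub>1: "0 < K\<^sub>1" "\<forall>\<^sub>F n in sequentially. prob_ge \<gamma> (\<beta> n) n (K\<^sub>1 * a n) \<le> \<eta> / 2"
      using above \<eta> unfolding tight_above_def by (meson half_gt_zero)
    obtain c where c: "0 < c" "\<forall>\<^sub>F n in sequentially. 1 - \<eta> / 2 \<le> prob_ge \<gamma> (\<beta> n) n (c * a n)"
      using below \<eta> unfolding tight_below_def by (meson half_gt_zero)
    obtain N where N: "\<And>n. N \<le> n \<Longrightarrow> prob_ge \<gamma> (\<beta> n) n (K\<^sub>1 * a n) \<le> \<eta> / 2"
      "\<And>n. N \<le> n \<Longrightarrow> 1 - \<eta> / 2 \<le> prob_ge \<gamma> (\<beta> n) n (c * a n)"
      using eventually_conj[OF K\<^sub>1(2) c(2)] by (auto simp: eventually_sequentially)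
    \<comment> \<open>For \<open>n \<le> N\<close> the ratio lies between \<open>1 / a n\<close> and
      \<open>n / a n\<close>, which determines the finite part of the maximum.\<close>
    define K\<^sub>0 where "K\<^sub>0 = Max (insert (max K\<^sub>1 (1 / c)) ((\<lambda>n. max (a n) (real n / a n)) ` {n\<^sub>0..N}))"
    have K\<^sub>0: "K\<^sub>1 \<le> K\<^sub>0" "1 / c \<le> K\<^sub>0"
      using Max_ge[of "insert (max K\<^sub>1 (1 / c)) ((\<lambda>n. max (a n) (real n / a n)) ` {n\<^sub>0..N})" "max K\<^sub>1 (1 / c)"]
      by (auto simp: K\<^sub>0_def)
    have K\<^sub>0': "a n \<le> K\<^sub>0" "real n / a n \<le> K\<^sub>0" if "n\<^sub>0 \<le> n" "n \<le> N" for n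
      using Max_ge[of "insert (max K\<^sub>1 (1 / c)) ((\<lambda>n. max (a n) (real n / a n)) ` {n\<^sub>0..N})" "max (a n) (real n / a n)"] that
      by (auto simp: K\<^sub>0_def)
    have K\<^sub>0_pos: "0 < K\<^sub>0" using K\<^sub>0 K\<^sub>1 by linarith
    have "1 - \<eta> \<le> ?p K n" if K: "K\<^sub>0 \<le> K" and n: "n\<^sub>0 \<le> n" for K n
    proof (cases "n \<le> N")
      case True
      have "1 / K \<le> real (max_component n \<omega>) / a n \<and> real (max_component n \<omega>) / a n \<le> K" for \<omega>
      proof
        have x: "1 \<le> real (max_component n \<omega>)" "real (max_component n \<omega>) \<le> real n"
          using max_component_pos[of n \<omega>] max_component_le[of n \<omega>] n n\<^sub>0 by auto
        have an: "0 < a n" "a n \<le> K" using n\<^sub>0 n K\<^sub>0'[OF n True] K by auto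
        have "1 / K \<le> 1 / a n" using an by (intro divide_left_mono) auto
        also have "\<dots> \<le> real (max_component n \<omega>) / a n" using x an by (intro divide_right_mono) auto
        finally show "1 / K \<le> real (max_component n \<omega>) / a n" .
        have "real (max_component n \<omega>) / a n \<le> real n / a n" using x an by (intro divide_right_mono) auto
        then show "real (max_component n \<omega>) / a n \<le> K" using K\<^sub>0'(2)[OF n True] K by linarith
      qed
      then show ?thesis using \<eta> by simp
    next
      case False
      let ?P = "measure_pmf.prob (edges \<gamma> (\<beta> n) n)"
      have an: "0 < a n" using n\<^sub>0 n by auto
      have "{\<omega>. c * a n \<le> real (max_component n \<omega>)} \<subseteq>
        {\<omega>. 1 / K \<le> real (max_component n \<omega>) / a n \<and> real (max_component n \<omega>) / a n \<le> K} \<union>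
        {\<omega>. K\<^sub>1 * a n \<le> real (max_component n \<omega>)}"
      proof
        fix \<omega> assume \<omega>: "\<omega> \<in> {\<omega>. c * a n \<le> real (max_component n \<omega>)}"
        define y where "y = real (max_component n \<omega>) / a n"
        have x: "real (max_component n \<omega>) = y * a n" using an by (simp add: y_def)
        have "c \<le> y" using \<omega> an unfolding mem_Collect_eq x by simp
        moreover have "1 / K \<le> c"
        proof -
          have "1 / c \<le> K" "0 < K" using K\<^sub>0 K K\<^sub>0_pos by auto
          then show ?thesis using c by (simp add: field_simps)
        qed
        moreover have "y \<le> K \<or> K\<^sub>1 \<le> y" using K\<^sub>0(1) K by linarith
        ultimately show "\<omega> \<in> {\<omega>. 1 / K \<le> real (max_component n \<omega>) / a n \<and> real (max_component n \<omega>) / a n \<le> K} \<union>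
            {\<omega>. K\<^sub>1 * a n \<le> real (max_component n \<omega>)}"
          using an unfolding Un_iff mem_Collect_eq x by auto
      qed
      then have "?P {\<omega>. c * a n \<le> real (max_component n \<omega>)} \<le>
        ?P ({\<omega>. 1 / K \<le> real (max_component n \<omega>) / a n \<and> real (max_component n \<omega>) / a n \<le> K} \<union>
        {\<omega>. K\<^sub>1 * a n \<le> real (max_component n \<omega>)})"
        by (intro measure_pmf.finite_measure_mono) auto
      also have "\<dots> \<le> ?p K n + ?P {\<omega>. K\<^sub>1 * a n \<le> real (max_component n \<omega>)}"
        by (intro measure_Un_le) auto
      finally show ?thesis
        using N[of n] False unfolding prob_ge_def by simp
    qed
    then show ?thesis
      unfolding eventually_at_top_linorder by blast
  qed
  have "((\<lambda>K. INF n\<in>{n\<^sub>0..}. ?p K n) \<longlongrightarrow> 1) at_top"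
  proof (rule tendstoI)
    fix \<eta> :: real assume \<eta>: "0 < \<eta>"
    have "\<forall>\<^sub>F K in at_top. \<forall>n\<ge>n\<^sub>0. 1 - \<eta> / 2 \<le> ?p K n" using key[of "\<eta> / 2"] \<eta> by simp
    then show "\<forall>\<^sub>F K in at_top. dist (INF n\<in>{n\<^sub>0..}. ?p K n) 1 < \<eta>"
    proof eventually_elim
      case (elim K)
      have "1 - \<eta> / 2 \<le> (INF n\<in>{n\<^sub>0..}. ?p K n)"
        using elim by (intro cINF_greatest) auto
      moreover have "(INF n\<in>{n\<^sub>0..}. ?p K n) \<le> ?p K n\<^sub>0"
        by (rule cINF_lower) (auto intro!: bdd_belowI[of _ 0])
      then have "(INF n\<in>{n\<^sub>0..}. ?p K n) \<le> 1"
        using measure_pmf.prob_le_1 order.trans by blast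
      ultimately show ?case using \<eta> by (simp add: dist_real_def)
    qed
  qed
  then show ?thesis
    unfolding prob_same_order_def
    by (intro exI[of _ n\<^sub>0]) (simp only: prob_growing_graph[of _ _ _ "\<lambda>x. 1 / K \<le> real x / a n \<and> real x / a n \<le> K" for K n])
qed

section \<open>The critical window\<close>

lemma square_root_below_pi:
  assumes "0 < y" "y < pi\<^sup>2"
  obtains x where "0 < x" "x < pi" "x\<^sup>2 = y"
proof
  show "0 < sqrt y" "(sqrt y)\<^sup>2 = y" using assms by auto
  have "sqrt y < sqrt (pi\<^sup>2)" using assms by (intro real_sqrt_less_mono)
  then show "sqrt y < pi" by simp
qed

lemma eventually_inverse_ln_le:
  fixes x \<delta> :: real
  assumes "0 < \<delta>"
  shows "\<forall>\<^sub>F n in sequentially. x / ln (real n) \<le> \<delta>"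
proof -
  have "((\<lambda>n. x / ln (real n)) \<longlongrightarrow> 0) sequentially"
    by (intro tendsto_divide_0[OF tendsto_const] filterlim_at_top_imp_at_infinity
        filterlim_compose[OF ln_at_top] filterlim_real_sequentially)
  from order_tendstoD(2)[OF this assms] show ?thesis
    by (rule eventually_mono) simp
qed

lemma eventually_ln_ge: "\<forall>\<^sub>F n in sequentially. y \<le> ln (real n)"
  using filterlim_compose[OF ln_at_top filterlim_real_sequentially] by (auto simp: filterlim_at_top)

text \<open>With \<open>\<theta> = x / ln n\<close> the phase at the right end is \<open>x\<close>,
  so \<open>S (ln n) = sin x * ln n / x\<close> is of order \<open>ln n\<close>, while
  \<open>\<theta>\<close> tends to 0 and meets every smallness condition of
  \<open>wave_sin\<close>.\<close>

lemma eventually_wave_sin: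
  assumes \<gamma>: "0 \<le> \<gamma>" "\<gamma> < 1/2" and x: "0 < x" "x < pi"
  shows "\<forall>\<^sub>F n in sequentially. wave_graph \<gamma> (- (x / ln (real n))\<^sup>2)
    (\<lambda>z. sin (x / ln (real n) * z) / (x / ln (real n))) (\<lambda>z. cos (x / ln (real n) * z)) n"
proof -
  define s where "s = (1/2 - \<gamma>) * min (sin (pi / 3)) (sin x)"
  have s: "0 < s" using \<gamma> x by (auto simp: s_def sin_60 intro!: mult_pos_pos sin_gt_zero)
  have "0 < (1/2 - \<gamma>) / 16" "0 < s / 100" using \<gamma> s by auto
  from this[THEN eventually_inverse_ln_le[of _ x]] eventually_ln_ge[of 1] eventually_ge_at_top[of 1]
  show ?thesis
  proof eventually_elim
    case (elim n)
    have L: "0 < ln (real n)" using elim(3) by linarith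
    then have "0 < x / ln (real n)" using x by simp
    moreover have "100 * (x / ln (real n)) \<le> s" using elim(2) by linarith
    ultimately show ?case
      unfolding s_def using elim \<gamma> x L by (intro wave_graph_sin[where x = x]) simp_all
  qed
qed

lemma eventually_wave_sinh:
  assumes \<gamma>: "0 \<le> \<gamma>" "\<gamma> < 1/2" and x: "0 < x"
  shows "\<forall>\<^sub>F n in sequentially. wave_graph \<gamma> ((x / ln (real n))\<^sup>2)
    (\<lambda>z. sinh (x / ln (real n) * z) / (x / ln (real n))) (\<lambda>z. cosh (x / ln (real n) * z)) n"
proof -
  have "0 < (1/2 - \<gamma>) / 16" using \<gamma> by auto
  from eventually_inverse_ln_le[OF this, of x] eventually_ln_ge[of 1] eventually_ge_at_top[of 1]
  show ?thesis
  proof eventually_elim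
    case (elim n)
    then have "0 < x / ln (real n)" using x by (intro divide_pos_pos) linarith+
    then show ?case
      using elim \<gamma> by (intro wave_graph_sinh) auto
  qed
qed

text \<open>This is \<open>- \<mu> * (ln n)\<^sup>2\<close> for the \<open>\<mu>\<close> that
  belongs to \<open>\<beta> n\<close>; \<alpha> is its limit.\<close>

definition offset :: "real \<Rightarrow> (nat \<Rightarrow> real) \<Rightarrow> nat \<Rightarrow> real" where
  "offset \<gamma> \<beta> n = 4 * beta_crit \<gamma> * (\<beta> n - beta_crit \<gamma>) * (ln (real n))\<^sup>2"

lemma wave_param_le_iff:
  assumes "\<gamma> < 1/2" "0 < ln (real n)"
  shows "wave_param \<gamma> (y / (ln (real n))\<^sup>2) \<le> \<beta> n \<longleftrightarrow> - y \<le> offset \<gamma> \<beta> n"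
    and "\<beta> n \<le> wave_param \<gamma> (y / (ln (real n))\<^sup>2) \<longleftrightarrow> offset \<gamma> \<beta> n \<le> - y"
proof -
  define a where "a = 1/2 - \<gamma>"
  define M where "M = (ln (real n))\<^sup>2"
  have pos: "0 < a" "0 < M" using assms by (auto simp: a_def M_def)
  have bc: "beta_crit \<gamma> = a / 2" by (simp add: beta_crit_def a_def)
  have eq: "2 * a * M * (\<beta> n - wave_param \<gamma> (y / M)) = offset \<gamma> \<beta> n + y"
    unfolding wave_param_def offset_def bc a_def[symmetric] M_def[symmetric]
    using pos by (simp add: field_simps power2_eq_square)
  have "0 \<le> \<beta> n - wave_param \<gamma> (y / M) \<longleftrightarrow> 0 \<le> offset \<gamma> \<beta> n + y"
    "\<beta> n - wave_param \<gamma> (y / M) \<le> 0 \<longleftrightarrow> offset \<gamma> \<beta> n + y \<le> 0"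
    unfolding eq[symmetric] using pos by (auto simp: zero_le_mult_iff mult_le_0_iff)
  then show "wave_param \<gamma> (y / (ln (real n))\<^sup>2) \<le> \<beta> n \<longleftrightarrow> - y \<le> offset \<gamma> \<beta> n"
    "\<beta> n \<le> wave_param \<gamma> (y / (ln (real n))\<^sup>2) \<longleftrightarrow> offset \<gamma> \<beta> n \<le> - y"
    unfolding M_def by linarith+
qed

lemma window_tight_above:
  assumes \<gamma>: "0 \<le> \<gamma>" "\<gamma> < 1/2" and x: "0 < x" "x < pi"
    and \<beta>: "\<forall>\<^sub>F n in sequentially. 0 \<le> \<beta> n" and off: "\<forall>\<^sub>F n in sequentially. offset \<gamma> \<beta> n \<le> x\<^sup>2"
  shows "tight_above \<gamma> \<beta> (\<lambda>n. sqrt (real n) / ln (real n))"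
proof (rule tight_aboveI[OF \<gamma>, where c = "sin x / x"])
  have sinx: "0 < sin x" using x by (rule sin_gt_zero)
  then show "0 < sin x / x" using x by simp
  show "\<forall>\<^sub>F n in sequentially. \<exists>\<mu> S C. wave_graph \<gamma> \<mu> S C n \<and> 0 \<le> \<beta> n \<and> \<beta> n \<le> wave_param \<gamma> \<mu> \<and>
      0 < S (ln (real n)) \<and> sin x / x * (sqrt (real n) / S (ln (real n))) \<le> sqrt (real n) / ln (real n)"
    using eventually_wave_sin[OF \<gamma> x] \<beta> off eventually_ln_ge[of 1]
  proof eventually_elim
    case (elim n)
    have L: "0 < ln (real n)" using elim by simp
    have "\<beta> n \<le> wave_param \<gamma> (- (x / ln (real n))\<^sup>2)"
      using wave_param_le_iff(2)[OF \<gamma>(2) L, of \<beta> "- x\<^sup>2"] elim by (simp add: power_divide)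
    then show ?case
      using elim L sinx x
      by (intro exI[of _ "- (x / ln (real n))\<^sup>2"] exI[of _ "\<lambda>z. sin (x / ln (real n) * z) / (x / ln (real n))"]
          exI[of _ "\<lambda>z. cos (x / ln (real n) * z)"] conjI) auto
  qed
qed

text \<open>Only a smaller parameter is required, so one subcritical wave covers the whole window,
  including \<open>\<beta> n\<close> above the critical value.\<close>

lemma window_tight_below:
  assumes \<gamma>: "0 \<le> \<gamma>" "\<gamma> < 1/2" and x: "0 < x"
    and off: "\<forall>\<^sub>F n in sequentially. - x\<^sup>2 \<le> offset \<gamma> \<beta> n"
  shows "tight_below \<gamma> \<beta> (\<lambda>n. sqrt (real n) / ln (real n))"
proof (rule tight_belowI[OF \<gamma>, where c = "1 / (sinh x / x + 1)"])
  have sh: "0 < sinh x / x" using x by simp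
  then show "0 < 1 / (sinh x / x + 1)" by simp
  show "\<forall>\<^sub>F n in sequentially. \<exists>\<mu> S C. wave_graph \<gamma> \<mu> S C n \<and> wave_param \<gamma> \<mu> \<le> \<beta> n \<and>
      1 / (sinh x / x + 1) * (sqrt (real n) / ln (real n)) \<le> sqrt (real n) / (S (ln (real n)) + 1)"
    using eventually_wave_sinh[OF \<gamma> x] off eventually_ln_ge[of 1]
  proof eventually_elim
    case (elim n)
    have L: "0 < ln (real n)" "1 \<le> ln (real n)" using elim by auto
    define r where "r = sinh x / x"
    have r: "0 < r" using sh by (simp add: r_def)
    have "wave_param \<gamma> ((x / ln (real n))\<^sup>2) \<le> \<beta> n"
      using wave_param_le_iff(1)[OF \<gamma>(2) L(1), of "x\<^sup>2" \<beta>] elim by (simp add: power_divide)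
    moreover have "1 / (sinh x / x + 1) * (sqrt (real n) / ln (real n)) \<le>
        sqrt (real n) / (sinh (x / ln (real n) * ln (real n)) / (x / ln (real n)) + 1)"
    proof -
      have "sinh (x / ln (real n) * ln (real n)) / (x / ln (real n)) = r * ln (real n)"
        using L x by (simp add: r_def)
      moreover have "1 / (r + 1) * (sqrt (real n) / ln (real n)) = sqrt (real n) / ((r + 1) * ln (real n))"
        by simp
      moreover have "sqrt (real n) / ((r + 1) * ln (real n)) \<le> sqrt (real n) / (r * ln (real n) + 1)"
        using r L by (intro divide_left_mono mult_pos_pos add_pos_pos) (auto simp: distrib_right)
      ultimately show ?thesis by (simp only: r_def)
    qed
    ultimately show ?case
      using elim
      by (intro exI[of _ "(x / ln (real n))\<^sup>2"] exI[of _ "\<lambda>z. sinh (x / ln (real n) * z) / (x / ln (real n))"]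
          exI[of _ "\<lambda>z. cosh (x / ln (real n) * z)"] conjI) auto
  qed
qed

text \<open>As \<open>x\<close> approaches \<open>pi\<close> the factor \<open>sin x\<close> in
  \<open>S (ln n)\<close> tends to 0, while \<open>c\<close> does not depend on \<open>x\<close>.
  Hence the multiple of \<open>sqrt n / ln n\<close> reached with high probability can be made
  arbitrarily large.\<close>

lemma supercritical:
  assumes \<gamma>: "0 \<le> \<gamma>" "\<gamma> < 1/2"
    and off: "\<And>y. y < pi\<^sup>2 \<Longrightarrow> \<forall>\<^sub>F n in sequentially. y \<le> offset \<gamma> \<beta> n"
  shows "prob_much_greater (\<lambda>n. measure_pmf (growing_graph \<gamma> (\<beta> n) n))
    (\<lambda>n G. real (card (largest_component {1..n} G))) (\<lambda>n. sqrt (real n) / ln (real n))"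
  unfolding prob_much_greater_def
proof
  fix K :: real
  let ?p = "\<lambda>n. measure (measure_pmf (edges \<gamma> (\<beta> n) n)) {\<omega>. real (max_component n \<omega>) / (sqrt (real n) / ln (real n)) > K}"
  define M where "M = max 1 K"
  have M: "1 \<le> M" "K \<le> M" by (auto simp: M_def)
  have "?p \<longlonglongrightarrow> 1"
  proof (rule tendstoI)
    fix \<eta> :: real assume \<eta>: "0 < \<eta>"
    obtain c N where c: "0 < c" and N: "\<And>n \<mu> S C. N \<le> n \<Longrightarrow> wave_graph \<gamma> \<mu> S C n \<Longrightarrow>
      1 - \<eta> / 2 \<le> prob_ge \<gamma> (wave_param \<gamma> \<mu>) n (c * (sqrt (real n) / (S (ln (real n)) + 1)))"
      using wave_graph_lower[OF \<gamma>, of "\<eta> / 2"] \<eta> by (metis half_gt_zero)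
    \<comment> \<open>The target is \<open>S + 1 \<le> c / (2 * M) * ln n\<close>. Half of it bounds
      \<open>S\<close> through this choice of \<open>x\<close>, the other half absorbs the 1 once
      \<open>ln n \<ge> 4 * M / c\<close>.\<close>
    obtain x where x: "1 < x" "x < pi" "sin x \<le> c / (4 * M)"
    proof -
      define d where "d = min 1 (c / (4 * M))"
      have d: "0 < d" "d \<le> 1" "d \<le> c / (4 * M)" using c M by (auto simp: d_def)
      have "sin (pi - d) \<le> d" using sin_x_le_x[of d] d by simp
      then show ?thesis using that[of "pi - d"] d pi_gt3 by auto
    qed
    have x0: "0 < x" using x by simp
    have "x\<^sup>2 < pi\<^sup>2" using x by (intro power_strict_mono) auto
    from off[OF this] eventually_wave_sin[OF \<gamma> x0 x(2)] eventually_ln_ge[of "max 1 (4 * M / c)"] eventually_ge_at_top[of N]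
    show "\<forall>\<^sub>F n in sequentially. dist (?p n) 1 < \<eta>"
    proof eventually_elim
      case (elim n)
      let ?\<mu> = "- (x / ln (real n))\<^sup>2"
      have L: "0 < ln (real n)" "4 * M / c \<le> ln (real n)" using elim by auto
      have n: "1 \<le> n" using elim(2) by (simp add: wave_graph_def wave_graph_axioms_def)
      have param: "wave_param \<gamma> ?\<mu> \<le> \<beta> n"
        using wave_param_le_iff(1)[OF \<gamma>(2) L(1), of "- x\<^sup>2" \<beta>] elim by (simp add: power_divide)
      define s where "s = sin (x / ln (real n) * ln (real n)) / (x / ln (real n)) + 1"
      have s: "0 < s" "s \<le> c / (2 * M) * ln (real n)"
      proof -
        have eq: "s = sin x * ln (real n) / x + 1" using L x0 by (simp add: s_def)
        have sinx: "0 < sin x" using x x0 by (intro sin_gt_zero) auto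
        then show "0 < s" unfolding eq using L x0 by (intro add_nonneg_pos) auto
        have "sin x * ln (real n) / x \<le> sin x * ln (real n) / 1"
          using sinx L x by (intro divide_left_mono) auto
        also have "\<dots> \<le> c / (4 * M) * ln (real n)"
          using mult_right_mono[OF x(3), of "ln (real n)"] L by simp
        finally have "s \<le> c / (4 * M) * ln (real n) + 1" unfolding eq by simp
        also have "1 \<le> c / (4 * M) * ln (real n)"
          using L c M by (simp add: field_simps)
        finally show "s \<le> c / (2 * M) * ln (real n)" by (simp add: field_simps)
      qed
      have "2 * M * (sqrt (real n) / ln (real n)) \<le> c * (sqrt (real n) / s)"
      proof -
        have "2 * M * s \<le> c * ln (real n)" using s M by (simp add: field_simps)
        then have "2 * M * s * sqrt (real n) \<le> c * ln (real n) * sqrt (real n)"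
          by (intro mult_right_mono) auto
        then show ?thesis using s L by (simp add: field_simps)
      qed
      moreover have "K * (sqrt (real n) / ln (real n)) < 2 * M * (sqrt (real n) / ln (real n))"
        using M L n by (intro mult_strict_right_mono) auto
      ultimately have le: "K * (sqrt (real n) / ln (real n)) < c * (sqrt (real n) / s)" by linarith
      have "1 - \<eta> / 2 \<le> prob_ge \<gamma> (wave_param \<gamma> ?\<mu>) n (c * (sqrt (real n) / s))"
        unfolding s_def using N[OF elim(4,2)] .
      also have "\<dots> \<le> prob_ge \<gamma> (\<beta> n) n (c * (sqrt (real n) / s))"
        using wave_param_pos[OF elim(2)] param n by (intro prob_ge_mono) auto
      also have "\<dots> \<le> ?p n"
        unfolding prob_ge_def
      proof (intro measure_pmf.finite_measure_mono subsetI CollectI)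
        fix \<omega> assume "\<omega> \<in> {\<omega>. c * (sqrt (real n) / s) \<le> real (max_component n \<omega>)}"
        then have "K * (sqrt (real n) / ln (real n)) < real (max_component n \<omega>)" using le by simp
        moreover have "0 < sqrt (real n) / ln (real n)" using L n by (intro divide_pos_pos) auto
        ultimately show "K < real (max_component n \<omega>) / (sqrt (real n) / ln (real n))"
          by (simp only: pos_less_divide_eq)
      qed simp
      finally have "1 - \<eta> / 2 \<le> ?p n" .
      moreover have "?p n \<le> 1" by (rule measure_pmf.prob_le_1)
      ultimately show ?case using \<eta> by (simp add: dist_real_def)
    qed
  qed
  then show "(\<lambda>n. measure (measure_pmf (growing_graph \<gamma> (\<beta> n) n))
      {\<omega> \<in> space (measure_pmf (growing_graph \<gamma> (\<beta> n) n)).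
        K < real (card (largest_component {1..n} \<omega>)) / (sqrt (real n) / ln (real n))}) \<longlonglongrightarrow> 1"
    by (simp only: prob_growing_graph[of _ _ _ "\<lambda>x. K < real x / (sqrt (real n) / ln (real n))" for n])
qed

text \<open>Here the wave has exactly the parameter \<open>\<beta> n\<close>. As the offset stays
  below a negative number, \<open>\<theta> n * ln n\<close> is bounded away from 0, so
  \<open>sinh\<close> is comparable with \<open>exp\<close> there and
  \<open>sqrt n / S (ln n)\<close> has the order of \<open>a n\<close>.\<close>

lemma subcritical:
  fixes \<gamma> :: real and \<beta> :: "nat \<Rightarrow> real"
  defines "\<theta> n \<equiv> sqrt (4 * beta_crit \<gamma> * \<bar>\<beta> n - beta_crit \<gamma>\<bar>)"
    and "a n \<equiv> sqrt \<bar>\<beta> n - beta_crit \<gamma>\<bar> * real n powr (1/2 - sqrt (4 * beta_crit \<gamma> * \<bar>\<beta> n - beta_crit \<gamma>\<bar>))"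
  assumes \<gamma>: "0 \<le> \<gamma>" "\<gamma> < 1/2" and \<beta>: "\<forall>\<^sub>F n in sequentially. 0 \<le> \<beta> n" "\<beta> \<longlonglongrightarrow> beta_crit \<gamma>"
    and off: "\<forall>\<^sub>F n in sequentially. offset \<gamma> \<beta> n \<le> - y" and y: "0 < y"
  shows "tight_above \<gamma> \<beta> a" "tight_below \<gamma> \<beta> a" "\<forall>\<^sub>F n in sequentially. 0 < a n"
proof -
  define b where "b = 1/2 - \<gamma>"
  have b: "0 < b" "beta_crit \<gamma> = b / 2" using \<gamma> by (auto simp: b_def beta_crit_def)
  define \<rho> where "\<rho> = sqrt y"
  have \<rho>: "0 < \<rho>" using y by (simp add: \<rho>_def)
  have "(\<lambda>n. 4 * beta_crit \<gamma> * \<bar>\<beta> n - beta_crit \<gamma>\<bar>) \<longlonglongrightarrow> 4 * beta_crit \<gamma> * \<bar>beta_crit \<gamma> - beta_crit \<gamma>\<bar>"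
    by (intro tendsto_intros \<beta>)
  then have "\<theta> \<longlonglongrightarrow> sqrt (4 * beta_crit \<gamma> * \<bar>beta_crit \<gamma> - beta_crit \<gamma>\<bar>)"
    unfolding \<theta>_def by (intro tendsto_real_sqrt)
  then have "\<forall>\<^sub>F n in sequentially. \<theta> n < b / 16"
    using b by (intro order_tendstoD(2)[of \<theta> 0]) auto
  then have wave: "\<forall>\<^sub>F n in sequentially. wave_graph \<gamma> ((\<theta> n)\<^sup>2) (\<lambda>z. sinh (\<theta> n * z) / \<theta> n) (\<lambda>z. cosh (\<theta> n * z)) n \<and>
      wave_param \<gamma> ((\<theta> n)\<^sup>2) = \<beta> n \<and> 0 < \<theta> n \<and> \<theta> n \<le> 1/2 \<and> \<rho> \<le> \<theta> n * ln (real n) \<and>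
      sqrt (2 * b) * a n = \<theta> n * (sqrt (real n) * exp (- (\<theta> n * ln (real n)))) \<and> 1 \<le> n"
    using off eventually_ln_ge[of 1] eventually_ge_at_top[of 1]
  proof eventually_elim
    case (elim n)
    have L: "0 < ln (real n)" using elim(3) by linarith
    have neg: "\<beta> n - beta_crit \<gamma> < 0"
    proof (rule ccontr)
      assume "\<not> \<beta> n - beta_crit \<gamma> < 0"
      then have "0 \<le> offset \<gamma> \<beta> n" using b by (simp add: offset_def)
      then show False using elim y by linarith
    qed
    have \<theta>2: "(\<theta> n)\<^sup>2 = - (4 * beta_crit \<gamma> * (\<beta> n - beta_crit \<gamma>))"
      using neg b by (simp add: \<theta>_def algebra_simps)
    have \<theta>0: "0 < \<theta> n" using neg b by (simp add: \<theta>_def)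
    have "\<rho>\<^sup>2 \<le> (\<theta> n * ln (real n))\<^sup>2"
      using elim(2) y by (simp add: \<rho>_def power_mult_distrib \<theta>2 offset_def)
    then have \<rho>\<theta>: "\<rho> \<le> \<theta> n * ln (real n)"
      by (rule power2_le_imp_le) (use \<theta>0 L in simp)
    have "wave_param \<gamma> ((\<theta> n)\<^sup>2) = \<beta> n"
      unfolding \<theta>2 wave_param_def b_def[symmetric] b(2) using b by (simp add: field_simps power2_eq_square)
    moreover have "sqrt (2 * b) * a n = \<theta> n * (sqrt (real n) * exp (- (\<theta> n * ln (real n))))"
    proof -
      have "sqrt (2 * b) * sqrt \<bar>\<beta> n - beta_crit \<gamma>\<bar> = \<theta> n"
        unfolding real_sqrt_mult[symmetric] \<theta>_def b(2) by (simp add: ac_simps)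
      moreover have "real n powr (1/2 - \<theta> n) = sqrt (real n) * exp (- (\<theta> n * ln (real n)))"
      proof -
        have "real n powr (1/2 - \<theta> n) = real n powr (1/2) * real n powr (- \<theta> n)"
          by (simp add: powr_add[symmetric])
        then show ?thesis using elim(4) by (simp add: powr_half_sqrt) (simp add: powr_def)
      qed
      ultimately show ?thesis unfolding a_def \<theta>_def[symmetric] by (metis mult.assoc)
    qed
    moreover have "wave_graph \<gamma> ((\<theta> n)\<^sup>2) (\<lambda>z. sinh (\<theta> n * z) / \<theta> n) (\<lambda>z. cosh (\<theta> n * z)) n"
      using \<gamma> elim \<theta>0 by (intro wave_graph_sinh) (auto simp: b_def)
    moreover have "\<theta> n \<le> 1/2" using elim(1) \<gamma> by (simp add: b_def)
    ultimately show ?case using \<theta>0 \<rho>\<theta> elim by blast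
  qed
  show "\<forall>\<^sub>F n in sequentially. 0 < a n"
    using wave
  proof eventually_elim
    case (elim n)
    then have "0 < sqrt (2 * b) * a n" by auto
    then show ?case using b by (simp add: zero_less_mult_iff)
  qed
  \<comment> \<open>From \<open>2 * exp (- v) * sinh v = 1 - exp (- 2 * v)\<close>, which increases
    in \<open>v\<close> and is evaluated at the lower bound \<open>\<rho>\<close>. The factor
    \<open>sqrt (2 * b)\<close> converts \<open>a n\<close> into \<open>\<theta> n\<close>
    units.\<close>
  define c where "c = (1 - exp (- (2 * \<rho>))) / (2 * sqrt (2 * b))"
  have c: "0 < c" using \<rho> b by (simp add: c_def)
  show "tight_above \<gamma> \<beta> a"
  proof (rule tight_aboveI[OF \<gamma> c])
    show "\<forall>\<^sub>F n in sequentially. \<exists>\<mu> S C. wave_graph \<gamma> \<mu> S C n \<and> 0 \<le> \<beta> n \<and> \<beta> n \<le> wave_param \<gamma> \<mu> \<and>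
      0 < S (ln (real n)) \<and> c * (sqrt (real n) / S (ln (real n))) \<le> a n"
      using wave \<beta>(1)
    proof eventually_elim
      case (elim n)
      define v where "v = \<theta> n * ln (real n)"
      have v: "\<rho> \<le> v" "0 < v" using elim \<rho> by (auto simp: v_def)
      have sinh: "0 < sinh v" using v by simp
      have "1 - exp (- (2 * \<rho>)) \<le> 1 - exp (- (2 * v))" using v by simp
      also have "\<dots> = 2 * (exp (- v) * sinh v)"
        by (simp add: sinh_def algebra_simps exp_add[symmetric])
      finally have "c * sqrt (2 * b) \<le> exp (- v) * sinh v"
        using b by (simp add: c_def)
      then have "c * sqrt (2 * b) * (\<theta> n * sqrt (real n)) \<le> exp (- v) * sinh v * (\<theta> n * sqrt (real n))"
        using elim by (intro mult_right_mono) auto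
      also have "\<dots> = sqrt (2 * b) * a n * sinh v"
        using elim by (simp add: v_def)
      finally have "sqrt (2 * b) * (c * (\<theta> n * sqrt (real n))) \<le> sqrt (2 * b) * (a n * sinh v)"
        by (simp add: ac_simps)
      then have "c * (\<theta> n * sqrt (real n)) \<le> a n * sinh v"
        using b by simp
      then have "c * (sqrt (real n) / (sinh v / \<theta> n)) \<le> a n"
        using sinh elim by (simp add: field_simps)
      then show ?case
        using elim sinh
        by (intro exI[of _ "(\<theta> n)\<^sup>2"] exI[of _ "\<lambda>z. sinh (\<theta> n * z) / \<theta> n"] exI[of _ "\<lambda>z. cosh (\<theta> n * z)"] conjI)
          (auto simp: v_def)
    qed
  qed
  show "tight_below \<gamma> \<beta> a"
  proof (rule tight_belowI[OF \<gamma>, where c = "sqrt (2 * b)"])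
    show "0 < sqrt (2 * b)" using b by simp
    show "\<forall>\<^sub>F n in sequentially. \<exists>\<mu> S C. wave_graph \<gamma> \<mu> S C n \<and> wave_param \<gamma> \<mu> \<le> \<beta> n \<and>
      sqrt (2 * b) * a n \<le> sqrt (real n) / (S (ln (real n)) + 1)"
      using wave
    proof eventually_elim
      case (elim n)
      define v where "v = \<theta> n * ln (real n)"
      have v: "0 < v" using elim \<rho> by (auto simp: v_def)
      have \<theta>: "0 < \<theta> n" "\<theta> n \<le> 1/2" using elim by auto
      have "sinh v \<le> exp v / 2"
        by (simp add: sinh_field_def divide_right_mono)
      \<comment> \<open>The summand \<open>\<theta> n\<close> is the 1 in
        \<open>S (ln n) + 1\<close>, with \<open>S (ln n) = sinh v / \<theta> n\<close>, after
        multiplication by \<open>\<theta> n\<close>.\<close>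
      then have "sinh v + \<theta> n \<le> exp v / 2 + 1/2"
        using \<theta> by linarith
      also have "\<dots> \<le> exp v"
      proof -
        have "1 \<le> exp v" using v by simp
        then show ?thesis by linarith
      qed
      finally have le: "sinh v + \<theta> n \<le> exp v" .
      have "sqrt (2 * b) * a n = sqrt (real n) / (exp v / \<theta> n)"
        using elim \<theta> by (simp add: v_def exp_minus field_simps)
      also have "\<dots> \<le> sqrt (real n) / (sinh v / \<theta> n + 1)"
      proof (rule divide_left_mono)
        show "sinh v / \<theta> n + 1 \<le> exp v / \<theta> n"
          using divide_right_mono[OF le, of "\<theta> n"] \<theta> by (simp add: add_divide_distrib)
        have "0 < sinh v / \<theta> n" using v \<theta> by simp
        then show "0 < exp v / \<theta> n * (sinh v / \<theta> n + 1)" using \<theta> by (intro mult_pos_pos) auto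
      qed simp
      finally show ?case
        using elim
        by (intro exI[of _ "(\<theta> n)\<^sup>2"] exI[of _ "\<lambda>z. sinh (\<theta> n * z) / \<theta> n"] exI[of _ "\<lambda>z. cosh (\<theta> n * z)"] conjI)
          (auto simp: v_def)
    qed
  qed
qed

theorem corollary2p4:
  fixes \<gamma> :: real and \<beta> :: "nat \<Rightarrow> real" and \<alpha> :: ereal
  assumes "0 \<le> \<gamma>" and "\<gamma> < 1/2"
    and "\<And>n. n \<ge> 1 \<Longrightarrow> \<beta> n > 0"
    and "\<beta> \<longlonglongrightarrow> beta_crit \<gamma>"
    and "(\<lambda>n. ereal (4 * beta_crit \<gamma> * (\<beta> n - beta_crit \<gamma>) * (ln (real n))\<^sup>2)) \<longlonglongrightarrow> \<alpha>"
  shows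
    "(\<alpha> < 0 \<longrightarrow>
        prob_same_order (\<lambda>n. measure_pmf (growing_graph \<gamma> (\<beta> n) n))
          (\<lambda>n G. real (card (largest_component {1..n} G)))
          (\<lambda>n. sqrt \<bar>\<beta> n - beta_crit \<gamma>\<bar> *
                real n powr (1/2 - sqrt (4 * beta_crit \<gamma> * \<bar>\<beta> n - beta_crit \<gamma>\<bar>)))) \<and>
     (-\<infinity> < \<alpha> \<and> \<alpha> < ereal (pi\<^sup>2) \<longrightarrow>
        prob_same_order (\<lambda>n. measure_pmf (growing_graph \<gamma> (\<beta> n) n))
          (\<lambda>n G. real (card (largest_component {1..n} G)))
          (\<lambda>n. sqrt (real n) / ln (real n))) \<and>
     (ereal (pi\<^sup>2) \<le> \<alpha> \<longrightarrow>
        prob_much_greater (\<lambda>n. measure_pmf (growing_graph \<gamma> (\<beta> n) n))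
          (\<lambda>n G. real (card (largest_component {1..n} G)))
          (\<lambda>n. sqrt (real n) / ln (real n)))"
proof (intro conjI impI)
  have lim: "(\<lambda>n. ereal (offset \<gamma> \<beta> n)) \<longlonglongrightarrow> \<alpha>"
    using assms(5) by (simp only: offset_def)
  have le: "\<forall>\<^sub>F n in sequentially. offset \<gamma> \<beta> n \<le> y" if "\<alpha> < ereal y" for y
    using order_tendstoD(2)[OF lim that] by (auto elim: eventually_mono)
  have ge: "\<forall>\<^sub>F n in sequentially. y \<le> offset \<gamma> \<beta> n" if "ereal y < \<alpha>" for y
    using order_tendstoD(1)[OF lim that] by (auto elim: eventually_mono)
  have \<beta>: "\<forall>\<^sub>F n in sequentially. 0 \<le> \<beta> n"
    using eventually_ge_at_top[of 1] by eventually_elim (use assms(3) less_imp_le in blast)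
  show "prob_same_order (\<lambda>n. measure_pmf (growing_graph \<gamma> (\<beta> n) n))
          (\<lambda>n G. real (card (largest_component {1..n} G)))
          (\<lambda>n. sqrt \<bar>\<beta> n - beta_crit \<gamma>\<bar> *
                real n powr (1/2 - sqrt (4 * beta_crit \<gamma> * \<bar>\<beta> n - beta_crit \<gamma>\<bar>)))" if "\<alpha> < 0"
  proof -
    obtain r where r: "\<alpha> < ereal r" "ereal r < 0"
      using ereal_dense2[OF \<open>\<alpha> < 0\<close>] by auto
    have off: "\<forall>\<^sub>F n in sequentially. offset \<gamma> \<beta> n \<le> - (- r)" using le[OF r(1)] by simp
    have pos: "0 < - r" using r(2) by simp
    show ?thesis
      by (rule prob_same_order_of_tight; rule subcritical[OF assms(1,2) \<beta> assms(4) off pos])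
  qed
  show "prob_same_order (\<lambda>n. measure_pmf (growing_graph \<gamma> (\<beta> n) n))
          (\<lambda>n G. real (card (largest_component {1..n} G))) (\<lambda>n. sqrt (real n) / ln (real n))"
    if \<alpha>: "-\<infinity> < \<alpha> \<and> \<alpha> < ereal (pi\<^sup>2)"
  proof (rule prob_same_order_of_tight)
    \<comment> \<open>Since \<alpha> may be negative, the maximum with 0 ensures a positive phase
      \<open>x\<close>; the minimum below does the same for the \<open>sinh\<close> wave.\<close>
    obtain r where r: "max 0 \<alpha> < ereal r" "ereal r < ereal (pi\<^sup>2)"
      using ereal_dense2[of "max 0 \<alpha>" "ereal (pi\<^sup>2)"] \<alpha> by auto
    obtain x where x: "0 < x" "x < pi" "x\<^sup>2 = r"
      using square_root_below_pi[of r] r by auto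
    show "tight_above \<gamma> \<beta> (\<lambda>n. sqrt (real n) / ln (real n))"
      using le[of r] r x by (intro window_tight_above[OF assms(1,2) x(1,2) \<beta>]) auto
    obtain s where s: "ereal s < min 0 \<alpha>"
      using ereal_dense2[of "-\<infinity>" "min 0 \<alpha>"] \<alpha> by auto
    show "tight_below \<gamma> \<beta> (\<lambda>n. sqrt (real n) / ln (real n))"
      using ge[of s] s by (intro window_tight_below[OF assms(1,2), of "sqrt (- s)"]) auto
    show "\<forall>\<^sub>F n in sequentially. 0 < sqrt (real n) / ln (real n)"
      using eventually_gt_at_top[of 1] by eventually_elim auto
  qed
  show "prob_much_greater (\<lambda>n. measure_pmf (growing_graph \<gamma> (\<beta> n) n))
          (\<lambda>n G. real (card (largest_component {1..n} G))) (\<lambda>n. sqrt (real n) / ln (real n))"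
    if "ereal (pi\<^sup>2) \<le> \<alpha>"
    \<comment> \<open>Every \<open>y\<close> below \<open>pi\<^sup>2\<close> lies strictly below
      \<alpha>, also when \<alpha> equals \<open>pi\<^sup>2\<close>; this is how the boundary value
      falls on the supercritical side.\<close>
    using ge that by (intro supercritical[OF assms(1,2)]) (meson ereal_less_eq(3) less_le_trans less_ereal.simps(1))
qed

end
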